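(* There exists a normal uniform algebra $A$, on a compact metrizable space $X$, such that every point of $X$ is a peak point for $A$ but $A$ is not strongly regular.
   Context: All spaces are Hausdorff. For $X$ compact, $C(X)$ is the algebra of continuous complex-valued functions on $X$ with the supremum norm. A uniform algebra on $X$ is a closed subalgebra of $C(X)$ that contains the constants and separates the points of $X$. A uniform algebra $A$ on $X$ is natural if its maximal ideal space is $X$ (identifying points with evaluation functionals). $A$ is normal on $X$ if for each pair of disjoint closed sets $K_0,K_1\subset X$ there is $f\in A$ with $f=1$ on $K_1$ and $f=0$ on $K_0$; $A$ is normal if it is natural and normal on $X$. For $x\in X$, $M_x=\{f\in A: f(x)=0\}$ and $J_x=\{f\in A: f^{-1}(0)\text{ contains a neighborhood of }x\text{ in }X\}$. $A$ is strongly regular at $x$ if $\overline{J_x}=M_x$, and $A$ is strongly regular if it is strongly regular at every point of $X$. The point $x$ is a peak point for $A$ if there is $f\in A$ with $f(x)=1$ and $|f(y)|<1$ for every $y\in X\setminus\{x\}$. *)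

theory Defs
  imports "HOL-Analysis.Analysis"
begin

text \<open>
  Functions on a space \<open>X\<close> are represented by functions on the ambient type that are
  extensional on the carrier, i.e. have a fixed dummy value outside \<^term>\<open>topspace X\<close>. The
  algebraic operations are therefore restricted to the carrier. With this convention the metric
  space \<^const>\<open>cfunspace\<close> of bounded continuous functions under the supremum metric is,
  for compact \<open>X\<close>, exactly $C(X)$ with the metric of its supremum norm
  (\<open>compactin_mspace_cfunspace\<close>, \<open>cfunspace_mdist_le\<close>).
\<close>

definition C_metric :: "'a topology \<Rightarrow> ('a \<Rightarrow> complex) metric" where
  "C_metric X = cfunspace X (euclidean_metric :: complex metric)"

definition fconst :: "'a topology \<Rightarrow> complex \<Rightarrow> 'a \<Rightarrow> complex" where
  "fconst X c = (\<lambda>x\<in>topspace X. c)"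

definition fadd :: "'a topology \<Rightarrow> ('a \<Rightarrow> complex) \<Rightarrow> ('a \<Rightarrow> complex) \<Rightarrow> 'a \<Rightarrow> complex" where
  "fadd X f g = (\<lambda>x\<in>topspace X. f x + g x)"

definition fmult :: "'a topology \<Rightarrow> ('a \<Rightarrow> complex) \<Rightarrow> ('a \<Rightarrow> complex) \<Rightarrow> 'a \<Rightarrow> complex" where
  "fmult X f g = (\<lambda>x\<in>topspace X. f x * g x)"

definition fscale :: "'a topology \<Rightarrow> complex \<Rightarrow> ('a \<Rightarrow> complex) \<Rightarrow> 'a \<Rightarrow> complex" where
  "fscale X c f = (\<lambda>x\<in>topspace X. c * f x)"

definition subalgebra_C :: "'a topology \<Rightarrow> ('a \<Rightarrow> complex) set \<Rightarrow> bool" where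
  "subalgebra_C X A \<longleftrightarrow>
     A \<subseteq> mspace (C_metric X) \<and>
     fconst X 0 \<in> A \<and>
     (\<forall>f\<in>A. \<forall>g\<in>A. fadd X f g \<in> A) \<and>
     (\<forall>f\<in>A. \<forall>g\<in>A. fmult X f g \<in> A) \<and>
     (\<forall>c. \<forall>f\<in>A. fscale X c f \<in> A)"

definition uniform_algebra :: "'a topology \<Rightarrow> ('a \<Rightarrow> complex) set \<Rightarrow> bool" where
  "uniform_algebra X A \<longleftrightarrow>
     compact_space X \<and> Hausdorff_space X \<and>
     subalgebra_C X A \<and>
     closedin (mtopology_of (C_metric X)) A \<and>
     (\<forall>c. fconst X c \<in> A) \<and>
     (\<forall>x\<in>topspace X. \<forall>y\<in>topspace X. x \<noteq> y \<longrightarrow> (\<exists>f\<in>A. f x \<noteq> f y))"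

text \<open>
  The maximal ideal space is the set of nonzero multiplicative linear functionals on \<open>A\<close>, with
  the Gelfand (weak-star) topology, which is the topology of pointwise convergence on \<open>A\<close>.
  Functionals are extensional on \<open>A\<close>, so that distinct elements differ on \<open>A\<close>.
\<close>

definition characters :: "'a topology \<Rightarrow> ('a \<Rightarrow> complex) set \<Rightarrow> (('a \<Rightarrow> complex) \<Rightarrow> complex) set" where
  "characters X A =
     {\<phi>. \<phi> \<in> extensional A \<and>
         (\<forall>f\<in>A. \<forall>g\<in>A. \<phi> (fadd X f g) = \<phi> f + \<phi> g) \<and>
         (\<forall>c. \<forall>f\<in>A. \<phi> (fscale X c f) = c * \<phi> f) \<and>
         (\<forall>f\<in>A. \<forall>g\<in>A. \<phi> (fmult X f g) = \<phi> f * \<phi> g) \<and>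
         (\<exists>f\<in>A. \<phi> f \<noteq> 0)}"

definition maximal_ideal_space ::
    "'a topology \<Rightarrow> ('a \<Rightarrow> complex) set \<Rightarrow> (('a \<Rightarrow> complex) \<Rightarrow> complex) topology" where
  "maximal_ideal_space X A =
     subtopology (product_topology (\<lambda>_. euclidean) A) (characters X A)"

definition natural_uniform_algebra :: "'a topology \<Rightarrow> ('a \<Rightarrow> complex) set \<Rightarrow> bool" where
  "natural_uniform_algebra X A \<longleftrightarrow>
     uniform_algebra X A \<and>
     homeomorphic_map X (maximal_ideal_space X A) (\<lambda>x. \<lambda>f\<in>A. f x)"

definition normal_on :: "'a topology \<Rightarrow> ('a \<Rightarrow> complex) set \<Rightarrow> bool" where
  "normal_on X A \<longleftrightarrow>
     (\<forall>K0 K1. closedin X K0 \<and> closedin X K1 \<and> K0 \<inter> K1 = {} \<longrightarrow>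
        (\<exists>f\<in>A. (\<forall>x\<in>K1. f x = 1) \<and> (\<forall>x\<in>K0. f x = 0)))"

definition normal_uniform_algebra :: "'a topology \<Rightarrow> ('a \<Rightarrow> complex) set \<Rightarrow> bool" where
  "normal_uniform_algebra X A \<longleftrightarrow> natural_uniform_algebra X A \<and> normal_on X A"

definition M_ideal :: "('a \<Rightarrow> complex) set \<Rightarrow> 'a \<Rightarrow> ('a \<Rightarrow> complex) set" where
  "M_ideal A x = {f \<in> A. f x = 0}"

definition J_ideal :: "'a topology \<Rightarrow> ('a \<Rightarrow> complex) set \<Rightarrow> 'a \<Rightarrow> ('a \<Rightarrow> complex) set" where
  "J_ideal X A x = {f \<in> A. \<exists>U. openin X U \<and> x \<in> U \<and> (\<forall>y\<in>U. f y = 0)}"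

definition strongly_regular_at :: "'a topology \<Rightarrow> ('a \<Rightarrow> complex) set \<Rightarrow> 'a \<Rightarrow> bool" where
  "strongly_regular_at X A x \<longleftrightarrow>
     mtopology_of (C_metric X) closure_of J_ideal X A x = M_ideal A x"

definition strongly_regular :: "'a topology \<Rightarrow> ('a \<Rightarrow> complex) set \<Rightarrow> bool" where
  "strongly_regular X A \<longleftrightarrow> (\<forall>x\<in>topspace X. strongly_regular_at X A x)"

definition peak_point :: "'a topology \<Rightarrow> ('a \<Rightarrow> complex) set \<Rightarrow> 'a \<Rightarrow> bool" where
  "peak_point X A x \<longleftrightarrow> (\<exists>f\<in>A. f x = 1 \<and> (\<forall>y\<in>topspace X - {x}. cmod (f y) < 1))"

end

theory Submission
  imports Defs "HOL-Complex_Analysis.Complex_Analysis"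
begin

text \<open>
  The plane part is a Swiss cheese \<open>K\<close> in the half plane \<open>Re z \<ge> 0\<close> with \<open>0\<close> on its boundary. Its holes are
  dyadic squares centred at the poles of functions \<open>1 / (1 - exp w)\<close> which are close to \<open>1\<close> on one side
  of a line and close to \<open>0\<close> on the other; from these, an alternating iteration produces functions that
  are exactly \<open>1\<close> on one half plane and exactly \<open>0\<close> on another, which gives normality. Any two dyadic
  squares are nested or disjoint, so the poles of an approximating function are enclosed by disjoint
  maximal holes whose boundaries lie in \<open>K\<close>. The holes are so small that the contour integral against
  \<open>exp (1 / z)\<close> over all boundaries is finite. It annihilates, up to arbitrarily small errors, the
  functions vanishing near \<open>0\<close>, but not the function \<open>z\<close>; so strong regularity fails at the peak point \<open>0\<close>.

  To make every other point a peak point, roots of all orders are adjoined to countably many functions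
  \<open>h\<close> that vanish at \<open>0\<close>. If \<open>h x = 1\<close> and \<open>h\<close> lives near \<open>x\<close>, a root of high order has norm almost \<open>1\<close>,
  and Bishop's summation yields a peak function. The fibre over \<open>0\<close> is a single point, and averaging over
  the rotations of the roots carries the failure of strong regularity upstairs.
\<close>

subsection \<open>Uniform closures of function algebras\<close>

text \<open>The kernel \<open>exp (1 / z)\<close> is an essential singularity by design. It has
  modulus \<open>1\<close> on the imaginary axis and at most \<open>1\<close> to the left of it, so
  the edge of the frame through \<open>0\<close> carries finite mass, which would fail for a
  negative power of \<open>z\<close>. Towards the right it grows, but a cutoff with threshold
  \<open>a > 0\<close> makes holes only at distance at least \<open>a\<close> from \<open>0\<close>,
  where the kernel is bounded by \<open>exp (1 / a)\<close>, and this bound is known before the size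
  of those holes is fixed. Small holes have a price: the bound for a function with poles in them
  grows like \<open>2 ^ q\<close>, so the cutoffs come without useful norm bounds and do not by
  themselves yield peak functions away from \<open>0\<close>. A root of degree \<open>d\<close>
  turns a bound \<open>B\<close> into \<open>B ^ (1 / d)\<close>; this is why roots are adjoined.
  Each radicand vanishes at \<open>0\<close>, so a function vanishing near the point over
  \<open>0\<close> vanishes over a whole neighbourhood of \<open>0\<close> in the plane, as the
  averaging requires. The test for strong regularity is quantitative: a tolerance depending on the
  radius alone survives both approximation and averaging.\<close>

definition uclosure :: "'a set \<Rightarrow> ('a \<Rightarrow> complex) set \<Rightarrow> ('a \<Rightarrow> complex) set" where
  "uclosure S P = {f. \<forall>e>0. \<exists>p\<in>P. \<forall>x\<in>S. cmod (f x - p x) < e}"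

lemma uclosureD: "f \<in> uclosure S P \<Longrightarrow> e > 0 \<Longrightarrow> \<exists>p\<in>P. \<forall>x\<in>S. cmod (f x - p x) < e"
  unfolding uclosure_def by blast

lemma uclosure_uclosure:
  assumes "\<And>e. e > 0 \<Longrightarrow> \<exists>p\<in>uclosure S P. \<forall>x\<in>S. cmod (f x - p x) < e"
  shows "f \<in> uclosure S P"
  unfolding uclosure_def
proof (intro CollectI allI impI)
  fix e :: real assume e: "e > 0"
  then obtain g where g: "g \<in> uclosure S P" "\<forall>x\<in>S. cmod (f x - g x) < e/2"
    using assms[of "e/2"] by auto
  then obtain p where p: "p \<in> P" "\<forall>x\<in>S. cmod (g x - p x) < e/2"
    using e uclosureD[of g S P "e/2"] by auto
  have "cmod (f x - p x) < e" if "x \<in> S" for x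
  proof -
    have "cmod (f x - g x) < e/2" "cmod (g x - p x) < e/2" using g(2) p(2) that by auto
    then show ?thesis using norm_triangle_ineq[of "f x - g x" "g x - p x"] by simp
  qed
  with p(1) show "\<exists>p\<in>P. \<forall>x\<in>S. cmod (f x - p x) < e" by blast
qed

lemma uclosure_base: "p \<in> P \<Longrightarrow> p \<in> uclosure S P"
  unfolding uclosure_def by (intro CollectI allI impI bexI[of _ p]) auto

lemma uclosure_cong:
  assumes "f \<in> uclosure S P" "\<And>x. x \<in> S \<Longrightarrow> f x = g x"
  shows "g \<in> uclosure S P"
  unfolding uclosure_def
proof (intro CollectI allI impI)
  fix e :: real assume "e > 0"
  from uclosureD[OF assms(1) this] show "\<exists>p\<in>P. \<forall>x\<in>S. cmod (g x - p x) < e" using assms(2) by simp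
qed

lemma uclosure_unif_lim:
  assumes F: "\<And>n. F n \<in> uclosure S P" and f: "uniform_limit S F f sequentially"
  shows "f \<in> uclosure S P"
proof (rule uclosure_uclosure)
  fix e :: real assume "e > 0"
  then have "\<forall>\<^sub>F n in sequentially. \<forall>x\<in>S. dist (F n x) (f x) < e"
    using f by (simp add: uniform_limit_iff)
  then obtain n where "\<forall>x\<in>S. dist (F n x) (f x) < e"
    unfolding eventually_sequentially by blast
  then show "\<exists>p\<in>uclosure S P. \<forall>x\<in>S. cmod (f x - p x) < e"
    using F by (auto simp: dist_norm norm_minus_commute intro!: bexI[of _ "F n"])
qed

text \<open>Serves twice: for the plane set \<open>cheese\<close> with the functions of
  \<open>mero\<close>, and for \<open>cover\<close> with polynomials in the adjoined roots. All
  functions here are total and only their values on \<open>S\<close> count, which keeps the algebra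
  free of \<open>restrict\<close>.\<close>

locale fun_algebra =
  fixes S :: "'a::metric_space set" and P :: "('a \<Rightarrow> complex) set"
  assumes compS: "compact S" and Sne: "S \<noteq> {}"
    and P_const: "(\<lambda>_. c) \<in> P"
    and P_add: "\<lbrakk>f \<in> P; g \<in> P\<rbrakk> \<Longrightarrow> (\<lambda>x. f x + g x) \<in> P"
    and P_mult: "\<lbrakk>f \<in> P; g \<in> P\<rbrakk> \<Longrightarrow> (\<lambda>x. f x * g x) \<in> P"
    and P_cont: "f \<in> P \<Longrightarrow> continuous_on S f"
begin

abbreviation "cl \<equiv> uclosure S P"

lemma cl_cont: "f \<in> cl \<Longrightarrow> continuous_on S f"
proof -
  assume f: "f \<in> cl"
  have "\<exists>p\<in>P. \<forall>x\<in>S. cmod (f x - p x) < 1 / Suc n" for n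
    using uclosureD[OF f, of "1 / Suc n"] by simp
  then obtain p where p: "\<And>n. p n \<in> P" "\<And>n x. x \<in> S \<Longrightarrow> cmod (f x - p n x) < 1 / Suc n"
    by metis
  have "uniform_limit S p f sequentially"
    unfolding uniform_limit_iff
  proof (intro allI impI)
    fix e :: real assume "e > 0"
    then obtain N where N: "1 / Suc N < e" using nat_approx_posE by blast
    have "dist (p n x) (f x) < e" if "n \<ge> N" "x \<in> S" for n x
    proof -
      have "1 / Suc n \<le> 1 / Suc N" using that by (intro divide_left_mono) auto
      then show ?thesis using p(2)[OF that(2), of n] N by (simp add: dist_norm norm_minus_commute)
    qed
    then show "\<forall>\<^sub>F n in sequentially. \<forall>x\<in>S. dist (p n x) (f x) < e"
      using eventually_sequentially by blast
  qed
  then show ?thesis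
    by (rule uniform_limit_theorem[rotated]) (auto simp: p P_cont)
qed

lemma cl_bounded: "f \<in> cl \<Longrightarrow> \<exists>B>0. \<forall>x\<in>S. cmod (f x) \<le> B"
  using compact_imp_bounded[OF compact_continuous_image[OF cl_cont compS]]
  by (meson bounded_pos imageI)

lemma cl_const [simp]: "(\<lambda>_. c) \<in> cl"
  by (simp add: uclosure_base P_const)

lemma cl_add: assumes "f \<in> cl" "g \<in> cl" shows "(\<lambda>x. f x + g x) \<in> cl"
  unfolding uclosure_def
proof (intro CollectI allI impI)
  fix e :: real assume "e > 0"
  then obtain p q where pq: "p \<in> P" "\<forall>x\<in>S. cmod (f x - p x) < e/2" "q \<in> P" "\<forall>x\<in>S. cmod (g x - q x) < e/2"
    using uclosureD[OF assms(1), of "e/2"] uclosureD[OF assms(2), of "e/2"] by auto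
  have "cmod (f x + g x - (p x + q x)) < e" if "x \<in> S" for x
  proof -
    have eq: "f x + g x - (p x + q x) = (f x - p x) + (g x - q x)" by simp
    show ?thesis
      unfolding eq using bspec[OF pq(2) that] bspec[OF pq(4) that] norm_triangle_ineq[of "f x - p x" "g x - q x"] by linarith
  qed
  with P_add[OF pq(1,3)] show "\<exists>p\<in>P. \<forall>x\<in>S. cmod (f x + g x - p x) < e" by (intro bexI) auto
qed

lemma cl_mult: assumes "f \<in> cl" "g \<in> cl" shows "(\<lambda>x. f x * g x) \<in> cl"
  unfolding uclosure_def
proof (intro CollectI allI impI)
  fix e :: real assume e: "e > 0"
  obtain B where B: "B > 0" "\<forall>x\<in>S. cmod (f x) \<le> B" using cl_bounded assms by blast
  obtain q where q: "q \<in> P" "\<forall>x\<in>S. cmod (g x - q x) < e/(2*B)"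
    using uclosureD[OF assms(2), of "e/(2*B)"] B e by auto
  obtain C where C: "C > 0" "\<forall>x\<in>S. cmod (q x) \<le> C" using cl_bounded uclosure_base q(1) by metis
  obtain p where p: "p \<in> P" "\<forall>x\<in>S. cmod (f x - p x) < e/(2*C)"
    using uclosureD[OF assms(1), of "e/(2*C)"] C e by auto
  have "cmod (f x * g x - (p x * q x)) < e" if x: "x \<in> S" for x
  proof -
    have "f x * g x - (p x * q x) = f x * (g x - q x) + (f x - p x) * q x"
      by (simp add: algebra_simps)
    then have "cmod (f x * g x - (p x * q x)) \<le> cmod (f x) * cmod (g x - q x) + cmod (f x - p x) * cmod (q x)"
      by (metis norm_mult norm_triangle_ineq)
    also have "cmod (f x) * cmod (g x - q x) \<le> B * cmod (g x - q x)"
      using B x by (intro mult_right_mono) auto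
    also have "B * cmod (g x - q x) < B * (e/(2*B))"
      using B q x by (intro mult_strict_left_mono) auto
    also have "cmod (f x - p x) * cmod (q x) \<le> e/(2*C) * C"
      using C p x e by (intro mult_mono) (auto simp: less_imp_le)
    finally show ?thesis using B C e by (simp add: field_simps)
  qed
  with P_mult[OF p(1) q(1)] show "\<exists>p\<in>P. \<forall>x\<in>S. cmod (f x * g x - p x) < e" by (intro bexI) auto
qed

lemma cl_scale: "f \<in> cl \<Longrightarrow> (\<lambda>x. c * f x) \<in> cl"
  using cl_mult[of "\<lambda>_. c" f] by simp

lemma cl_diff: "f \<in> cl \<Longrightarrow> g \<in> cl \<Longrightarrow> (\<lambda>x. f x - g x) \<in> cl"
  using cl_add[of f "\<lambda>x. -1 * g x"] cl_scale[of g "-1"] by simp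

lemma cl_power: "f \<in> cl \<Longrightarrow> (\<lambda>x. f x ^ n) \<in> cl"
  by (induction n) (auto intro: cl_mult)

lemma cl_sum: "finite I \<Longrightarrow> (\<And>i. i \<in> I \<Longrightarrow> f i \<in> cl) \<Longrightarrow> (\<lambda>x. \<Sum>i\<in>I. f i x) \<in> cl"
  by (induction I rule: finite_induct) (auto intro: cl_add)

lemma cl_prod: "finite I \<Longrightarrow> (\<And>i. i \<in> I \<Longrightarrow> f i \<in> cl) \<Longrightarrow> (\<lambda>x. \<Prod>i\<in>I. f i x) \<in> cl"
  by (induction I rule: finite_induct) (auto intro: cl_mult)

lemma cl_suminf:
  assumes f: "\<And>n. f n \<in> cl" and M: "\<And>n x. x \<in> S \<Longrightarrow> cmod (f n x) \<le> M n" and sM: "summable M"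
  shows "(\<lambda>x. \<Sum>n. f n x) \<in> cl"
proof (rule uclosure_unif_lim)
  show "uniform_limit S (\<lambda>n x. \<Sum>i<n. f i x) (\<lambda>x. \<Sum>n. f n x) sequentially"
    using M sM by (rule Weierstrass_m_test)
  show "(\<lambda>x. \<Sum>i<n. f i x) \<in> cl" for n
    using f by (intro cl_sum) auto
qed

section \<open>The closed algebra as a set of extensional functions\<close>

definition "Alg = {f \<in> extensional S. f \<in> cl}"

lemma restrict_Alg [simp]: "restrict f S \<in> Alg \<longleftrightarrow> f \<in> cl"
  unfolding Alg_def using uclosure_cong[of f S P "restrict f S"] uclosure_cong[of "restrict f S" S P f] by auto

lemma Alg_restrict: "f \<in> Alg \<Longrightarrow> restrict f S = f"
  by (simp add: Alg_def extensional_restrict)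

lemma Alg_cl: "f \<in> Alg \<Longrightarrow> f \<in> cl"
  by (simp add: Alg_def)

lemma mspace_C: "mspace (C_metric (top_of_set S)) = {f \<in> extensional S. continuous_on S f}"
  using compS compactin_mspace_cfunspace[of "top_of_set S" "euclidean_metric :: complex metric"]
  by (simp add: C_metric_def compactin_subtopology del: mspace_cfunspace)

lemma Alg_mspace: "Alg \<subseteq> mspace (C_metric (top_of_set S))"
  unfolding mspace_C using cl_cont by (auto simp: Alg_def)

lemma mdist_C_le:
  assumes "f \<in> mspace (C_metric (top_of_set S))" "g \<in> mspace (C_metric (top_of_set S))"
  shows "mdist (C_metric (top_of_set S)) f g \<le> e \<longleftrightarrow> (\<forall>x\<in>S. cmod (f x - g x) \<le> e)"
  using cfunspace_mdist_le[of f "top_of_set S" euclidean_metric g e] assms Sne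
  by (simp add: C_metric_def dist_norm)

text \<open>Closed balls are used because a bound by \<open>\<le>\<close> on the supremum metric is
  the same as a pointwise bound. This turns \<open>strongly_regular_at\<close> into a statement
  about uniform approximation.\<close>

lemma closure_C:
  assumes "B \<subseteq> mspace (C_metric (top_of_set S))"
  shows "mtopology_of (C_metric (top_of_set S)) closure_of B =
     {f \<in> mspace (C_metric (top_of_set S)). \<forall>e>0. \<exists>g\<in>B. \<forall>x\<in>S. cmod (f x - g x) \<le> e}"
proof -
  let ?m = "C_metric (top_of_set S)"
  interpret Metric_space "mspace ?m" "mdist ?m" by simp
  have eq: "mtopology_of ?m = mtopology" by (simp add: mtopology_of_def)
  have "(\<exists>g\<in>B. g \<in> mcball f e) \<longleftrightarrow> (\<exists>g\<in>B. \<forall>x\<in>S. cmod (f x - g x) \<le> e)"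
    if f: "f \<in> mspace ?m" for f e
    unfolding mcball_def using mdist_C_le[OF f] f assms by blast
  then show ?thesis
    unfolding eq metric_closure_of_alt by (intro Collect_cong conj_cong refl all_cong1 imp_cong) auto
qed

lemma uniform_algebra_Alg:
  assumes sep: "\<And>x y. \<lbrakk>x \<in> S; y \<in> S; x \<noteq> y\<rbrakk> \<Longrightarrow> \<exists>f\<in>cl. f x \<noteq> f y"
  shows "uniform_algebra (top_of_set S) Alg"
  unfolding uniform_algebra_def
proof (intro conjI)
  let ?X = "top_of_set S" let ?m = "C_metric ?X"
  show "compact_space ?X" using compS by (simp add: compact_space_subtopology)
  show "Hausdorff_space ?X" by (simp add: Hausdorff_space_subtopology)
  show "subalgebra_C ?X Alg"
    unfolding subalgebra_C_def fconst_def fadd_def fmult_def fscale_def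
    using Alg_mspace by (auto intro!: cl_add cl_mult cl_scale dest: Alg_cl)
  have "mtopology_of ?m closure_of Alg \<subseteq> Alg"
  proof
    fix f assume "f \<in> mtopology_of ?m closure_of Alg"
    then have f: "f \<in> extensional S" and fe: "\<And>e. e > 0 \<Longrightarrow> \<exists>g\<in>Alg. \<forall>x\<in>S. cmod (f x - g x) \<le> e"
      unfolding closure_C[OF Alg_mspace] mspace_C by auto
    have "f \<in> cl"
    proof (rule uclosure_uclosure)
      fix e :: real assume "e > 0"
      then obtain g where g: "g \<in> Alg" "\<forall>x\<in>S. cmod (f x - g x) \<le> e/2" using fe[of "e/2"] by auto
      then show "\<exists>p\<in>cl. \<forall>x\<in>S. cmod (f x - p x) < e"
        using \<open>e > 0\<close> Alg_cl by (intro bexI[of _ g]) force+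
    qed
    then show "f \<in> Alg" using f by (simp add: Alg_def)
  qed
  then show "closedin (mtopology_of ?m) Alg"
    using closure_of_subset_eq Alg_mspace by (metis topspace_mtopology_of)
  show "\<forall>c. fconst ?X c \<in> Alg" by (simp add: fconst_def)
  show "\<forall>x\<in>topspace ?X. \<forall>y\<in>topspace ?X. x \<noteq> y \<longrightarrow> (\<exists>f\<in>Alg. f x \<noteq> f y)"
  proof (intro ballI impI)
    fix x y assume "x \<in> topspace ?X" "y \<in> topspace ?X" "x \<noteq> y"
    then obtain f where "f \<in> cl" "f x \<noteq> f y" "x \<in> S" "y \<in> S" using sep by auto
    then show "\<exists>f\<in>Alg. f x \<noteq> f y" by (intro bexI[of _ "restrict f S"]) auto
  qed
qed

section \<open>Characters and the maximal ideal space\<close>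

definition character :: "(('a \<Rightarrow> complex) \<Rightarrow> complex) \<Rightarrow> bool" where
  "character \<psi> \<longleftrightarrow> (\<forall>f\<in>cl. \<forall>g\<in>cl. \<psi> (\<lambda>x. f x + g x) = \<psi> f + \<psi> g) \<and>
      (\<forall>f\<in>cl. \<forall>g\<in>cl. \<psi> (\<lambda>x. f x * g x) = \<psi> f * \<psi> g) \<and>
      (\<forall>c. \<psi> (\<lambda>x. c) = c) \<and>
      (\<forall>f g. (\<forall>x\<in>S. f x = g x) \<longrightarrow> \<psi> f = \<psi> g)"

text \<open>Precomposition with \<open>restrict\<close> moves a functional to total functions. The
  clause of \<open>character\<close> on functions agreeing on \<open>S\<close> records this origin;
  the clause on constants combines homogeneity with being nonzero.\<close>

lemma characters_imp_character:
  assumes "\<phi> \<in> characters (top_of_set S) Alg"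
  shows "character (\<lambda>f. \<phi> (restrict f S))"
proof -
  have add: "\<phi> (restrict (\<lambda>x. f x + g x) S) = \<phi> (restrict f S) + \<phi> (restrict g S)" if "f \<in> cl" "g \<in> cl" for f g
  proof -
    have "\<phi> (fadd (top_of_set S) (restrict f S) (restrict g S)) = \<phi> (restrict f S) + \<phi> (restrict g S)"
      using assms that unfolding characters_def by auto
    moreover have "fadd (top_of_set S) (restrict f S) (restrict g S) = restrict (\<lambda>x. f x + g x) S"
      by (auto simp: fadd_def)
    ultimately show ?thesis by simp
  qed
  have mult: "\<phi> (restrict (\<lambda>x. f x * g x) S) = \<phi> (restrict f S) * \<phi> (restrict g S)" if "f \<in> cl" "g \<in> cl" for f g
  proof -
    have "\<phi> (fmult (top_of_set S) (restrict f S) (restrict g S)) = \<phi> (restrict f S) * \<phi> (restrict g S)"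
      using assms that unfolding characters_def by auto
    moreover have "fmult (top_of_set S) (restrict f S) (restrict g S) = restrict (\<lambda>x. f x * g x) S"
      by (auto simp: fmult_def)
    ultimately show ?thesis by simp
  qed
  have scale: "\<phi> (restrict (\<lambda>x. c * f x) S) = c * \<phi> (restrict f S)" if "f \<in> cl" for c f
  proof -
    have "\<phi> (fscale (top_of_set S) c (restrict f S)) = c * \<phi> (restrict f S)"
      using assms that unfolding characters_def by auto
    moreover have "fscale (top_of_set S) c (restrict f S) = restrict (\<lambda>x. c * f x) S"
      by (auto simp: fscale_def)
    ultimately show ?thesis by simp
  qed
  obtain f where f: "f \<in> cl" "\<phi> (restrict f S) \<noteq> 0"
    using assms Alg_cl Alg_restrict unfolding characters_def by force
  have one: "\<phi> (restrict (\<lambda>x. 1) S) = 1"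
    using mult[of f "\<lambda>_. 1"] f by simp
  have const: "\<phi> (restrict (\<lambda>x. c) S) = c" for c
    using scale[of "\<lambda>_. 1" c] one by simp
  have "restrict f S = restrict g S" if "\<forall>x\<in>S. f x = g x" for f g :: "'a \<Rightarrow> complex"
    using that by (auto simp: restrict_def)
  then show ?thesis
    unfolding character_def by (intro conjI ballI allI impI) (simp_all only: add mult const)
qed

context
  fixes \<psi> assumes char: "character \<psi>"
begin

lemma char_add: "f \<in> cl \<Longrightarrow> g \<in> cl \<Longrightarrow> \<psi> (\<lambda>x. f x + g x) = \<psi> f + \<psi> g"
  and char_mult: "f \<in> cl \<Longrightarrow> g \<in> cl \<Longrightarrow> \<psi> (\<lambda>x. f x * g x) = \<psi> f * \<psi> g"
  and char_const: "\<psi> (\<lambda>x. c) = c"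
  and char_cong: "(\<And>x. x \<in> S \<Longrightarrow> f x = g x) \<Longrightarrow> \<psi> f = \<psi> g"
  using char unfolding character_def by auto

lemma char_diff: assumes "f \<in> cl" "g \<in> cl" shows "\<psi> (\<lambda>x. f x - g x) = \<psi> f - \<psi> g"
proof -
  have "\<psi> f = \<psi> (\<lambda>x. (f x - g x) + g x)" by simp
  also have "\<dots> = \<psi> (\<lambda>x. f x - g x) + \<psi> g" using assms by (intro char_add cl_diff) auto
  finally show ?thesis by simp
qed

lemma char_power: "f \<in> cl \<Longrightarrow> \<psi> (\<lambda>x. f x ^ n) = \<psi> f ^ n"
  by (induction n) (auto simp: char_const char_mult cl_power)

lemma char_prod: "finite I \<Longrightarrow> (\<And>i. i \<in> I \<Longrightarrow> f i \<in> cl) \<Longrightarrow> \<psi> (\<lambda>x. \<Prod>i\<in>I. f i x) = (\<Prod>i\<in>I. \<psi> (f i))"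
  by (induction I rule: finite_induct) (auto simp: char_const char_mult cl_prod)

lemma char_nonzero:
  assumes "f \<in> cl" "g \<in> cl" "\<And>x. x \<in> S \<Longrightarrow> f x * g x = 1"
  shows "\<psi> f \<noteq> 0"
  using char_mult[OF assms(1,2)] char_cong[of "\<lambda>x. f x * g x" "\<lambda>_. 1"] assms(3) char_const[of 1] by auto

text \<open>If \<open>\<psi> f\<close> exceeded the supremum of \<open>\<bar>f\<bar>\<close>, the Neumann series would invert
  \<open>1 - f / \<psi> f\<close>, which lies in the kernel of \<open>\<psi>\<close>.\<close>

lemma char_bound:
  assumes f: "f \<in> cl" and B: "\<And>x. x \<in> S \<Longrightarrow> cmod (f x) \<le> B"
  shows "cmod (\<psi> f) \<le> B"
proof (rule ccontr)
  assume "\<not> cmod (\<psi> f) \<le> B"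
  then have lt: "B < cmod (\<psi> f)" by simp
  have "B \<ge> 0" using B Sne norm_ge_zero order_trans by blast
  define l where "l = \<psi> f"
  have l0: "l \<noteq> 0" using lt \<open>B \<ge> 0\<close> by (auto simp: l_def)
  define F where "F = (\<lambda>x. inverse l * f x)"
  have F: "F \<in> cl" unfolding F_def using f by (rule cl_scale)
  define r where "r = B / cmod l"
  have r: "0 \<le> r" "r < 1" using lt \<open>B \<ge> 0\<close> l0 by (auto simp: r_def l_def divide_simps)
  have Fr: "cmod (F x) \<le> r" if "x \<in> S" for x
    using B[OF that] l0 by (simp add: F_def r_def norm_mult norm_inverse norm_divide divide_simps)
  have psiF: "\<psi> F = 1"
    unfolding F_def using char_mult[of "\<lambda>_. inverse l" f] f l0 by (simp add: char_const l_def)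
  have "(\<lambda>x. \<Sum>n. F x ^ n) \<in> cl"
  proof (rule cl_suminf[of "\<lambda>n x. F x ^ n" "\<lambda>n. r ^ n"])
    show "(\<lambda>x. F x ^ n) \<in> cl" for n using F by (rule cl_power)
    show "cmod (F x ^ n) \<le> r ^ n" if "x \<in> S" for n x
      using Fr[OF that] by (simp add: norm_power power_mono)
    show "summable (\<lambda>n. r ^ n)" using r by (simp add: summable_geometric)
  qed
  moreover have "(\<lambda>x. 1 - F x) \<in> cl" using F by (intro cl_diff) auto
  moreover have "(1 - F x) * (\<Sum>n. F x ^ n) = 1" if "x \<in> S" for x
  proof -
    have "cmod (F x) < 1" using Fr[OF that] r by linarith
    then show ?thesis by (subst suminf_geometric) auto
  qed
  ultimately have "\<psi> (\<lambda>x. 1 - F x) \<noteq> 0" by (intro char_nonzero)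
  then show False using char_diff[of "\<lambda>_. 1" F] F psiF by (simp add: char_const)
qed

text \<open>Characters have norm at most \<open>1\<close> by \<open>char_bound\<close>, hence are
  determined on the closure by their values on the dense part \<open>P\<close>.\<close>

lemma char_eval:
  assumes y: "y \<in> S" and P: "\<And>p. p \<in> P \<Longrightarrow> \<psi> p = p y" and f: "f \<in> cl"
  shows "\<psi> f = f y"
proof -
  have "cmod (\<psi> f - f y) \<le> e" if "e > 0" for e :: real
  proof -
    obtain p where p: "p \<in> P" "\<forall>x\<in>S. cmod (f x - p x) < e/2"
      using uclosureD[OF f, of "e/2"] \<open>e > 0\<close> by auto
    have pc: "p \<in> cl" using p uclosure_base by blast
    have "cmod (\<psi> (\<lambda>x. f x - p x)) \<le> e/2"
      using p(2) f pc by (intro char_bound cl_diff) (auto simp: less_imp_le)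
    then have "cmod (\<psi> f - p y) \<le> e/2" using char_diff[OF f pc] P[OF p(1)] by simp
    moreover have "cmod (p y - f y) \<le> e/2" using p(2) y by (auto simp: norm_minus_commute less_imp_le)
    ultimately show ?thesis using norm_triangle_ineq[of "\<psi> f - p y" "p y - f y"] by simp
  qed
  then have "cmod (\<psi> f - f y) \<le> 0" by (rule field_le_epsilon) auto
  then show ?thesis by simp
qed

end

text \<open>Evaluation is a continuous injection of a compact space into a Hausdorff space, so
  surjectivity suffices, and by \<open>char_eval\<close> this has to be checked only on
  \<open>P\<close>.\<close>

lemma natural_Alg:
  assumes sep: "\<And>x y. \<lbrakk>x \<in> S; y \<in> S; x \<noteq> y\<rbrakk> \<Longrightarrow> \<exists>f\<in>cl. f x \<noteq> f y"
    and eval: "\<And>\<psi>. character \<psi> \<Longrightarrow> \<exists>y\<in>S. \<forall>p\<in>P. \<psi> p = p y"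
  shows "natural_uniform_algebra (top_of_set S) Alg"
  unfolding natural_uniform_algebra_def
proof
  let ?X = "top_of_set S" let ?M = "maximal_ideal_space ?X Alg" let ?ev = "\<lambda>x. \<lambda>f\<in>Alg. f x"
  show "uniform_algebra ?X Alg" using sep by (rule uniform_algebra_Alg)
  have topM: "topspace ?M = characters ?X Alg"
    by (auto simp: maximal_ideal_space_def characters_def PiE_def)
  have algs: "fadd ?X f g \<in> Alg" "fmult ?X f g \<in> Alg" "fscale ?X c f \<in> Alg" if "f \<in> Alg" "g \<in> Alg" for f g c
    using that by (auto simp: fadd_def fmult_def fscale_def intro!: cl_add cl_mult cl_scale dest: Alg_cl)
  have ev_char: "?ev x \<in> characters ?X Alg" if x: "x \<in> S" for x
  proof -
    have "restrict (\<lambda>_. 1) S \<in> Alg" by simp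
    then have ex: "\<exists>f\<in>Alg. ?ev x f \<noteq> 0" using x by (intro bexI[of _ "restrict (\<lambda>_. 1) S"]) auto
    show ?thesis
      unfolding characters_def
    proof (intro CollectI conjI ballI allI)
      show "?ev x \<in> extensional Alg" by simp
      show "\<exists>f\<in>Alg. ?ev x f \<noteq> 0" by (rule ex)
      fix f g c assume f: "f \<in> Alg"
      show "?ev x (fscale ?X c f) = c * ?ev x f" using algs(3)[OF f f] f x by (simp add: fscale_def)
      assume g: "g \<in> Alg"
      show "?ev x (fadd ?X f g) = ?ev x f + ?ev x g" using algs(1)[OF f g] f g x by (simp add: fadd_def)
      show "?ev x (fmult ?X f g) = ?ev x f * ?ev x g" using algs(2)[OF f g] f g x by (simp add: fmult_def)
    qed
  qed
  have char_ev: "\<phi> \<in> ?ev ` S" if phi: "\<phi> \<in> characters ?X Alg" for \<phi>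
  proof -
    have ch: "character (\<lambda>f. \<phi> (restrict f S))" using phi by (rule characters_imp_character)
    then obtain y where y: "y \<in> S" "\<forall>p\<in>P. \<phi> (restrict p S) = p y" using eval by blast
    have "\<phi> f = ?ev y f" for f
    proof (cases "f \<in> Alg")
      case True
      then have "\<phi> (restrict f S) = f y" using char_eval[OF ch y(1)] y(2) Alg_cl by blast
      then show ?thesis using True Alg_restrict by simp
    next
      case False
      then show ?thesis using phi by (auto simp: characters_def extensional_def)
    qed
    then show ?thesis using y(1) by blast
  qed
  show "homeomorphic_map ?X ?M ?ev"
  proof (rule continuous_imp_homeomorphic_map)
    show "compact_space ?X" using compS by (simp add: compact_space_subtopology)
    show "Hausdorff_space ?M"
      by (simp add: maximal_ideal_space_def Hausdorff_space_subtopology Hausdorff_space_product_topology)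
    show "continuous_map ?X ?M ?ev"
      unfolding maximal_ideal_space_def continuous_map_in_subtopology continuous_map_componentwise
      using ev_char cl_cont Alg_cl by auto
    show "?ev ` topspace ?X = topspace ?M"
      unfolding topM using ev_char char_ev by auto
    show "inj_on ?ev (topspace ?X)"
    proof (rule inj_onI)
      fix x y assume xy: "x \<in> topspace ?X" "y \<in> topspace ?X" "?ev x = ?ev y"
      show "x = y"
      proof (rule ccontr)
        assume "x \<noteq> y"
        then obtain f where f: "f \<in> cl" "f x \<noteq> f y" using sep xy by auto
        have "?ev x (restrict f S) = ?ev y (restrict f S)" by (simp only: xy(3))
        then show False using f xy(1,2) by simp
      qed
    qed
  qed
qed

text \<open>Functions that are exactly constant near both points can be multiplied without loss.
  Compactness is used twice: a product over a cover of \<open>C\<close> is \<open>0\<close> on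
  \<open>C\<close> and still \<open>1\<close> near \<open>x\<close>; then
  \<open>1 - (\<Prod>y\<in>D. 1 - f y t)\<close> glues these functions over a cover of
  \<open>K\<close>.\<close>

lemma normal_Alg:
  assumes sep: "\<And>x y. \<lbrakk>x \<in> S; y \<in> S; x \<noteq> y\<rbrakk> \<Longrightarrow>
     \<exists>f\<in>cl. \<exists>U V. open U \<and> open V \<and> x \<in> U \<and> y \<in> V \<and> (\<forall>t\<in>S \<inter> U. f t = 1) \<and> (\<forall>t\<in>S \<inter> V. f t = 0)"
  shows "normal_on (top_of_set S) Alg"
proof -
  have step1: "\<exists>f\<in>cl. \<exists>U. open U \<and> x \<in> U \<and> (\<forall>t\<in>S \<inter> U. f t = 1) \<and> (\<forall>t\<in>C. f t = 0)"
    if x: "x \<in> S" and C: "compact C" "C \<subseteq> S" "x \<notin> C" for x C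
  proof -
    have "\<forall>y\<in>C. \<exists>f U V. f \<in> cl \<and> open U \<and> open V \<and> x \<in> U \<and> y \<in> V \<and> (\<forall>t\<in>S \<inter> U. f t = 1) \<and> (\<forall>t\<in>S \<inter> V. f t = 0)"
    proof
      fix y assume "y \<in> C"
      then have "y \<in> S" "x \<noteq> y" using C by auto
      from sep[OF x this] show "\<exists>f U V. f \<in> cl \<and> open U \<and> open V \<and> x \<in> U \<and> y \<in> V \<and> (\<forall>t\<in>S \<inter> U. f t = 1) \<and> (\<forall>t\<in>S \<inter> V. f t = 0)"
        by blast
    qed
    then obtain f U V where f: "\<And>y. y \<in> C \<Longrightarrow> f y \<in> cl \<and> open (U y) \<and> open (V y) \<and> x \<in> U y \<and> y \<in> V y
        \<and> (\<forall>t\<in>S \<inter> U y. f y t = 1) \<and> (\<forall>t\<in>S \<inter> V y. f y t = 0)"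
      by metis
    then obtain D where D: "D \<subseteq> C" "finite D" "C \<subseteq> (\<Union>y\<in>D. V y)"
      using compactE_image[OF C(1), of C V] by (metis UN_I subsetI)
    have "(\<Prod>y\<in>D. f y t) = 0" if t: "t \<in> C" for t
    proof -
      obtain y where y: "y \<in> D" "t \<in> V y" using D t by auto
      then have "f y t = 0" using f[of y] D(1) t C(2) by auto
      then show ?thesis using D(2) y(1) by (intro prod_zero) auto
    qed
    moreover have "(\<lambda>t. \<Prod>y\<in>D. f y t) \<in> cl" using subsetD[OF D(1), THEN f] D(2) by (intro cl_prod) simp_all
    moreover have "open (\<Inter>y\<in>D. U y)" using subsetD[OF D(1), THEN f] D(2) by (intro open_INT) simp_all
    moreover have "\<forall>t\<in>S \<inter> (\<Inter>y\<in>D. U y). (\<Prod>y\<in>D. f y t) = 1"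
    proof
      fix t assume t: "t \<in> S \<inter> (\<Inter>y\<in>D. U y)"
      have "f y t = 1" if "y \<in> D" for y using f[of y] that D(1) t by auto
      then show "(\<Prod>y\<in>D. f y t) = 1" by (rule prod.neutral[OF ballI])
    qed
    moreover have "x \<in> (\<Inter>y\<in>D. U y)"
      using subsetD[OF D(1), THEN f] by simp
    ultimately show ?thesis
      by (intro bexI[of _ "\<lambda>t. \<Prod>y\<in>D. f y t"] exI[of _ "\<Inter>y\<in>D. U y"] conjI ballI) simp_all
  qed
  have step2: "\<exists>f\<in>cl. (\<forall>t\<in>K. f t = 1) \<and> (\<forall>t\<in>C. f t = 0)"
    if K: "compact K" "K \<subseteq> S" and C: "compact C" "C \<subseteq> S" "K \<inter> C = {}" for K C
  proof -
    have "\<forall>x\<in>K. \<exists>f U. f \<in> cl \<and> open U \<and> x \<in> U \<and> (\<forall>t\<in>S \<inter> U. f t = 1) \<and> (\<forall>t\<in>C. f t = 0)"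
    proof
      fix x assume "x \<in> K"
      then have "x \<in> S" "x \<notin> C" using K C by auto
      from step1[OF this(1) C(1,2) this(2)]
      show "\<exists>f U. f \<in> cl \<and> open U \<and> x \<in> U \<and> (\<forall>t\<in>S \<inter> U. f t = 1) \<and> (\<forall>t\<in>C. f t = 0)"
        by blast
    qed
    then obtain f U where f: "\<And>x. x \<in> K \<Longrightarrow> f x \<in> cl \<and> open (U x) \<and> x \<in> U x
        \<and> (\<forall>t\<in>S \<inter> U x. f x t = 1) \<and> (\<forall>t\<in>C. f x t = 0)"
      by metis
    then obtain D where D: "D \<subseteq> K" "finite D" "K \<subseteq> (\<Union>y\<in>D. U y)"
      using compactE_image[OF K(1), of K U] by (metis UN_I subsetI)
    have "(\<Prod>y\<in>D. 1 - f y t) = 0" if t: "t \<in> K" for t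
    proof -
      obtain y where y: "y \<in> D" "t \<in> U y" using D t by auto
      then have "f y t = 1" using f[of y] D(1) t K(2) by auto
      then show ?thesis using D(2) y(1) by (intro prod_zero) auto
    qed
    moreover have "(\<lambda>t. 1 - (\<Prod>y\<in>D. 1 - f y t)) \<in> cl" using subsetD[OF D(1), THEN f] D(2)
      by (intro cl_diff cl_prod) simp_all
    moreover have "(\<Prod>y\<in>D. 1 - f y t) = 1" if t: "t \<in> C" for t
    proof -
      have "1 - f y t = 1" if "y \<in> D" for y using f[of y] that D(1) t by auto
      then show ?thesis by (rule prod.neutral[OF ballI])
    qed
    ultimately show ?thesis 
      by (intro bexI[of _ "\<lambda>t. 1 - (\<Prod>y\<in>D. 1 - f y t)"] conjI ballI) simp_all
  qed
  show ?thesis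
    unfolding normal_on_def
  proof (intro allI impI)
    fix K0 K1 assume as: "closedin (top_of_set S) K0 \<and> closedin (top_of_set S) K1 \<and> K0 \<inter> K1 = {}"
    then have "compact K0" "compact K1" "K0 \<subseteq> S" "K1 \<subseteq> S"
      using compS closedin_compact closedin_subset by fastforce+
    then obtain f where f: "f \<in> cl" "\<forall>t\<in>K1. f t = 1" "\<forall>t\<in>K0. f t = 0" using step2[of K1 K0] as by auto
    then show "\<exists>f\<in>Alg. (\<forall>x\<in>K1. f x = 1) \<and> (\<forall>x\<in>K0. f x = 0)"
      using \<open>K0 \<subseteq> S\<close> \<open>K1 \<subseteq> S\<close> by (intro bexI[of _ "restrict f S"]) auto
  qed
qed

text \<open>The partial sums \<open>G\<^sub>n\<close> of \<open>\<Sum> 2\<^sup>-\<^sup>n\<^sup>-\<^sup>1 f\<^sub>n\<close> are built so that \<open>f\<^sub>n\<^sub>+\<^sub>1\<close> lives on a ball on which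
  \<open>G\<^sub>n\<close> is close to its value at the peak.\<close>

lemma peak_function_exists:
  assumes y: "y \<in> S"
    and f: "\<And>r. r > 0 \<Longrightarrow> \<exists>f\<in>cl. f y = 1 \<and> (\<forall>s\<in>S. cmod (f s) \<le> 5/4) \<and> (\<forall>s\<in>S - ball y r. f s = 0)"
  shows "\<exists>f\<in>cl. f y = 1 \<and> (\<forall>s\<in>S - {y}. cmod (f s) < 1)"
proof -
  \<comment> \<open>A state is a partial sum together with the radius of the ball carrying its last
    summand. The first sum is half a bump, bounded by \<open>5/8\<close>, so it stays below
    \<open>1\<close> even where no later control exists.\<close>
  define Pr where "Pr n x \<longleftrightarrow> fst x \<in> cl \<and> snd x > 0 \<and> fst x y = 1 - 1 / 2 ^ (n + 1) \<and> (n = 0 \<longrightarrow> (\<forall>s\<in>S. cmod (fst x s) \<le> 5/8))"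
    for n and x :: "('a \<Rightarrow> complex) \<times> real"
  define Qr where "Qr n x x' \<longleftrightarrow> snd x' \<le> snd x / 2 \<and> (\<forall>s\<in>S \<inter> ball y (snd x'). cmod (fst x s) \<le> 1 - 1 / 2 ^ (n + 1) + 1 / 2 ^ (n + 4)) \<and>
      (\<forall>s\<in>S. cmod (fst x' s - fst x s) \<le> 5/4 / 2 ^ (n + 2)) \<and> (\<forall>s\<in>S - ball y (snd x'). fst x' s = fst x s)"
    for n and x x' :: "('a \<Rightarrow> complex) \<times> real"
  have "\<exists>h. \<forall>n. Pr n (h n) \<and> Qr n (h n) (h (Suc n))"
  proof (rule dependent_nat_choice)
    obtain f0 where f0: "f0 \<in> cl" "f0 y = 1" "\<forall>s\<in>S. cmod (f0 s) \<le> 5/4" using f[of 1] by auto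
    have "Pr 0 (\<lambda>s. (1/2) * f0 s, 1)" using f0 cl_scale[OF f0(1), of "1/2"]
      by (simp add: Pr_def norm_mult norm_divide mult.commute)
    then show "\<exists>x. Pr 0 x" by blast
  next
    fix x n assume "Pr n x"
    then obtain G r where x: "x = (G, r)" "G \<in> cl" "r > 0" "G y = 1 - 1 / 2 ^ (n + 1)" unfolding Pr_def by (cases x) auto
    have "continuous (at y within S) G" using cl_cont[OF x(2)] y by (simp add: continuous_on_eq_continuous_within)
    then obtain d where d: "d > 0" "\<And>s. s \<in> S \<Longrightarrow> dist s y < d \<Longrightarrow> dist (G s) (G y) < 1 / 2 ^ (n + 4)"
      unfolding continuous_within_eps_delta by (metis zero_less_divide_1_iff zero_less_numeral zero_less_power)
    define r' where "r' = min d (r / 2)"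
    have r': "r' > 0" "r' \<le> r / 2" "r' \<le> d" using d x by (auto simp: r'_def)
    obtain f' where f': "f' \<in> cl" "f' y = 1" "\<And>s. s \<in> S \<Longrightarrow> cmod (f' s) \<le> 5/4" "\<And>s. s \<in> S - ball y r' \<Longrightarrow> f' s = 0"
      using f[OF r'(1)] by blast
    define G' where "G' s = G s + (1 / 2 ^ (n + 2)) * f' s" for s
    have "G' \<in> cl" unfolding G'_def by (intro cl_add cl_scale x f')
    moreover have "G' y = 1 - 1 / 2 ^ (n + 2)" by (simp add: G'_def x f' field_simps)
    ultimately have "Pr (Suc n) (G', r')" using r' by (simp add: Pr_def)
    moreover have "Qr n x (G', r')"
      unfolding Qr_def x(1) fst_conv snd_conv
    proof (intro conjI ballI)
      show "r' \<le> r / 2" by (rule r')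
      fix s assume s: "s \<in> S \<inter> ball y r'"
      then have "dist (G s) (G y) < 1 / 2 ^ (n + 4)" using d(2)[of s] r' by (simp add: dist_commute)
      moreover have "cmod (G y) = 1 - 1 / 2 ^ (n + 1)"
      proof -
        have "G y = complex_of_real (1 - 1 / 2 ^ (n + 1))" using x(4) by simp
        moreover have "(1::real) / 2 ^ (n + 1) \<le> 1" using frac_le[of 1 1 1 "(2::real) ^ (n + 1)"] one_le_power[of "2::real" "n + 1"] by linarith
        ultimately show ?thesis by (simp only: norm_of_real abs_of_nonneg diff_ge_0_iff_ge)
      qed
      ultimately show "cmod (G s) \<le> 1 - 1 / 2 ^ (n + 1) + 1 / 2 ^ (n + 4)"
        using norm_triangle_ineq[of "G s - G y" "G y"] by (simp add: dist_norm)
    next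
      fix s assume "s \<in> S"
      then show "cmod (G' s - G s) \<le> 5/4 / 2 ^ (n + 2)" using f'(3)[of s] by (simp add: G'_def norm_mult norm_divide norm_power field_simps)
    next
      fix s assume "s \<in> S - ball y r'"
      then show "G' s = G s" using f'(4) by (simp add: G'_def)
    qed
    ultimately show "\<exists>x'. Pr (Suc n) x' \<and> Qr n x x'" by blast
  qed
  then obtain h where h: "\<And>n. Pr n (h n)" "\<And>n. Qr n (h n) (h (Suc n))" by blast
  define G r where "G n = fst (h n)" and "r n = snd (h n)" for n
  have G: "G n \<in> cl" "G n y = 1 - 1 / 2 ^ (n + 1)" "r n > 0" for n
    using h(1)[of n] by (auto simp: Pr_def G_def r_def)
  have G0: "s \<in> S \<Longrightarrow> cmod (G 0 s) \<le> 5/8" for s using h(1)[of 0] by (auto simp: Pr_def G_def)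
  have Q: "r (Suc n) \<le> r n / 2" "s \<in> S \<Longrightarrow> s \<in> ball y (r (Suc n)) \<Longrightarrow> cmod (G n s) \<le> 1 - 1 / 2 ^ (n + 1) + 1 / 2 ^ (n + 4)"
    "s \<in> S \<Longrightarrow> cmod (G (Suc n) s - G n s) \<le> 5/4 / 2 ^ (n + 2)"
    "s \<in> S \<Longrightarrow> s \<notin> ball y (r (Suc n)) \<Longrightarrow> G (Suc n) s = G n s" for n s
    using h(2)[of n] by (auto simp: Qr_def G_def r_def)
  define F where "F s = G 0 s + (\<Sum>n. G (Suc n) s - G n s)" for s
  have F: "F \<in> cl"
    unfolding F_def
  proof (intro cl_add G cl_suminf[where M = "\<lambda>n. 5/4 / 2 ^ (n + 2)"])
    show "(\<lambda>s. G (Suc n) s - G n s) \<in> cl" for n by (intro cl_diff G)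
    show "cmod (G (Suc n) s - G n s) \<le> 5/4 / 2 ^ (n + 2)" if "s \<in> S" for n s by (rule Q(3)[OF that])
    have "summable (\<lambda>n. 5/16 * (1/2::real) ^ n)" by (intro summable_mult summable_geometric) simp
    then show "summable (\<lambda>n. 5/4 / 2 ^ (n + 2) :: real)" by (simp add: power_one_over field_simps)
  qed
  have Flim: "F s = l" if "(\<lambda>n. G n s) \<longlonglongrightarrow> l" for s l
    unfolding F_def sums_unique[OF telescope_sums[OF that], symmetric] by simp
  have "(\<lambda>n. G n y) \<longlonglongrightarrow> 1"
  proof -
    have "(\<lambda>n. 1 - (1/2) ^ Suc n :: complex) \<longlonglongrightarrow> 1 - 0"
      by (intro tendsto_diff tendsto_const LIMSEQ_Suc LIMSEQ_power_zero) simp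
    then show ?thesis by (simp add: G power_one_over)
  qed
  then have Fy: "F y = 1" by (rule Flim)
  have rpos: "r n \<le> r 0 / 2 ^ n" for n
  proof (induction n)
    case (Suc n)
    then show ?case using Q(1)[of n] by simp
  qed simp
  have rdec: "r m \<le> r n" if "n \<le> m" for m n
    by (rule lift_Suc_antimono_le[OF _ that, of r]) (use Q(1) G(3) in \<open>smt (verit) field_sum_of_halves\<close>)
  have const: "F s = G m s" if s: "s \<in> S" "s \<notin> ball y (r (Suc m))" for s m
  proof -
    have "G k s = G m s" if "m \<le> k" for k
      using that
    proof (induction k rule: dec_induct)
      case (step k)
      have "r (Suc k) \<le> r (Suc m)" using step(1) by (intro rdec) simp
      then have "s \<notin> ball y (r (Suc k))" using s(2) by auto
      then show ?case using Q(4)[OF s(1)] step by simp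
    qed simp
    then have "\<forall>\<^sub>F k in sequentially. G m s = G k s" unfolding eventually_sequentially by metis
    then have "(\<lambda>k. G k s) \<longlonglongrightarrow> G m s" by (rule Lim_transform_eventually[OF tendsto_const])
    then show ?thesis by (rule Flim)
  qed
  have "cmod (F s) < 1" if s: "s \<in> S - {y}" for s
  proof -
    have "dist y s > 0" using s by auto
    then obtain n0 where n0: "r 0 / dist y s < 2 ^ n0" using real_arch_pow[of 2 "r 0 / dist y s"] by auto
    have "r n0 \<le> r 0 / 2 ^ n0" by (rule rpos)
    also have "\<dots> < dist y s" using n0 \<open>dist y s > 0\<close> by (simp add: field_simps)
    finally have "s \<notin> ball y (r n0)" by simp
    then have ex: "\<exists>n. s \<notin> ball y (r n)" by blast
    \<comment> \<open>From the first ball missing \<open>s\<close> on, all summands vanish at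
      \<open>s\<close>. For \<open>m = n + 2\<close> the value is \<open>G (Suc n) s\<close>: there
      \<open>G n s\<close> is controlled, because \<open>s\<close> still lies in the ball of radius
      \<open>r (Suc n)\<close>, and just one more summand is added.\<close>
    define m where "m = (LEAST n. s \<notin> ball y (r n))"
    have m: "s \<notin> ball y (r m)" unfolding m_def by (rule LeastI_ex[OF ex])
    show ?thesis
    proof (cases "m \<le> 1")
      case True
      then have "r (Suc 0) \<le> r m" by (intro rdec) simp
      then have "s \<notin> ball y (r (Suc 0))" using m by auto
      then have "F s = G 0 s" using const s by blast
      then show ?thesis using G0[of s] s by simp
    next
      case False
      then obtain n where n: "m = Suc (Suc n)" by (metis One_nat_def Suc_le_D not_less_eq_eq)
      have "s \<in> ball y (r (Suc n))" using not_less_Least[of "Suc n" "\<lambda>n. s \<notin> ball y (r n)"] n m_def by simp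
      then have 1: "cmod (G n s) \<le> 1 - 1 / 2 ^ (n + 1) + 1 / 2 ^ (n + 4)" using Q(2) s by blast
      have "F s = G (Suc n) s" using const m n s by blast
      then have "cmod (F s) \<le> cmod (G n s) + cmod (G (Suc n) s - G n s)"
        using norm_triangle_ineq[of "G n s" "G (Suc n) s - G n s"] by simp
      also have "\<dots> \<le> (1 - 1 / 2 ^ (n + 1) + 1 / 2 ^ (n + 4)) + 5/4 / 2 ^ (n + 2)"
        using 1 Q(3)[of s n] s by (intro add_mono) auto
      \<comment> \<open>Errors \<open>1 / 2 ^ (n + 4)\<close> and \<open>5 / 2 ^ (n + 4)\<close>
        stand against the deficit \<open>8 / 2 ^ (n + 4)\<close> of \<open>G n y\<close>; this
        margin is why bumps of norm \<open>5/4\<close> are good enough.\<close>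
      also have "\<dots> = 1 - 1 / (8 * 2 ^ n)" by (simp add: power_add field_simps)
      also have "\<dots> < 1" by simp
      finally show ?thesis .
    qed
  qed
  then show ?thesis using F Fy by blast
qed

text \<open>The polynomial \<open>3 w\<^sup>2 - 2 w\<^sup>3\<close> has superattracting fixed points \<open>0\<close> and \<open>1\<close>; its iterates turn
  \<open>f\<close> into an exact indicator.\<close>

lemma indicator_of_near_01:
  assumes f: "f \<in> cl" and e: "e \<in> cl"
    and V: "\<And>s. s \<in> S \<Longrightarrow> s \<notin> V \<Longrightarrow> e s = 0"
    and n01: "\<And>s. s \<in> S \<Longrightarrow> s \<in> V \<Longrightarrow> cmod (f s) \<le> 1/8 \<or> cmod (1 - f s) \<le> 1/8"
  shows "(\<lambda>s. if cmod (1 - f s) \<le> 1/8 then e s else 0) \<in> cl"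
proof -
  define p :: "complex \<Rightarrow> complex" where "p w = 3 * w ^ 2 - 2 * w ^ 3" for w
  have p0: "cmod (p w) \<le> cmod w / 2" if "cmod w \<le> 1/8" for w
  proof -
    have "p w = w * (w * (3 - 2 * w))" by (simp add: p_def power2_eq_square power3_eq_cube algebra_simps)
    moreover have "cmod (3 - 2 * w) \<le> 4" using norm_triangle_ineq4[of 3 "2 * w"] that by (simp add: norm_mult)
    then have "cmod w * cmod (3 - 2 * w) \<le> 1/8 * 4" using that by (intro mult_mono) auto
    ultimately show ?thesis using mult_left_mono[of "cmod w * cmod (3 - 2 * w)" "1/2" "cmod w"] by (simp add: norm_mult)
  qed
  \<comment> \<open>Symmetry under \<open>w \<mapsto> 1 - w\<close> transports the contraction at
    \<open>0\<close> to the fixed point \<open>1\<close>.\<close>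
  have p1: "1 - p w = p (1 - w)" for w
    by (simp add: p_def power2_eq_square power3_eq_cube algebra_simps)
  have it0: "cmod ((p ^^ n) w) \<le> 1/8 / 2 ^ n" if "cmod w \<le> 1/8" for n w
  proof (induction n)
    case (Suc n)
    have "(1/8::real) / 2 ^ n \<le> 1/8" by (simp add: divide_le_eq)
    then have "cmod ((p ^^ n) w) \<le> 1/8" using Suc by linarith
    then show ?case using p0[of "(p ^^ n) w"] Suc by simp
  qed (use that in simp)
  have it1: "1 - (p ^^ n) w = (p ^^ n) (1 - w)" for n w
    by (induction n) (auto simp: p1)
  have pcl: "(\<lambda>s. (p ^^ n) (f s)) \<in> cl" for n
  proof (induction n)
    case 0 then show ?case using f by simp
  next
    case (Suc n)
    have "(\<lambda>s. 3 * (p ^^ n) (f s) ^ 2 - 2 * (p ^^ n) (f s) ^ 3) \<in> cl"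
      by (intro cl_diff cl_scale cl_power Suc)
    moreover have "(p ^^ Suc n) w = 3 * (p ^^ n) w ^ 2 - 2 * (p ^^ n) w ^ 3" for w
      by (simp only: funpow.simps o_apply) (simp only: p_def[of "(p ^^ n) w"])
    ultimately show ?case by (simp only:)
  qed
  obtain B where B: "B > 0" "\<And>s. s \<in> S \<Longrightarrow> cmod (e s) \<le> B" using cl_bounded[OF e] by blast
  show ?thesis
  proof (rule uclosure_uclosure)
    fix d :: real assume d: "d > 0"
    obtain n where n: "B / d < 2 ^ n" using real_arch_pow[of 2 "B / d"] by auto
    have "cmod ((if cmod (1 - f s) \<le> 1/8 then e s else 0) - e s * (p ^^ n) (f s)) < d" if s: "s \<in> S" for s
    proof (cases "s \<in> V")
      case False
      then show ?thesis using V[OF s] d by simp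
    next
      case True
      have "cmod ((if cmod (1 - f s) \<le> 1/8 then e s else 0) - e s * (p ^^ n) (f s)) \<le> B * (1/8 / 2 ^ n)"
      proof (cases "cmod (1 - f s) \<le> 1/8")
        case True
        have "e s - e s * (p ^^ n) (f s) = e s * (p ^^ n) (1 - f s)"
          unfolding it1[symmetric] by (simp add: algebra_simps)
        then show ?thesis using True mult_mono[OF B(2)[OF s] it0[OF True, of n]] B(1) by (simp add: norm_mult)
      next
        case False
        then have "cmod (f s) \<le> 1/8" using n01[OF s \<open>s \<in> V\<close>] by blast
        then show ?thesis using False mult_mono[OF B(2)[OF s] it0, of "f s" n] B(1) by (simp add: norm_mult)
      qed
      also have "\<dots> < d" using n d B(1) by (simp add: field_simps)
      finally show ?thesis .
    qed
    then show "\<exists>q\<in>cl. \<forall>s\<in>S. cmod ((if cmod (1 - f s) \<le> 1/8 then e s else 0) - q s) < d"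
      by (intro bexI[OF _ cl_mult[OF e pcl[of n]]]) blast
  qed
qed

end

subsection \<open>Cutoff functions\<close>

text \<open>Alternating corrections of the current function \<open>f\<close>: the factor
  \<open>hr n\<close> pushes it to \<open>0\<close> on the right, and \<open>hs n\<close> restores
  the missing part \<open>1 - f\<close> on the left. The increment is
  \<open>(1 - f) * hs n - f * (1 - hr n)\<close>.\<close>

primrec cut_iter :: "(nat \<Rightarrow> 'z \<Rightarrow> complex) \<Rightarrow> (nat \<Rightarrow> 'z \<Rightarrow> complex) \<Rightarrow> nat \<Rightarrow> 'z \<Rightarrow> complex" where
  "cut_iter hr hs 0 z = 1"
| "cut_iter hr hs (Suc n) z = cut_iter hr hs n z * hr n z + (1 - cut_iter hr hs n z) * hs n z"

text \<open>The transition of \<open>hs n\<close> lies between \<open>al (Suc n)\<close> and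
  \<open>al n\<close>, that of \<open>hr n\<close> between \<open>be n\<close> and
  \<open>be (Suc n)\<close>; these strips move apart, and the limit is exact beyond all of them. At
  every point each product in the increment has a small factor. The bounds \<open>M n\<close> may
  grow arbitrarily, since from the second step on they only multiply errors governed by the
  preceding tolerance \<open>e\<close>, which is chosen with them known.\<close>

lemma cut_iter_limit:
  fixes x :: "'z \<Rightarrow> real" and hr hs :: "nat \<Rightarrow> 'z \<Rightarrow> complex" and al be M e :: "nat \<Rightarrow> real"
  assumes r1: "\<And>n z. z \<in> \<Omega> \<Longrightarrow> x z \<le> be n \<Longrightarrow> cmod (1 - hr n z) \<le> e n"
    and r2: "\<And>n z. z \<in> \<Omega> \<Longrightarrow> be (Suc n) \<le> x z \<Longrightarrow> cmod (hr n z) \<le> e n"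
    and s1: "\<And>n z. z \<in> \<Omega> \<Longrightarrow> x z \<le> al (Suc n) \<Longrightarrow> cmod (1 - hs n z) \<le> e n"
    and s2: "\<And>n z. z \<in> \<Omega> \<Longrightarrow> al n \<le> x z \<Longrightarrow> cmod (hs n z) \<le> e n"
    and M: "\<And>n z. z \<in> \<Omega> \<Longrightarrow> cmod (hs n z) \<le> M n" "\<And>n z. z \<in> \<Omega> \<Longrightarrow> cmod (1 - hr n z) \<le> M n"
    and mono: "\<And>n. al (Suc n) \<le> al n" "\<And>n. be n \<le> be (Suc n)" "\<And>n. al n \<le> be n"
    and M0: "\<And>n. M n \<ge> 0" and e0: "\<And>n. e n \<ge> 0"
    and e: "\<And>n. (M 0 + 4) * e n * (1 + M (Suc n)) \<le> 1 / 2 ^ (n + 4)"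
  obtains F where "uniform_limit \<Omega> (cut_iter hr hs) F sequentially"
    "\<And>z. z \<in> \<Omega> \<Longrightarrow> (\<And>n. x z \<le> al n) \<Longrightarrow> F z = 1"
    "\<And>z. z \<in> \<Omega> \<Longrightarrow> (\<And>n. be n \<le> x z) \<Longrightarrow> F z = 0"
proof -
  \<comment> \<open>\<open>D\<close> bounds \<open>f\<close> and \<open>1 - f\<close> throughout,
    \<open>E n\<close> the error outside the strip from \<open>al n\<close> to \<open>be n\<close>,
    \<open>b n\<close> the size of the iterate and \<open>c n\<close> its increment. Index
    \<open>0\<close> is exceptional: the start is the constant \<open>1\<close>, wrong by
    \<open>1\<close> on the right, so the first increment is only bounded by
    \<open>M 0 + 1\<close>.\<close>
  define D where "D = M 0 + 4"
  define E where "E n = (case n of 0 \<Rightarrow> 1 | Suc k \<Rightarrow> 2 * D * e k)" for n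
  define b where "b n = (if n = 0 then 1 else M 0 + 3 - 1 / 2 ^ n)" for n :: nat
  define c where "c n = (if n = 0 then M 0 + 1 else 1 / 2 ^ (n + 1))" for n :: nat
  let ?f = "cut_iter hr hs"
  have D: "D \<ge> 4" using M0[of 0] by (simp add: D_def)
  have E0: "E n \<ge> 0" for n using D e0 by (auto simp: E_def split: nat.split)
  have De: "D * e n \<le> 1 / 2 ^ (n + 4)" "D * e n * M (Suc n) \<le> 1 / 2 ^ (n + 4)" for n
  proof -
    have "0 \<le> D * e n" "0 \<le> D * e n * M (Suc n)" using D e0[of n] M0[of "Suc n"] by simp_all
    moreover have "D * e n + D * e n * M (Suc n) \<le> 1 / 2 ^ (n + 4)"
      using e[of n] by (simp add: D_def distrib_left)
    ultimately show "D * e n \<le> 1 / 2 ^ (n + 4)" "D * e n * M (Suc n) \<le> 1 / 2 ^ (n + 4)" by linarith+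
  qed
  have bD: "b n \<le> D - 1" for n using M0[of 0] by (simp add: b_def D_def)
  have cn: "E n * M n + 2 * D * e n \<le> c n" for n
  proof (cases n)
    case 0
    then show ?thesis using De(1)[of 0] by (simp add: E_def c_def)
  next
    case (Suc k)
    have "E n * M n + 2 * D * e n = 2 * (D * e k * M (Suc k)) + 2 * (D * e (Suc k))"
      by (simp add: E_def Suc)
    also have "\<dots> \<le> 2 * (1 / 2 ^ (k + 4)) + 2 * (1 / 2 ^ (Suc k + 4))"
      using De(2)[of k] De(1)[of "Suc k"] by linarith
    also have "\<dots> \<le> c n" by (simp add: c_def Suc power_add field_simps)
    finally show ?thesis .
  qed
  have step: "cmod (?f (Suc n) z - ?f n z) \<le> c n"
    if z: "z \<in> \<Omega>" and bd: "cmod (?f n z) \<le> b n"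
      and sm1: "be n \<le> x z \<Longrightarrow> cmod (?f n z) \<le> E n" and sm2: "x z \<le> al n \<Longrightarrow> cmod (1 - ?f n z) \<le> E n" for n z
  proof -
    have f1: "cmod (?f n z) \<le> D" using bd bD[of n] by linarith
    have f2: "cmod (1 - ?f n z) \<le> D" using bd bD[of n] norm_triangle_ineq4[of 1 "?f n z"] by simp
    have eq: "?f (Suc n) z - ?f n z = (1 - ?f n z) * hs n z - ?f n z * (1 - hr n z)"
      by (simp add: algebra_simps)
    have "cmod (?f (Suc n) z - ?f n z) \<le> cmod (1 - ?f n z) * cmod (hs n z) + cmod (?f n z) * cmod (1 - hr n z)"
      unfolding eq by (metis norm_mult norm_triangle_ineq4)
    also have "\<dots> \<le> E n * M n + 2 * D * e n"
    proof -
      have EM: "0 \<le> E n * M n" "0 \<le> D * e n" using E0 M0 D e0[of n] by simp_all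
      have A: "cmod (1 - ?f n z) * cmod (hs n z) \<le> D * e n" if "al n \<le> x z"
        using f2 s2[OF z that] by (intro mult_mono) (use D in auto)
      have B: "cmod (?f n z) * cmod (1 - hr n z) \<le> D * e n" if "x z \<le> be n"
        using f1 r1[OF z that] by (intro mult_mono) (use D in auto)
      have C: "cmod (1 - ?f n z) * cmod (hs n z) \<le> E n * M n" if "x z \<le> al n"
        using sm2[OF that] M(1)[OF z, of n] by (intro mult_mono) (use E0 in auto)
      have F: "cmod (?f n z) * cmod (1 - hr n z) \<le> E n * M n" if "be n \<le> x z"
        using sm1[OF that] M(2)[OF z, of n] by (intro mult_mono) (use E0 in auto)
      \<comment> \<open>On the left \<open>1 - f\<close> and \<open>1 - hr\<close> are small, in the
        middle \<open>hs\<close> and \<open>1 - hr\<close>, on the right \<open>hs\<close> and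
        \<open>f\<close>.\<close>
      consider "x z \<le> al n" | "al n \<le> x z" "x z \<le> be n" | "be n \<le> x z" by linarith
      then show ?thesis
      proof cases
        case 1
        then have "x z \<le> be n" using mono(3)[of n] by linarith
        then show ?thesis using C[OF 1] B EM by linarith
      next
        case 2
        then show ?thesis using A B EM by linarith
      next
        case 3
        then have "al n \<le> x z" using mono(3)[of n] by linarith
        then show ?thesis using F[OF 3] A EM by linarith
      qed
    qed
    also have "\<dots> \<le> c n" by (rule cn)
    finally show ?thesis .
  qed
  have inv: "cmod (?f n z) \<le> b n \<and> (be n \<le> x z \<longrightarrow> cmod (?f n z) \<le> E n) \<and> (x z \<le> al n \<longrightarrow> cmod (1 - ?f n z) \<le> E n)"
    if z: "z \<in> \<Omega>" for n z
  proof (induction n)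
    case 0
    then show ?case by (simp add: b_def E_def)
  next
    case (Suc n)
    then have bd: "cmod (?f n z) \<le> b n" by simp
    have f1: "cmod (?f n z) \<le> D" using bd bD[of n] by linarith
    have f2: "cmod (1 - ?f n z) \<le> D" using bd bD[of n] norm_triangle_ineq4[of 1 "?f n z"] by simp
    have "cmod (?f (Suc n) z - ?f n z) \<le> c n" using step[OF z bd] Suc by blast
    then have "cmod (?f (Suc n) z) \<le> b n + c n"
      using bd norm_triangle_ineq[of "?f n z" "?f (Suc n) z - ?f n z"] by simp
    also have "\<dots> \<le> b (Suc n)" by (auto simp: b_def c_def field_simps)
    finally have 1: "cmod (?f (Suc n) z) \<le> b (Suc n)" .
    have 2: "cmod (?f (Suc n) z) \<le> E (Suc n)" if x: "be (Suc n) \<le> x z"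
    proof -
      have "al n \<le> x z" using x mono(2)[of n] mono(3)[of n] by linarith
      have "cmod (?f (Suc n) z) \<le> cmod (?f n z) * cmod (hr n z) + cmod (1 - ?f n z) * cmod (hs n z)"
        by (simp flip: norm_mult add: norm_triangle_ineq)
      also have "\<dots> \<le> D * e n + D * e n"
        using f1 f2 r2[OF z x] s2[OF z \<open>al n \<le> x z\<close>] D by (intro add_mono mult_mono) auto
      finally show ?thesis by (simp add: E_def)
    qed
    have 3: "cmod (1 - ?f (Suc n) z) \<le> E (Suc n)" if x: "x z \<le> al (Suc n)"
    proof -
      have "x z \<le> be n" using x mono(1)[of n] mono(3)[of n] by linarith
      have eq: "1 - ?f (Suc n) z = ?f n z * (1 - hr n z) + (1 - ?f n z) * (1 - hs n z)"
        by (simp add: algebra_simps)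
      have "cmod (1 - ?f (Suc n) z) \<le> cmod (?f n z) * cmod (1 - hr n z) + cmod (1 - ?f n z) * cmod (1 - hs n z)"
        unfolding eq by (simp flip: norm_mult add: norm_triangle_ineq)
      also have "\<dots> \<le> D * e n + D * e n"
        using f1 f2 r1[OF z \<open>x z \<le> be n\<close>] s1[OF z x] D by (intro add_mono mult_mono) auto
      finally show ?thesis by (simp add: E_def)
    qed
    show ?case using 1 2 3 by blast
  qed
  have ch: "cmod (?f (Suc n) z - ?f n z) \<le> c n" if z: "z \<in> \<Omega>" for n z
    using step[OF z, of n] inv[OF z, of n] by blast
  have "summable c"
  proof (subst summable_cong)
    show "\<forall>\<^sub>F n in sequentially. c n = (1/2) ^ Suc n"
      using eventually_gt_at_top[of 0] by eventually_elim (simp add: c_def power_one_over)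
    show "summable (\<lambda>n. (1/2::real) ^ Suc n)" by (subst summable_Suc_iff) (rule summable_geometric, simp)
  qed
  then have ul: "uniform_limit \<Omega> (\<lambda>n z. \<Sum>i<n. ?f (Suc i) z - ?f i z) (\<lambda>z. \<Sum>i. ?f (Suc i) z - ?f i z) sequentially"
    using ch by (intro Weierstrass_m_test) auto
  define F where "F z = 1 + (\<Sum>i. ?f (Suc i) z - ?f i z)" for z
  have "uniform_limit \<Omega> (\<lambda>n z. 1 + (\<Sum>i<n. ?f (Suc i) z - ?f i z)) F sequentially"
    unfolding F_def by (intro uniform_limit_add uniform_limit_const ul)
  moreover have "1 + (\<Sum>i<n. ?f (Suc i) z - ?f i z) = ?f n z" for n z
    unfolding sum_lessThan_telescope[of "\<lambda>i. ?f i z"] by simp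
  ultimately have UL: "uniform_limit \<Omega> ?f F sequentially" by simp
  have "(\<lambda>n. E (Suc n)) \<longlonglongrightarrow> 0"
  proof (rule tendsto_sandwich[of "\<lambda>_. 0" _ _ "\<lambda>n. (1/2) ^ n"])
    show "\<forall>\<^sub>F n in sequentially. 0 \<le> E (Suc n)" using E0 by simp
    have "E (Suc n) \<le> (1/2) ^ n" for n
    proof -
      have "E (Suc n) \<le> 2 * (1 / 2 ^ (n + 4))" using De(1)[of n] by (simp add: E_def)
      also have "\<dots> \<le> (1/2) ^ n" by (simp add: power_add power_one_over divide_left_mono)
      finally show ?thesis .
    qed
    then show "\<forall>\<^sub>F n in sequentially. E (Suc n) \<le> (1/2) ^ n" by simp
    show "(\<lambda>n. (1/2::real) ^ n) \<longlonglongrightarrow> 0" by (rule LIMSEQ_power_zero) simp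
  qed simp
  then have Elim: "E \<longlonglongrightarrow> 0" by (rule LIMSEQ_imp_Suc)
  show ?thesis
  proof (rule that[OF UL])
    fix z assume z: "z \<in> \<Omega>"
    have fF: "(\<lambda>n. ?f n z) \<longlonglongrightarrow> F z" using tendsto_uniform_limitI[OF UL z] .
    show "F z = 1" if x: "\<And>n. x z \<le> al n"
    proof -
      have "(\<lambda>n. 1 - ?f n z) \<longlonglongrightarrow> 0"
        by (rule Lim_null_comparison[OF _ Elim]) (use inv[OF z] x in auto)
      moreover have "(\<lambda>n. 1 - ?f n z) \<longlonglongrightarrow> 1 - F z" by (intro tendsto_intros fF)
      ultimately show ?thesis using LIMSEQ_unique by fastforce
    qed
    show "F z = 0" if x: "\<And>n. be n \<le> x z"
    proof -
      have "(\<lambda>n. ?f n z) \<longlonglongrightarrow> 0"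
        by (rule Lim_null_comparison[OF _ Elim]) (use inv[OF z] x in auto)
      then show ?thesis using fF LIMSEQ_unique by blast
    qed
  qed
qed

text \<open>Squares of half side \<open>\<eta>\<close> around the zeros
  \<open>2 * pi * k * \<i>\<close> are excluded. If the real part is off, the modulus of
  \<open>exp w\<close> is off \<open>1\<close>. Otherwise \<open>exp w\<close> lies on a ray making
  an angle of at least \<open>\<eta>\<close> with the positive axis, and as
  \<open>\<eta> \<le> pi / 2\<close>, the distance from \<open>1\<close> to that ray is at least
  \<open>sin \<eta>\<close>.\<close>

lemma exp_minus_one_lower:
  assumes eta: "0 < \<eta>" "\<eta> \<le> pi / 2"
    and w: "\<eta> \<le> \<bar>Re w\<bar> \<or> (\<forall>k::int. \<eta> \<le> \<bar>Im w - 2 * pi * of_int k\<bar>)"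
  shows "min (sin \<eta>) (1 - exp (-\<eta>)) \<le> cmod (1 - exp w)"
  using w
proof
  assume r: "\<eta> \<le> \<bar>Re w\<bar>"
  have n: "cmod (exp w) = exp (Re w)" by simp
  show ?thesis
  proof (cases "Re w \<ge> 0")
    case True
    then have "exp \<eta> - 1 \<le> cmod (1 - exp w)"
      using r norm_triangle_ineq2[of "exp w" 1] by (simp add: norm_minus_commute) (smt (verit) exp_le_cancel_iff)
    moreover have "1 - exp (-\<eta>) \<le> exp \<eta> - 1"
    proof -
      have "0 \<le> (exp (\<eta>/2) - exp (-\<eta>/2))^2" by simp
      also have "\<dots> = exp \<eta> + exp (-\<eta>) - 2"
        by (simp add: power2_eq_square algebra_simps flip: exp_add)
      finally show ?thesis by simp
    qed
    ultimately show ?thesis by linarith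
  next
    case False
    then have "1 - exp (-\<eta>) \<le> cmod (1 - exp w)"
      using r norm_triangle_ineq2[of 1 "exp w"] by simp (smt (verit) exp_le_cancel_iff)
    then show ?thesis by linarith
  qed
next
  assume i: "\<forall>k::int. \<eta> \<le> \<bar>Im w - 2 * pi * of_int k\<bar>"
  define x y where "x = exp (Re w)" and "y = Im w"
  define k where "k = round (y / (2 * pi))"
  define y0 where "y0 = y - 2 * pi * of_int k"
  have "\<bar>y / (2 * pi) - of_int k\<bar> \<le> 1/2" unfolding k_def by (metis abs_minus_commute of_int_round_abs_le)
  then have "\<bar>y / (2 * pi) - of_int k\<bar> * (2*pi) \<le> 1/2 * (2*pi)" by (intro mult_right_mono) auto
  also have "\<bar>y / (2 * pi) - of_int k\<bar> * (2*pi) = \<bar>(y / (2 * pi) - of_int k) * (2*pi)\<bar>" by (simp add: abs_mult)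
  also have "(y / (2 * pi) - of_int k) * (2*pi) = y0" by (simp add: y0_def algebra_simps)
  finally have y0: "\<bar>y0\<bar> \<le> pi" by simp
  have "\<eta> \<le> \<bar>y0\<bar>" using i by (simp add: y0_def y_def)
  then have "cos \<bar>y0\<bar> \<le> cos \<eta>" using y0 eta by (subst cos_mono_le_eq) auto
  moreover have "cos \<bar>y0\<bar> = cos y"
    using cos_int_2pin[of k] sin_int_2pin[of k] by (simp add: y0_def cos_diff)
  ultimately have cy: "cos y \<le> cos \<eta>" by simp
  have gen1: "(1 - x * a)\<^sup>2 + (x * b)\<^sup>2 = 1 - 2 * x * a + x\<^sup>2 * (a\<^sup>2 + b\<^sup>2)"
    and gen2: "(x - a)\<^sup>2 + b\<^sup>2 = x\<^sup>2 - 2 * (x * a) + (a\<^sup>2 + b\<^sup>2)" for a b :: real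
    by (simp_all add: power2_eq_square algebra_simps)
  have sq: "(cmod (1 - exp w))\<^sup>2 = (x - cos y)\<^sup>2 + (sin y)\<^sup>2"
  proof -
    have "(cmod (1 - exp w))\<^sup>2 = (1 - x * cos y)\<^sup>2 + (x * sin y)\<^sup>2"
      by (simp add: cmod_power2 Re_exp Im_exp x_def y_def)
    also have "\<dots> = (x - cos y)\<^sup>2 + (sin y)\<^sup>2" unfolding gen1 gen2 by simp
    finally show ?thesis .
  qed
  have "(sin \<eta>)\<^sup>2 \<le> (x - cos y)\<^sup>2 + (sin y)\<^sup>2"
  proof (cases "cos y \<ge> 0")
    case True
    then have "(cos y)\<^sup>2 \<le> (cos \<eta>)\<^sup>2" using cy by (intro power_mono) auto
    then have "(sin \<eta>)\<^sup>2 \<le> (sin y)\<^sup>2" by (simp add: sin_squared_eq)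
    then show ?thesis using zero_le_power2[of "x - cos y"] by linarith
  next
    case False
    have "x > 0" by (simp add: x_def)
    then have "x * cos y \<le> 0" using False by (simp add: mult_nonneg_nonpos)
    moreover have "(x - cos y)\<^sup>2 + (sin y)\<^sup>2 = x\<^sup>2 - 2 * (x * cos y) + ((cos y)\<^sup>2 + (sin y)\<^sup>2)"
      by (rule gen2)
    moreover have "(sin \<eta>)\<^sup>2 \<le> 1" by (simp add: sin_squared_eq)
    ultimately show ?thesis using zero_le_power2[of x] by (simp only: sin_cos_squared_add2)
  qed
  then have "(sin \<eta>)\<^sup>2 \<le> (cmod (1 - exp w))\<^sup>2" using sq by simp
  then have "sin \<eta> \<le> cmod (1 - exp w)" by (rule power2_le_imp_le) simp
  then show ?thesis by linarith
qed

section \<open>Step functions with poles along a line of dyadic squares\<close>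

definition dyadic_sq :: "nat \<Rightarrow> int \<Rightarrow> int \<Rightarrow> complex set" where
  "dyadic_sq n i j = box (Complex (of_int i / 2 ^ n) (of_int j / 2 ^ n)) (Complex (of_int (i+1) / 2 ^ n) (of_int (j+1) / 2 ^ n))"

lemma in_dyadic_sq:
  "z \<in> dyadic_sq n i j \<longleftrightarrow> of_int i < 2 ^ n * Re z \<and> 2 ^ n * Re z < of_int i + 1 \<and> of_int j < 2 ^ n * Im z \<and> 2 ^ n * Im z < of_int j + 1"
  by (auto simp: dyadic_sq_def in_box_complex_iff field_simps)

text \<open>Consecutive poles are \<open>1 / 2 ^ l\<close> apart, each the centre of a square of
  side \<open>1 / 2 ^ (l + q)\<close>. So \<open>l\<close> governs the density of the poles and the
  steepness of the step, \<open>q\<close> the ratio of gap to hole. The \<open>3/2\<close> is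
  \<open>1/2\<close> for the centre plus the offset \<open>1\<close> in
  \<open>line_hole\<close>.\<close>

definition line_pole :: "nat \<Rightarrow> nat \<Rightarrow> int \<Rightarrow> int \<Rightarrow> complex" where
  "line_pole q l u k = Complex ((of_int u + 1/2) / 2 ^ (l + q)) ((of_int k * 2 ^ q + 3/2) / 2 ^ (l + q))"

definition line_hole :: "nat \<Rightarrow> nat \<Rightarrow> int \<Rightarrow> int \<Rightarrow> complex set" where
  "line_hole q l u k = dyadic_sq (l + q) u (k * 2 ^ q + 1)"

definition line_arg :: "nat \<Rightarrow> nat \<Rightarrow> int \<Rightarrow> complex \<Rightarrow> complex" where
  "line_arg q l u z = of_real (2 * pi * 2 ^ l) * (z - line_pole q l u 0)"

definition line_fun :: "nat \<Rightarrow> nat \<Rightarrow> int \<Rightarrow> complex \<Rightarrow> complex" where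
  "line_fun q l u z = 1 / (1 - exp (line_arg q l u z))"

text \<open>After the scaling by \<open>2 * pi * 2 ^ l\<close> in \<open>line_arg\<close> the holes
  have half side \<open>pi / 2 ^ q\<close>, so the bound from \<open>exp_minus_one_lower\<close>
  does not involve \<open>l\<close>. The summand \<open>1\<close> makes it cover
  \<open>1 - line_fun\<close> as well.\<close>

definition line_bound :: "nat \<Rightarrow> real" where
  "line_bound q = 1 / min (sin (pi / 2 ^ q)) (1 - exp (- (pi / 2 ^ q))) + 1"

lemma Re_line_arg: "Re (line_arg q l u z) = 2 * pi / 2 ^ q * (2 ^ (l + q) * Re z - of_int u - 1/2)"
  by (simp add: line_arg_def line_pole_def power_add field_simps)

lemma Im_line_arg: "Im (line_arg q l u z) = 2 * pi / 2 ^ q * (2 ^ (l + q) * Im z - 3/2)"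
  by (simp add: line_arg_def line_pole_def power_add field_simps)

lemma line_arg_pole:
  assumes "exp (line_arg q l u z) = 1" shows "\<exists>k. z \<in> line_hole q l u k"
proof -
  obtain k :: int where k: "Re (line_arg q l u z) = 0" "Im (line_arg q l u z) = of_int (2 * k) * pi"
    using assms unfolding exp_eq_1 by auto
  have "2 ^ (l + q) * Re z - of_int u - 1/2 = 0" using k(1) unfolding Re_line_arg by simp
  moreover have "2 ^ (l + q) * Im z - 3/2 = of_int k * 2 ^ q"
  proof -
    have "2 * pi / 2 ^ q * (2 ^ (l + q) * Im z - 3/2) = 2 * pi / 2 ^ q * (of_int k * 2 ^ q)"
      using k(2) unfolding Im_line_arg by simp
    then show ?thesis by (subst (asm) mult_cancel_left) simp
  qed
  ultimately have "z \<in> line_hole q l u k" unfolding line_hole_def in_dyadic_sq by simp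
  then show ?thesis ..
qed

lemma line_bound_pos: "q \<ge> 1 \<Longrightarrow> 0 < min (sin (pi / 2 ^ q)) (1 - exp (- (pi / 2 ^ q)))"
proof -
  assume q: "q \<ge> 1"
  have "(2::real) ^ 1 \<le> 2 ^ q" using q by (intro power_increasing) auto
  then have "pi / 2 ^ q < pi" "0 < pi / 2 ^ q" by (auto simp: divide_less_eq)
  then have "0 < sin (pi / 2 ^ q)" by (intro sin_gt_zero)
  then show ?thesis by simp
qed

lemma line_fun_bound:
  assumes q: "q \<ge> 1" and z: "\<And>k. z \<notin> line_hole q l u k"
  shows "cmod (line_fun q l u z) \<le> line_bound q" "cmod (1 - line_fun q l u z) \<le> line_bound q"
proof -
  define \<eta> where "\<eta> = pi / 2 ^ q"
  define \<mu> where "\<mu> = min (sin \<eta>) (1 - exp (- \<eta>))"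
  let ?w = "line_arg q l u z"
  have q2: "(2::real) ^ 1 \<le> 2 ^ q" using q by (intro power_increasing) auto
  then have eta: "0 < \<eta>" "\<eta> \<le> pi/2" using divide_left_mono[OF q2, of pi] by (simp_all add: \<eta>_def)
  have scale: "\<eta> \<le> \<bar>2 * pi / 2 ^ q * v\<bar> \<longleftrightarrow> 1/2 \<le> \<bar>v\<bar>" for v :: real
    unfolding \<eta>_def abs_mult by (simp add: field_simps)
  have "\<eta> \<le> \<bar>Re ?w\<bar> \<or> (\<forall>k::int. \<eta> \<le> \<bar>Im ?w - 2 * pi * of_int k\<bar>)"
  proof (rule ccontr)
    assume "\<not> ?thesis"
    then obtain k :: int where k: "\<not> \<eta> \<le> \<bar>Re ?w\<bar>" "\<not> \<eta> \<le> \<bar>Im ?w - 2 * pi * of_int k\<bar>" by blast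
    have "Im ?w - 2 * pi * of_int k = 2 * pi / 2 ^ q * (2 ^ (l + q) * Im z - 3/2 - of_int k * 2 ^ q)"
      unfolding Im_line_arg by (simp add: algebra_simps)
    then have "\<bar>2 ^ (l + q) * Im z - 3/2 - of_int k * 2 ^ q\<bar> < 1/2" using k(2) scale by simp
    moreover have "\<bar>2 ^ (l + q) * Re z - of_int u - 1/2\<bar> < 1/2" using k(1) scale unfolding Re_line_arg by simp
    ultimately have "z \<in> line_hole q l u k" unfolding line_hole_def in_dyadic_sq by (simp only: abs_less_iff of_int_add of_int_mult of_int_power of_int_numeral of_int_1) linarith
    then show False using z by blast
  qed
  then have "\<mu> \<le> cmod (1 - exp ?w)" unfolding \<mu>_def by (rule exp_minus_one_lower[OF eta])
  moreover have mu: "\<mu> > 0" using line_bound_pos[OF q] by (simp add: \<mu>_def \<eta>_def)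
  ultimately have "cmod (line_fun q l u z) \<le> 1 / \<mu>"
    unfolding line_fun_def norm_divide by (simp add: frac_le)
  moreover have "line_bound q = 1 / \<mu> + 1" by (simp add: line_bound_def \<mu>_def \<eta>_def)
  ultimately show "cmod (line_fun q l u z) \<le> line_bound q" "cmod (1 - line_fun q l u z) \<le> line_bound q"
    using norm_triangle_ineq4[of 1 "line_fun q l u z"] by simp_all
qed

text \<open>With \<open>q\<close>, and hence \<open>line_bound q\<close>, held fixed, increasing
  \<open>l\<close> steepens the step at will; accuracy is thus obtained at no cost in norm. The
  poles are put into a column of squares in the middle of the strip.\<close>

lemma line_exists:
  assumes c: "c1 < c2" and e: "(e::real) > 0"
  shows "\<exists>l u. c1 < of_int u / 2 ^ (l + q) \<and> of_int (u + 1) / 2 ^ (l + q) < c2 \<and>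
    (\<forall>z. Re z \<le> c1 \<longrightarrow> cmod (1 - line_fun q l u z) \<le> e) \<and> (\<forall>z. c2 \<le> Re z \<longrightarrow> cmod (line_fun q l u z) \<le> e)"
proof -
  \<comment> \<open>The first entry makes a square at most an eighth of the strip wide; the second
    gives \<open>exp T - 1 \<ge> T \<ge> 1 / e\<close> for the lower bound \<open>T\<close> of the
    exponents at the edges.\<close>
  obtain l :: nat where l: "max (8 / (c2 - c1)) (1 / e / (c2 - c1)) < 2 ^ l"
    using real_arch_pow[of 2 "max (8 / (c2 - c1)) (1 / e / (c2 - c1))"] by auto
  define N where "N = (2::real) ^ (l + q)"
  have l1: "8 \<le> 2 ^ l * (c2 - c1)" "1 / e \<le> 2 ^ l * (c2 - c1)"
    using l c e by (simp_all add: field_simps)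
  have "(2::real) ^ l \<le> N" unfolding N_def by (intro power_increasing) auto
  then have N8: "8 \<le> N * (c2 - c1)" using l1(1) c mult_right_mono[of "2 ^ l" N "c2 - c1"] by linarith
  have N0: "N > 0" by (simp add: N_def)
  define u where "u = \<lfloor>N * ((c1 + c2) / 2)\<rfloor>"
  have u: "of_int u \<le> N * ((c1 + c2) / 2)" "N * ((c1 + c2) / 2) < of_int u + 1"
    unfolding u_def by linarith+
  have u1: "N * c1 + 3 \<le> of_int u" using u N8 by (simp add: algebra_simps)
  have u2: "of_int u + 4 \<le> N * c2" using u N8 by (simp add: algebra_simps)
  define T where "T = 2 ^ l * (c2 - c1)"
  have T: "T > 0" "1 / e \<le> T" using l1 c by (auto simp: T_def)
  have eT: "1 / (exp T - 1) \<le> e"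
  proof -
    have "1 / e \<le> exp T - 1" using T exp_ge_add_one_self[of T] by linarith
    then show ?thesis using e T by (simp add: field_simps)
  qed
  have Re: "Re (line_arg q l u z) = 2 * pi * 2 ^ l * (Re z - (of_int u + 1/2) / N)" for z
    by (simp add: line_arg_def line_pole_def N_def)
  have mid: "(c1 + c2) / 2 - 1 / N < of_int u / N" "of_int u / N \<le> (c1 + c2) / 2"
  proof -
    have "N * ((c1 + c2) / 2) / N < (of_int u + 1) / N" using u(2) N0 by (rule divide_strict_right_mono)
    then show "(c1 + c2) / 2 - 1 / N < of_int u / N" using N0 by (simp add: add_divide_distrib)
    have "of_int u / N \<le> N * ((c1 + c2) / 2) / N" using u(1) N0 by (intro divide_right_mono) auto
    then show "of_int u / N \<le> (c1 + c2) / 2" using N0 by simp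
  qed
  have N8': "1 / N \<le> (c2 - c1) / 8" using N8 N0 by (simp add: field_simps)
  have pos: "c1 + (c2 - c1) / 4 \<le> (of_int u + 1/2) / N" "(of_int u + 1/2) / N \<le> c2 - (c2 - c1)/4"
  proof -
    have "(of_int u + 1/2) / N = of_int u / N + 1 / N / 2" by (simp add: add_divide_distrib)
    moreover have "0 < 1 / N" using N0 by simp
    moreover have "c1 + (c2 - c1) / 4 \<le> Z \<and> Z \<le> c2 - (c2 - c1)/4"
      if "Z = Y + X / 2" "0 < X" "(c1 + c2) / 2 - X < Y" "Y \<le> (c1 + c2) / 2" "X \<le> (c2 - c1) / 8" for X Y Z :: real
      using that c by (simp add: field_simps)
    ultimately have "c1 + (c2 - c1) / 4 \<le> (of_int u + 1/2) / N \<and> (of_int u + 1/2) / N \<le> c2 - (c2 - c1)/4"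
      using mid N8' by blast
    then show "c1 + (c2 - c1) / 4 \<le> (of_int u + 1/2) / N" "(of_int u + 1/2) / N \<le> c2 - (c2 - c1)/4"
      by auto
  qed
  have big: "T \<le> 2 * pi * 2 ^ l * d" if "(c2 - c1) / 4 \<le> d" for d
  proof -
    have "T = 4 * 2 ^ l * ((c2 - c1) / 4)" by (simp add: T_def)
    also have "\<dots> \<le> 4 * 2 ^ l * d" using that by (intro mult_left_mono) auto
    also have "\<dots> \<le> 2 * pi * 2 ^ l * d"
      using that c pi_gt3 by (intro mult_right_mono) auto
    finally show ?thesis .
  qed
  have A: "cmod (line_fun q l u z) \<le> e" if "c2 \<le> Re z" for z
  proof -
    have "T \<le> Re (line_arg q l u z)" unfolding Re using pos that by (intro big) linarith
    then have "exp T - 1 \<le> cmod (exp (line_arg q l u z)) - cmod 1" by simp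
    also have "\<dots> \<le> cmod (1 - exp (line_arg q l u z))" using norm_triangle_ineq2 by (metis norm_minus_commute)
    finally have "1 / cmod (1 - exp (line_arg q l u z)) \<le> 1 / (exp T - 1)"
      using T by (intro divide_left_mono mult_pos_pos) auto
    then show ?thesis using eT by (simp add: line_fun_def norm_divide)
  qed
  have B: "cmod (1 - line_fun q l u z) \<le> e" if "Re z \<le> c1" for z
  proof -
    have "T \<le> 2 * pi * 2 ^ l * ((of_int u + 1/2) / N - Re z)" using pos that by (intro big) linarith
    then have T1: "T \<le> - Re (line_arg q l u z)" unfolding Re by (simp add: algebra_simps)
    let ?w = "line_arg q l u z"
    have w1: "exp ?w \<noteq> 1"
    proof
      assume "exp ?w = 1"
      then have "Re ?w = 0" by (simp add: exp_eq_1)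
      then show False using T1 T by simp
    qed
    \<comment> \<open>The reflection \<open>w \<mapsto> - w\<close> exchanges the function with its
      complement, so the estimate of the other side applies.\<close>
    have "1 - line_fun q l u z = 1 / (1 - exp (- ?w))"
      using w1 by (simp add: line_fun_def exp_minus divide_simps) (simp add: algebra_simps)
    moreover have "exp T - 1 \<le> cmod (1 - exp (- ?w))"
    proof -
      have "exp T - 1 \<le> cmod (exp (- ?w)) - cmod 1" using T1 by simp
      also have "\<dots> \<le> cmod (1 - exp (- ?w))" using norm_triangle_ineq2 by (metis norm_minus_commute)
      finally show ?thesis .
    qed
    then have "1 / cmod (1 - exp (- ?w)) \<le> 1 / (exp T - 1)"
      using T by (intro divide_left_mono mult_pos_pos) auto
    ultimately show ?thesis using eT by (simp add: norm_divide)
  qed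
  have "c1 < of_int u / N" "of_int (u + 1) / N < c2"
    using u1 u2 N0 by (simp_all add: field_simps)
  then show ?thesis using A B unfolding N_def by (intro exI[of _ l] exI[of _ u] conjI allI impI)
qed

subsection \<open>The Swiss cheese\<close>

text \<open>One coordinate of the fact that dyadic squares are nested or disjoint. On the finer grid
  the coarse interval has the integer ends \<open>i * D\<close> and \<open>(i + 1) * D\<close>, and
  a unit cell overlapping it cannot stick out.\<close>

lemma dyadic_nested:
  fixes i i' :: int and x y :: real
  assumes "n \<le> m"
    and x: "of_int i < 2 ^ n * x" "2 ^ n * x < of_int i + 1" "of_int i' < 2 ^ m * x" "2 ^ m * x < of_int i' + 1"
    and y: "of_int i' < 2 ^ m * y" "2 ^ m * y < of_int i' + 1"
  shows "of_int i < 2 ^ n * y \<and> 2 ^ n * y < of_int i + 1"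
proof -
  define D where "D = (2::int) ^ (m - n)"
  have D: "D > 0" by (simp add: D_def)
  have m: "(2::real) ^ m = 2 ^ n * of_int D"
    using assms(1) by (simp add: D_def flip: power_add)
  have "of_int i * of_int D < 2 ^ n * x * of_int D" "2 ^ n * x * of_int D < (of_int i + 1) * of_int D"
    using x D by (auto intro!: mult_strict_right_mono)
  then have "of_int (i * D) < (of_int (i' + 1) :: real)" "of_int i' < (of_int ((i + 1) * D) :: real)"
    using x(3,4) unfolding m by (simp_all add: mult.assoc mult.commute mult.left_commute)
  then have "i * D < i' + 1" "i' < (i + 1) * D" unfolding of_int_less_iff by auto
  then have "i * D \<le> i'" "i' + 1 \<le> (i + 1) * D" by auto
  then have "of_int (i * D) \<le> (of_int i' :: real)" "of_int (i' + 1) \<le> (of_int ((i + 1) * D) :: real)"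
    unfolding of_int_le_iff by auto
  then have "of_int i * of_int D \<le> (of_int i' :: real)" "of_int i' + 1 \<le> ((of_int i + 1) * of_int D :: real)"
    by simp_all
  moreover have "of_int i' < 2 ^ n * y * of_int D" "2 ^ n * y * of_int D < of_int i' + 1"
    using y unfolding m by (simp_all add: mult_ac)
  ultimately have "of_int i * of_int D < 2 ^ n * y * of_int D" "2 ^ n * y * of_int D < (of_int i + 1) * of_int D"
    by linarith+
  then show ?thesis using D by (simp add: mult_less_cancel_right)
qed

lemma dyadic_sq_nested:
  assumes "n \<le> m" "z \<in> dyadic_sq n i j" "z \<in> dyadic_sq m i' j'"
  shows "dyadic_sq m i' j' \<subseteq> dyadic_sq n i j"
proof
  fix w assume "w \<in> dyadic_sq m i' j'"
  then show "w \<in> dyadic_sq n i j"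
    using assms dyadic_nested[of n m i "Re z" i' "Re w"] dyadic_nested[of n m j "Im z" j' "Im w"]
    unfolding in_dyadic_sq by blast
qed

text \<open>A direction and two rational thresholds. Countability of this type allows the weights
  \<open>(1/2) ^ to_nat (t, n, s)\<close>. The coordinate being cut is
  \<open>Re (cnj (cut_dir t) * z)\<close>, that is \<open>Re z\<close>, \<open>Im z\<close> or
  \<open>- Im z\<close>; a positive lower threshold keeps the holes away from
  \<open>0\<close>.\<close>

type_synonym cut_index = "nat \<times> rat \<times> rat"

definition cut_a :: "cut_index \<Rightarrow> real" where "cut_a t = of_rat (fst (snd t))"
definition cut_b :: "cut_index \<Rightarrow> real" where "cut_b t = of_rat (snd (snd t))"
definition cut_valid :: "cut_index \<Rightarrow> bool" where "cut_valid t \<longleftrightarrow> 0 < cut_a t \<and> cut_a t < cut_b t"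
definition cut_dir :: "cut_index \<Rightarrow> complex" where
  "cut_dir t = (if fst t = 0 then 1 else if fst t = 1 then \<i> else -\<i>)"
text \<open>Decreases to \<open>cut_a t\<close> while \<open>cut_b_seq\<close> increases to
  \<open>cut_b t\<close>; starting with a third of the interval keeps the two families of strips
  apart.\<close>

definition cut_a_seq :: "cut_index \<Rightarrow> nat \<Rightarrow> real" where "cut_a_seq t n = cut_a t + (cut_b t - cut_a t) / real (n + 3)"
definition cut_b_seq :: "cut_index \<Rightarrow> nat \<Rightarrow> real" where "cut_b_seq t n = cut_b t - (cut_b t - cut_a t) / real (n + 3)"
text \<open>A line has about \<open>2\<^sup>l\<close> holes of side \<open>2\<^sup>-\<^sup>l\<^sup>-\<^sup>q\<close> inside the frame, all at distance at least \<open>cut_a t\<close>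
  from \<open>0\<close>; \<open>q\<close> is chosen so that the total perimeter, weighted by the bound \<open>exp (1 / cut_a t)\<close> of
  \<open>\<bar>exp (1 / z)\<bar>\<close>, is summable over all lines.\<close>

definition line_q :: "cut_index \<Rightarrow> nat \<Rightarrow> bool \<Rightarrow> nat" where
  "line_q t n s = (SOME q. 2 \<le> q \<and> 8 / 2 ^ q * exp (1 / cut_a t) \<le> (1/2) ^ to_nat (t, n, s))"
definition line_M :: "cut_index \<Rightarrow> nat \<Rightarrow> real" where "line_M t n = line_bound (line_q t n True) + line_bound (line_q t n False)"
text \<open>The order of choices avoids circularity: \<open>line_q\<close> is fixed for all steps by
  summability alone and determines \<open>line_M\<close>; then the tolerance of step
  \<open>n\<close> may refer to \<open>line_M t (Suc n)\<close>; \<open>line_params\<close> comes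
  last, as \<open>line_bound\<close> does not depend on it.\<close>

definition line_tol :: "cut_index \<Rightarrow> nat \<Rightarrow> real" where
  "line_tol t n = 1 / 2 ^ (n + 4) / ((line_M t 0 + 4) * (1 + line_M t (Suc n)))"
text \<open>The flag \<open>True\<close> selects the line for \<open>hr\<close> in
  \<open>cut_iter\<close>, on the side of \<open>cut_b\<close>; \<open>False\<close> selects the one
  for \<open>hs\<close>.\<close>

definition line_lo :: "cut_index \<Rightarrow> nat \<Rightarrow> bool \<Rightarrow> real" where "line_lo t n s = (if s then cut_b_seq t n else cut_a_seq t (Suc n))"
definition line_hi :: "cut_index \<Rightarrow> nat \<Rightarrow> bool \<Rightarrow> real" where "line_hi t n s = (if s then cut_b_seq t (Suc n) else cut_a_seq t n)"
definition good_line :: "cut_index \<Rightarrow> nat \<Rightarrow> bool \<Rightarrow> nat \<Rightarrow> int \<Rightarrow> bool" where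
  "good_line t n s l u \<longleftrightarrow> line_lo t n s < of_int u / 2 ^ (l + line_q t n s) \<and> of_int (u + 1) / 2 ^ (l + line_q t n s) < line_hi t n s \<and>
    (\<forall>z. Re z \<le> line_lo t n s \<longrightarrow> cmod (1 - line_fun (line_q t n s) l u z) \<le> line_tol t n) \<and>
    (\<forall>z. line_hi t n s \<le> Re z \<longrightarrow> cmod (line_fun (line_q t n s) l u z) \<le> line_tol t n)"
definition line_params :: "cut_index \<Rightarrow> nat \<Rightarrow> bool \<Rightarrow> nat \<times> int" where
  "line_params t n s = (SOME (l, u). good_line t n s l u)"
definition line_l :: "cut_index \<Rightarrow> nat \<Rightarrow> bool \<Rightarrow> nat" where "line_l t n s = fst (line_params t n s)"
definition line_u :: "cut_index \<Rightarrow> nat \<Rightarrow> bool \<Rightarrow> int" where "line_u t n s = snd (line_params t n s)"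

definition hole :: "cut_index \<Rightarrow> nat \<Rightarrow> bool \<Rightarrow> int \<Rightarrow> complex set" where
  "hole t n s k = {z. cnj (cut_dir t) * z \<in> line_hole (line_q t n s) (line_l t n s) (line_u t n s) k}"
text \<open>Holes of different lines may be nested, and some lie outside the frame; the contour
  estimate works with the maximal ones inside it.\<close>

definition holes :: "complex set set" where
  "holes = {hole t n s k | t n s k. cut_valid t}"
definition frame :: "complex set" where "frame = cbox (Complex 0 (-1)) (Complex 1 1)"
definition cheese :: "complex set" where "cheese = frame - \<Union>holes"

lemma in_frame: "z \<in> frame \<longleftrightarrow> 0 \<le> Re z \<and> Re z \<le> 1 \<and> -1 \<le> Im z \<and> Im z \<le> 1"
  by (auto simp: frame_def in_cbox_complex_iff)

lemma line_q: "2 \<le> line_q t n s" "8 / 2 ^ line_q t n s * exp (1 / cut_a t) \<le> (1/2) ^ to_nat (t, n, s)"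
proof -
  define r where "r = (1/2::real) ^ to_nat (t, n, s)"
  have r: "r > 0" by (simp add: r_def)
  obtain q :: nat where q: "8 * exp (1 / cut_a t) / r < 2 ^ q"
    using real_arch_pow[of 2 "8 * exp (1 / cut_a t) / r"] by auto
  have "(2::real) ^ q \<le> 2 ^ (q + 2)" by (intro power_increasing) auto
  then have "8 * exp (1 / cut_a t) / r \<le> 2 ^ (q + 2)" using q by linarith
  then have "8 / 2 ^ (q+2) * exp (1 / cut_a t) \<le> r" using r by (simp add: field_simps)
  then have "\<exists>q. 2 \<le> q \<and> 8 / 2 ^ q * exp (1 / cut_a t) \<le> (1/2) ^ to_nat (t, n, s)"
    unfolding r_def by (intro exI[of _ "q + 2"]) simp
  from someI_ex[OF this] show "2 \<le> line_q t n s" "8 / 2 ^ line_q t n s * exp (1 / cut_a t) \<le> (1/2) ^ to_nat (t, n, s)"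
    unfolding line_q_def by auto
qed

lemma line_bound_ge1: "line_bound (line_q t n s) \<ge> 1"
  using line_bound_pos[of "line_q t n s"] line_q(1)[of t n s] by (simp add: line_bound_def)

lemma line_M_ge: "line_M t n \<ge> 0" "line_bound (line_q t n s) \<le> line_M t n"
  using line_bound_ge1[of t n True] line_bound_ge1[of t n False] by (cases s; simp add: line_M_def)+

lemma line_tol_pos: "line_tol t n > 0"
  using line_M_ge(1)[of t 0] line_M_ge(1)[of t "Suc n"] by (simp add: line_tol_def)

context
  fixes t assumes v: "cut_valid t"
begin

lemma cut_seqs: "cut_a_seq t (Suc n) < cut_a_seq t n" "cut_b_seq t n < cut_b_seq t (Suc n)" "cut_a_seq t n \<le> cut_b_seq t n" "cut_a t < cut_a_seq t n" "cut_b_seq t n < cut_b t"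
  "cut_a t < cut_b_seq t n"
proof -
  define d where "d = cut_b t - cut_a t"
  have d: "d > 0" using v by (simp add: d_def cut_valid_def)
  have "d / real (Suc n + 3) < d / real (n + 3)" using d by (intro divide_strict_left_mono) auto
  then show "cut_a_seq t (Suc n) < cut_a_seq t n" "cut_b_seq t n < cut_b_seq t (Suc n)" by (simp_all add: cut_a_seq_def cut_b_seq_def d_def)
  define X where "X = d / real (n + 3)"
  have "X \<le> d / 2" unfolding X_def using d by (intro divide_left_mono) auto
  moreover have "cut_a_seq t n = cut_a t + X" "cut_b_seq t n = cut_b t - X" by (simp_all add: cut_a_seq_def cut_b_seq_def X_def d_def)
  ultimately show "cut_a_seq t n \<le> cut_b_seq t n" "cut_a t < cut_b_seq t n" using d by (simp_all add: d_def)
  show "cut_a t < cut_a_seq t n" "cut_b_seq t n < cut_b t" using d by (simp_all add: cut_a_seq_def cut_b_seq_def d_def)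
qed

lemma line_lo_hi: "line_lo t n s < line_hi t n s" "cut_a t \<le> line_lo t n s" "line_hi t n s \<le> cut_b t"
  using cut_seqs(1-3)[of n] cut_seqs(4,5)[of n] cut_seqs(4,5,6)[of "Suc n"] cut_seqs(6)[of n] cut_seqs(3)[of "Suc n"] cut_seqs(3)[of n] v
  by (auto simp: line_lo_def line_hi_def cut_valid_def)

lemma line_spec:
  "line_lo t n s < of_int (line_u t n s) / 2 ^ (line_l t n s + line_q t n s)"
  "of_int (line_u t n s + 1) / 2 ^ (line_l t n s + line_q t n s) < line_hi t n s"
  "Re z \<le> line_lo t n s \<Longrightarrow> cmod (1 - line_fun (line_q t n s) (line_l t n s) (line_u t n s) z) \<le> line_tol t n"
  "line_hi t n s \<le> Re z \<Longrightarrow> cmod (line_fun (line_q t n s) (line_l t n s) (line_u t n s) z) \<le> line_tol t n"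
proof -
  obtain l u where line_u: "good_line t n s l u"
    using line_exists[OF line_lo_hi(1) line_tol_pos] unfolding good_line_def by blast
  have "case line_params t n s of (l, u) \<Rightarrow> good_line t n s l u"
    unfolding line_params_def by (rule someI[of _ "(l, u)"]) (use line_u in simp)
  then show "line_lo t n s < of_int (line_u t n s) / 2 ^ (line_l t n s + line_q t n s)"
    "of_int (line_u t n s + 1) / 2 ^ (line_l t n s + line_q t n s) < line_hi t n s"
    "Re z \<le> line_lo t n s \<Longrightarrow> cmod (1 - line_fun (line_q t n s) (line_l t n s) (line_u t n s) z) \<le> line_tol t n"
    "line_hi t n s \<le> Re z \<Longrightarrow> cmod (line_fun (line_q t n s) (line_l t n s) (line_u t n s) z) \<le> line_tol t n"
    by (simp_all add: good_line_def line_l_def line_u_def case_prod_beta)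
qed

lemma hole_Re: "z \<in> hole t n s k \<Longrightarrow> cut_a t \<le> Re (cnj (cut_dir t) * z)"
proof -
  let ?N = "(2::real) ^ (line_l t n s + line_q t n s)"
  assume "z \<in> hole t n s k"
  then have "of_int (line_u t n s) < ?N * Re (cnj (cut_dir t) * z)"
    by (simp add: hole_def line_hole_def in_dyadic_sq del: times_complex.sel)
  then have "of_int (line_u t n s) / ?N < Re (cnj (cut_dir t) * z)" by (simp add: divide_less_eq mult.commute del: times_complex.sel)
  then show ?thesis using line_spec(1)[of n s] line_lo_hi(2)[of n s] by linarith
qed

lemma hole_norm: "z \<in> hole t n s k \<Longrightarrow> cut_a t \<le> cmod z"
proof -
  assume "z \<in> hole t n s k"
  then have "cut_a t \<le> Re (cnj (cut_dir t) * z)" by (rule hole_Re)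
  also have "\<dots> \<le> cmod (cnj (cut_dir t) * z)" by (rule complex_Re_le_cmod)
  also have "\<dots> = cmod z" by (simp add: norm_mult cut_dir_def)
  finally show ?thesis .
qed

end

text \<open>The offset \<open>1\<close> in the definition of \<^const>\<open>line_hole\<close> keeps the rotated squares off the column
  \<open>i = 0\<close>, so that no hole meets the boundary of a dyadic square with a corner at the origin.\<close>

lemma hole_dyadic_sq:
  assumes v: "cut_valid t"
  shows "\<exists>i j. i \<noteq> 0 \<and> hole t n s k = dyadic_sq (line_l t n s + line_q t n s) i j"
proof -
  define q l u where "q = line_q t n s" and "l = line_l t n s" and "u = line_u t n s"
  define w where "w = k * 2 ^ q + 1"
  have four: "(4::int) dvd 2 ^ q" 
  proof -
    have "q = 2 + (q - 2)" using line_q(1)[of t n s] by (simp add: q_def)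
    then have "(2::int) ^ q = 2 ^ 2 * 2 ^ (q - 2)" by (metis power_add)
    then show ?thesis by simp
  qed
  then have "4 dvd k * 2 ^ q" by (rule dvd_mult)
  then have "4 dvd w - 1" by (simp add: w_def)
  \<comment> \<open>\<open>w\<close> is \<open>1\<close> modulo \<open>4\<close>, so neither
    \<open>w\<close> nor its mirror image \<open>- w - 1\<close> is the column
    \<open>0\<close>.\<close>
  then have w: "w \<noteq> 0" "- w - 1 \<noteq> 0" by presburger+
  have u: "u > 0"
  proof -
    have "0 < of_int u / (2::real) ^ (l + q)"
      using line_spec(1)[OF v, of n s] line_lo_hi(2)[OF v, of n s] v by (simp add: cut_valid_def u_def q_def l_def)
    then show ?thesis by (simp add: zero_less_divide_iff)
  qed
  have mem: "z \<in> hole t n s k \<longleftrightarrow> cnj (cut_dir t) * z \<in> dyadic_sq (l + q) u w" for z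
    by (simp add: hole_def line_hole_def q_def l_def u_def w_def)
  consider "fst t = 0" | "fst t = 1" | "fst t \<noteq> 0" "fst t \<noteq> 1" by blast
  then show ?thesis
  proof cases
    case 1
    then have "hole t n s k = dyadic_sq (l + q) u w" by (intro set_eqI) (simp add: mem cut_dir_def)
    moreover have "u \<noteq> 0" using u by simp
    ultimately show ?thesis unfolding l_def q_def by blast
  next
    case 2
    then have "hole t n s k = dyadic_sq (l + q) (- w - 1) u"
      by (intro set_eqI) (auto simp: mem cut_dir_def in_dyadic_sq)
    then show ?thesis using w(2) unfolding l_def q_def by blast
  next
    case 3
    then have "hole t n s k = dyadic_sq (l + q) w (- u - 1)"
      by (intro set_eqI) (auto simp: mem cut_dir_def in_dyadic_sq)
    then show ?thesis using w(1) unfolding l_def q_def by blast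
  qed
qed

lemma dyadic_sq_center: "Complex ((of_int i + 1/2) / 2 ^ n) ((of_int j + 1/2) / 2 ^ n) \<in> dyadic_sq n i j"
  by (simp add: in_dyadic_sq)

lemma open_dyadic_sq: "open (dyadic_sq n i j)" by (simp add: dyadic_sq_def open_box)

text \<open>This is for counting: at most \<open>2 * 2 ^ l\<close> holes of a line lie in the frame,
  because whatever the direction, the centre of such a hole has a coordinate of modulus at most
  \<open>1\<close> along the line.\<close>

lemma hole_in_frame:
  assumes v: "cut_valid t" and sub: "hole t n s k \<subseteq> frame"
  shows "k \<in> {- (2 ^ line_l t n s)..<2 ^ line_l t n s}"
proof -
  define q l u where "q = line_q t n s" and "l = line_l t n s" and "u = line_u t n s"
  let ?c = "line_pole q l u k"
  have "?c \<in> line_hole q l u k" by (simp add: line_hole_def in_dyadic_sq line_pole_def)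
  then have "cut_dir t * ?c \<in> hole t n s k"
    by (auto simp: hole_def q_def l_def u_def cut_dir_def)
  then have "cut_dir t * ?c \<in> frame" using sub by blast
  then have "\<bar>Im ?c\<bar> \<le> 1" by (auto simp: in_frame cut_dir_def split: if_splits)
  then have "\<bar>of_int k * 2 ^ q + 3/2\<bar> \<le> (2::real) ^ (l + q)" by (simp add: line_pole_def abs_divide)
  then have 1: "of_int k * 2 ^ q + 3/2 \<le> (2::real) ^ l * 2 ^ q" "- (2 ^ l * 2 ^ q) - 3/2 \<le> of_int k * (2::real) ^ q"
    by (auto simp: power_add abs_le_iff)
  have q4: "(2::real) ^ 2 \<le> 2 ^ q" using line_q(1)[of t n s] unfolding q_def by (intro power_increasing) auto
  have "of_int k * 2 ^ q < (2::real) ^ l * 2 ^ q" using 1(1) by linarith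
  then have "of_int k < (2::real) ^ l" by simp
  then have a: "k < 2 ^ l" by (metis of_int_less_iff of_int_numeral of_int_power)
  have "(- (2 ^ l) - 1) * 2 ^ q < of_int k * (2::real) ^ q" using 1(2) q4 by (simp add: algebra_simps)
  then have "- (2 ^ l) - 1 < (of_int k :: real)" by simp
  then have "of_int (- (2 ^ l) - 1) < (of_int k :: real)" by simp
  then have "- (2 ^ l) - 1 < k" unfolding of_int_less_iff .
  then show ?thesis using a by (simp add: l_def)
qed

text \<open>The weight is abstract, later the contribution of a hole to a contour integral, and its
  bound is assumed for every description of the square. So each hole can be charged to one line that
  produces it, with the level and the distance \<open>cut_a t\<close> of that line, and the lines
  sum to at most \<open>\<Sum>m. (1/2) ^ m\<close>.\<close>

lemma holes_weight:
  assumes fin: "finite \<F>" and F: "\<F> \<subseteq> {S \<in> holes. S \<subseteq> frame}"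
    and w: "\<And>S n i j r. \<lbrakk>S \<in> \<F>; S = dyadic_sq n i j; 0 < r; \<And>z. z \<in> S \<Longrightarrow> r \<le> cmod z\<rbrakk> \<Longrightarrow> w S \<le> 4 / 2 ^ n * exp (1 / r)"
  shows "sum w \<F> \<le> 2"
proof -
  have "\<forall>S\<in>\<F>. \<exists>t n s k. cut_valid t \<and> S = hole t n s k" using F unfolding holes_def by blast
  then obtain tt nn ss kk where h: "\<And>S. S \<in> \<F> \<Longrightarrow> cut_valid (tt S) \<and> S = hole (tt S) (nn S) (ss S) (kk S)"
    by metis
  define lam where "lam S = to_nat (tt S, nn S, ss S)" for S
  have line: "sum w {S \<in> \<F>. lam S = m} \<le> (1/2) ^ m" for m
  proof (cases "{S \<in> \<F>. lam S = m} = {}")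
    case False
    then obtain S0 where S0: "S0 \<in> \<F>" "lam S0 = m" by blast
    define t n s where "t = tt S0" and "n = nn S0" and "s = ss S0"
    have same: "tt S = t \<and> nn S = n \<and> ss S = s" if "S \<in> \<F>" "lam S = m" for S
    proof -
      have "to_nat (tt S, nn S, ss S) = to_nat (t, n, s)"
        using that S0 unfolding lam_def t_def n_def s_def by simp
      then show ?thesis by simp
    qed
    have v: "cut_valid t" using h[OF S0(1)] by (simp add: t_def)
    let ?l = "line_l t n s" and ?q = "line_q t n s"
    let ?A = "{S \<in> \<F>. lam S = m}"
    have "?A \<subseteq> hole t n s ` {- (2 ^ ?l)..<2 ^ ?l}"
    proof
      fix S assume S: "S \<in> ?A"
      then have eq: "S = hole t n s (kk S)" using h[of S] same[of S] by simp
      have "S \<subseteq> frame" using S F by blast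
      then have "kk S \<in> {- (2 ^ ?l)..<2 ^ ?l}" using hole_in_frame[OF v] eq by metis
      then show "S \<in> hole t n s ` {- (2 ^ ?l)..<2 ^ ?l}" using eq by blast
    qed
    then have "card ?A \<le> card (hole t n s ` {- (2 ^ ?l)..<2 ^ ?l :: int})" by (intro card_mono) auto
    also have "\<dots> \<le> card {- (2 ^ ?l)..<2 ^ ?l :: int}" by (rule card_image_le) simp
    also have "\<dots> = 2 * 2 ^ ?l" by (simp add: nat_power_eq nat_mult_distrib flip: mult_2)
    finally have card: "card ?A \<le> 2 * 2 ^ ?l" .
    have wS: "w S \<le> 4 / 2 ^ (?l + ?q) * exp (1 / cut_a t)" if "S \<in> ?A" for S
    proof -
      have eq: "S = hole t n s (kk S)" using h[of S] same[of S] that by simp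
      obtain i j where ij: "hole t n s (kk S) = dyadic_sq (?l + ?q) i j" using hole_dyadic_sq[OF v] by blast
      show ?thesis
      proof (rule w)
        show "S \<in> \<F>" using that by simp
        show "S = dyadic_sq (?l + ?q) i j" using eq ij by simp
        show "0 < cut_a t" using v by (simp add: cut_valid_def)
        show "cut_a t \<le> cmod z" if "z \<in> S" for z using hole_norm[OF v] that eq by metis
      qed
    qed
    have "sum w ?A \<le> of_nat (card ?A) * (4 / 2 ^ (?l + ?q) * exp (1 / cut_a t))"
      using wS by (rule sum_bounded_above)
    also have "\<dots> \<le> of_nat (2 * 2 ^ ?l) * (4 / 2 ^ (?l + ?q) * exp (1 / cut_a t))"
      using card by (intro mult_right_mono of_nat_mono) auto
    \<comment> \<open>The number of holes cancels the factor \<open>2 ^ l\<close> in the side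
      length, leaving the quantity that \<open>line_q\<close> was chosen to bound.\<close>
    also have "\<dots> = 8 / 2 ^ ?q * exp (1 / cut_a t)" by (simp add: power_add)
    also have "\<dots> \<le> (1/2) ^ to_nat (t, n, s)" by (rule line_q)
    also have "to_nat (t, n, s) = m" using S0 by (simp add: lam_def t_def n_def s_def)
    finally show ?thesis .
  next
    case True
    then show ?thesis by (simp only: sum.empty) simp
  qed
  have "sum w \<F> = (\<Sum>m\<in>lam ` \<F>. sum w {S \<in> \<F>. lam S = m})"
    using fin by (rule sum.image_gen)
  also have "\<dots> \<le> (\<Sum>m\<in>lam ` \<F>. (1/2) ^ m)" using line by (intro sum_mono)
  also have "\<dots> \<le> (\<Sum>m. (1/2::real) ^ m)"
    using fin by (intro sum_le_suminf summable_geometric) auto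
  also have "\<dots> = 2" by (subst suminf_geometric) auto
  finally show ?thesis .
qed

definition mero :: "(complex \<Rightarrow> complex) set" where
  "mero = {g. \<exists>P. finite P \<and> P \<inter> cheese = {} \<and> g holomorphic_on (ball 0 4 - P)}"

lemma meroI: "finite P \<Longrightarrow> P \<inter> cheese = {} \<Longrightarrow> g holomorphic_on (ball 0 4 - P) \<Longrightarrow> g \<in> mero"
  unfolding mero_def by blast

lemma meroE:
  assumes "g \<in> mero"
  obtains P where "finite P" "P \<inter> cheese = {}" "g holomorphic_on (ball 0 4 - P)"
  using assms unfolding mero_def by blast

lemma mero_entire: "g holomorphic_on ball 0 4 \<Longrightarrow> g \<in> mero"
  by (rule meroI[of "{}"]) auto

lemma frame_norm: "z \<in> frame \<Longrightarrow> cmod z \<le> 2"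
  using cmod_le[of z] by (auto simp: in_frame)

lemma frame_ball: "frame \<subseteq> ball 0 4"
  using frame_norm by (fastforce simp: dist_norm)

lemma cheese_ball: "cheese \<subseteq> ball 0 4"
  using frame_ball by (auto simp: cheese_def)

lemma holesE:
  assumes "S \<in> holes"
  obtains n i j r where "i \<noteq> 0" "S = dyadic_sq n i j" "r > 0" "\<And>z. z \<in> S \<Longrightarrow> r \<le> cmod z"
proof -
  obtain t n s k where t: "cut_valid t" "S = hole t n s k" using assms unfolding holes_def by blast
  obtain i j where ij: "i \<noteq> 0" "hole t n s k = dyadic_sq (line_l t n s + line_q t n s) i j" using hole_dyadic_sq[OF t(1)] by blast
  show ?thesis
  proof (rule that[OF ij(1)])
    show "S = dyadic_sq (line_l t n s + line_q t n s) i j" using ij t by simp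
    show "cut_a t > 0" using t(1) by (simp add: cut_valid_def)
    show "cut_a t \<le> cmod z" if "z \<in> S" for z using hole_norm[OF t(1)] that t(2) by metis
  qed
qed

lemma open_hole: "S \<in> holes \<Longrightarrow> open S"
  by (elim holesE) (simp add: open_dyadic_sq)

lemma connected_hole: "S \<in> holes \<Longrightarrow> connected S"
  by (elim holesE) (simp add: dyadic_sq_def convex_connected convex_box)

lemma zero_cheese: "0 \<in> cheese"
proof -
  have "0 \<notin> S" if "S \<in> holes" for S
    using holesE[OF that] by (metis norm_zero not_less)
  then show ?thesis by (auto simp: cheese_def in_frame)
qed

lemma compact_cheese: "compact cheese"
proof -
  have "open (\<Union>holes)" using open_hole by blast
  then show ?thesis unfolding cheese_def frame_def by (intro compact_diff compact_cbox)
qed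

interpretation cheese: fun_algebra cheese mero
proof
  show "compact cheese" by (rule compact_cheese)
  show "cheese \<noteq> {}" using zero_cheese by blast
  show "(\<lambda>_. c) \<in> mero" for c by (rule mero_entire) simp
  fix f assume f: "f \<in> mero"
  then obtain P where P: "finite P" "P \<inter> cheese = {}" "f holomorphic_on (ball 0 4 - P)" by (rule meroE)
  have "cheese \<subseteq> ball 0 4 - P" using P(2) cheese_ball by blast
  then show "continuous_on cheese f"
    using P(3) holomorphic_on_imp_continuous_on continuous_on_subset by blast
  fix g assume g: "g \<in> mero"
  then obtain P' where P': "finite P'" "P' \<inter> cheese = {}" "g holomorphic_on (ball 0 4 - P')" by (rule meroE)
  have h: "f holomorphic_on (ball 0 4 - (P \<union> P'))" "g holomorphic_on (ball 0 4 - (P \<union> P'))"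
    using P(3) P'(3) by (auto elim: holomorphic_on_subset)
  show "(\<lambda>x. f x + g x) \<in> mero" "(\<lambda>x. f x * g x) \<in> mero"
    by (rule meroI[of "P \<union> P'"]; use P P' h in \<open>auto intro: holomorphic_intros\<close>)+
qed

lemma cut_dir_cnj: "cmod (cut_dir t) = 1" "cut_dir t * cnj (cut_dir t) = 1" "cnj (cut_dir t) \<noteq> 0"
  by (auto simp: cut_dir_def)

lemma not_in_hole: "z \<in> cheese \<Longrightarrow> cut_valid t \<Longrightarrow> cnj (cut_dir t) * z \<notin> line_hole (line_q t n s) (line_l t n s) (line_u t n s) k"
proof
  assume a: "z \<in> cheese" "cut_valid t" "cnj (cut_dir t) * z \<in> line_hole (line_q t n s) (line_l t n s) (line_u t n s) k"
  have "hole t n s k \<in> holes" unfolding holes_def using a(2) by blast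
  moreover have "z \<in> hole t n s k" using a(3) by (simp add: hole_def)
  ultimately show False using a(1) unfolding cheese_def by blast
qed

lemma line_fun_mero:
  assumes v: "cut_valid t"
  shows "(\<lambda>z. line_fun (line_q t n s) (line_l t n s) (line_u t n s) (cnj (cut_dir t) * z)) \<in> mero"
proof -
  define W where "W z = line_arg (line_q t n s) (line_l t n s) (line_u t n s) (cnj (cut_dir t) * z)" for z
  have Wd: "(W has_field_derivative of_real (2 * pi * 2 ^ line_l t n s) * cnj (cut_dir t)) (at z)" for z
    unfolding W_def line_arg_def by (auto intro!: derivative_eq_intros)
  have Wh: "W holomorphic_on A" for A
    unfolding W_def line_arg_def by (intro holomorphic_intros)
  define E where "E z = 1 - exp (W z)" for z
  define P where "P = {z \<in> cball 0 4. E z = 0}"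
  have "finite P"
    unfolding P_def
  proof (rule holomorphic_compact_finite_zeros[of E UNIV])
    show "E holomorphic_on UNIV" unfolding E_def by (intro holomorphic_intros Wh)
    show "\<not> E constant_on UNIV"
    proof
      assume "E constant_on UNIV"
      then obtain c where "\<And>z. E z = c" unfolding constant_on_def by blast
      then have "E = (\<lambda>_. c)" by blast
      then have "(E has_field_derivative 0) (at 0)" by simp
      moreover have "(E has_field_derivative - (exp (W 0) * (of_real (2 * pi * 2 ^ line_l t n s) * cnj (cut_dir t)))) (at 0)"
        unfolding E_def by (auto intro!: derivative_eq_intros Wd)
      ultimately have "- (exp (W 0) * (of_real (2 * pi * 2 ^ line_l t n s) * cnj (cut_dir t))) = 0"
        using DERIV_unique by blast
      then show False using cut_dir_cnj(3)[of t] by simp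
    qed
  qed (auto simp: compact_cball)
  moreover have "P \<inter> cheese = {}"
  proof -
    have "z \<notin> cheese" if "z \<in> P" for z
    proof
      assume z: "z \<in> cheese"
      have "exp (W z) = 1" using that by (simp add: P_def E_def)
      then obtain k where "cnj (cut_dir t) * z \<in> line_hole (line_q t n s) (line_l t n s) (line_u t n s) k"
        using line_arg_pole unfolding W_def by blast
      then show False using not_in_hole[OF z v] by blast
    qed
    then show ?thesis by blast
  qed
  moreover have "(\<lambda>z. line_fun (line_q t n s) (line_l t n s) (line_u t n s) (cnj (cut_dir t) * z)) holomorphic_on (ball 0 4 - P)"
  proof -
    have "(\<lambda>z. 1 / (1 - exp (W z))) holomorphic_on (ball 0 4 - P)"
      by (intro holomorphic_intros Wh) (auto simp: P_def E_def)
    then show ?thesis by (simp add: line_fun_def W_def)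
  qed
  ultimately show ?thesis by (rule meroI)
qed

lemma cutoff_exists:
  assumes v: "cut_valid t"
  shows "\<exists>F\<in>cheese.cl. \<forall>z\<in>cheese. (Re (cnj (cut_dir t) * z) \<le> cut_a t \<longrightarrow> F z = 1) \<and> (cut_b t \<le> Re (cnj (cut_dir t) * z) \<longrightarrow> F z = 0)"
proof -
  define L where "L s n z = line_fun (line_q t n s) (line_l t n s) (line_u t n s) (cnj (cut_dir t) * z)" for s n z
  define x where "x z = Re (cnj (cut_dir t) * z)" for z
  have b: "cmod (L s n z) \<le> line_M t n" "cmod (1 - L s n z) \<le> line_M t n" if "z \<in> cheese" for s n z
    using line_fun_bound[of "line_q t n s" "cnj (cut_dir t) * z" "line_l t n s" "line_u t n s"] not_in_hole[OF that v, of n s] line_q(1)[of t n s] line_M_ge(2)[of t n s]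
    unfolding L_def by fastforce+
  have tol: "(line_M t 0 + 4) * line_tol t n * (1 + line_M t (Suc n)) \<le> 1 / 2 ^ (n + 4)" for n
    using line_M_ge(1)[of t 0] line_M_ge(1)[of t "Suc n"] by (simp add: line_tol_def)
  have r1: "x z \<le> cut_b_seq t n \<Longrightarrow> cmod (1 - L True n z) \<le> line_tol t n" for n z
    using line_spec(3)[OF v, of "cnj (cut_dir t) * z" n True] unfolding line_lo_def x_def L_def by simp
  have r2: "cut_b_seq t (Suc n) \<le> x z \<Longrightarrow> cmod (L True n z) \<le> line_tol t n" for n z
    using line_spec(4)[OF v, of n True "cnj (cut_dir t) * z"] unfolding line_hi_def x_def L_def by simp
  have s1: "x z \<le> cut_a_seq t (Suc n) \<Longrightarrow> cmod (1 - L False n z) \<le> line_tol t n" for n z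
    using line_spec(3)[OF v, of "cnj (cut_dir t) * z" n False] unfolding line_lo_def x_def L_def by simp
  have s2: "cut_a_seq t n \<le> x z \<Longrightarrow> cmod (L False n z) \<le> line_tol t n" for n z
    using line_spec(4)[OF v, of n False "cnj (cut_dir t) * z"] unfolding line_hi_def x_def L_def by simp
  obtain F where F: "uniform_limit cheese (cut_iter (L True) (L False)) F sequentially"
    "\<And>z. z \<in> cheese \<Longrightarrow> (\<And>n. x z \<le> cut_a_seq t n) \<Longrightarrow> F z = 1"
    "\<And>z. z \<in> cheese \<Longrightarrow> (\<And>n. cut_b_seq t n \<le> x z) \<Longrightarrow> F z = 0"
    using cut_iter_limit[of cheese x "cut_b_seq t" "L True" "line_tol t" "cut_a_seq t" "L False" "line_M t", OF r1 r2 s1 s2 b(1) b(2)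
      less_imp_le[OF cut_seqs(1)[OF v]] less_imp_le[OF cut_seqs(2)[OF v]] cut_seqs(3)[OF v] line_M_ge(1) less_imp_le[OF line_tol_pos] tol]
    by blast
  have LG: "L s n \<in> mero" for s n unfolding L_def using line_fun_mero[OF v] by simp
  have "cut_iter (L True) (L False) n \<in> cheese.cl" for n
  proof (induction n)
    case 0
    have "cut_iter (L True) (L False) 0 = (\<lambda>_. 1)" by (rule ext) simp
    then show ?case by simp
  next
    case (Suc n)
    have "cut_iter (L True) (L False) (Suc n) =
      (\<lambda>z. cut_iter (L True) (L False) n z * L True n z + (1 - cut_iter (L True) (L False) n z) * L False n z)"
      by (rule ext) simp
    moreover have "\<dots> \<in> cheese.cl"
      by (intro cheese.cl_add cheese.cl_mult cheese.cl_diff cheese.cl_const Suc uclosure_base LG)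
    ultimately show ?case by simp
  qed
  then have "F \<in> cheese.cl" using F(1) by (rule uclosure_unif_lim)
  moreover have "F z = 1" if "z \<in> cheese" "x z \<le> cut_a t" for z
    by (rule F(2)[OF that(1)]) (use that(2) cut_seqs(4)[OF v] in \<open>meson less_imp_le order_trans\<close>)
  moreover have "F z = 0" if "z \<in> cheese" "cut_b t \<le> x z" for z
    by (rule F(3)[OF that(1)]) (use that(2) cut_seqs(5)[OF v] in \<open>meson less_imp_le order_trans\<close>)
  ultimately show ?thesis unfolding x_def by blast
qed

lemma rat_between:
  assumes "0 \<le> x" "x < (y::real)"
  obtains a b where "0 < (of_rat a :: real)" "x < of_rat a" "(of_rat a :: real) < of_rat b" "of_rat b < y"
proof -
  obtain a where a: "x < of_rat a" "of_rat a < y" using of_rat_dense[OF assms(2)] by blast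
  obtain b where b: "of_rat a < (of_rat b :: real)" "of_rat b < y" using of_rat_dense[OF a(2)] by blast
  show ?thesis using that[of a b] a b assms by linarith
qed

text \<open>Thresholds are positive, so a direction helps only if the larger of the two coordinates
  is positive. For \<open>Re\<close> this holds in the half plane; vertically one uses
  \<open>Im\<close> when the upper point has positive imaginary part and \<open>- Im\<close>
  otherwise.\<close>

lemma cheese_separate:
  assumes "x \<in> cheese" "w \<in> cheese" "x \<noteq> w"
  shows "\<exists>t. cut_valid t \<and> ((Re (cnj (cut_dir t) * x) < cut_a t \<and> cut_b t < Re (cnj (cut_dir t) * w)) \<or>
                          (Re (cnj (cut_dir t) * w) < cut_a t \<and> cut_b t < Re (cnj (cut_dir t) * x)))"
proof -
  define A where "A t x w \<longleftrightarrow> Re (cnj (cut_dir t) * x) < cut_a t \<and> cut_b t < Re (cnj (cut_dir t) * w)" for t x w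
  have dd: "\<exists>t. cut_valid t \<and> A t x w"
    if lt: "max 0 (Re (cnj (cut_dir (d, 0, 0)) * x)) < Re (cnj (cut_dir (d, 0, 0)) * w)" for d x w
  proof -
    obtain a b where ab: "0 < (of_rat a :: real)" "max 0 (Re (cnj (cut_dir (d, 0, 0)) * x)) < of_rat a"
      "(of_rat a :: real) < of_rat b" "of_rat b < Re (cnj (cut_dir (d, 0, 0)) * w)"
      by (rule rat_between[OF _ lt]) auto
    have "cut_dir (d, a, b) = cut_dir (d, 0, 0)" by (simp add: cut_dir_def)
    then show ?thesis using ab by (intro exI[of _ "(d, a, b)"]) (simp add: A_def cut_valid_def cut_a_def cut_b_def)
  qed
  have main: "\<exists>t. cut_valid t \<and> (A t x w \<or> A t w x)"
    if xw: "x \<in> frame" "w \<in> frame" and ne: "Re x < Re w \<or> Im x < Im w" for x w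
  proof -
    consider "Re x < Re w" | "Im x < Im w" "0 < Im w" | "Im x < Im w" "Im w \<le> 0" using ne by linarith
    then show ?thesis
    proof cases
      case 1
      then have "\<exists>t. cut_valid t \<and> A t x w" using dd[of 0 x w] xw by (simp add: cut_dir_def in_frame)
      then show ?thesis by blast
    next
      case 2
      then have "\<exists>t. cut_valid t \<and> A t x w" using dd[of 1 x w] by (simp add: cut_dir_def)
      then show ?thesis by blast
    next
      case 3
      then have "\<exists>t. cut_valid t \<and> A t w x" using dd[of 2 w x] by (simp add: cut_dir_def)
      then show ?thesis by blast
    qed
  qed
  have "Re x < Re w \<or> Im x < Im w \<or> Re w < Re x \<or> Im w < Im x" using assms(3) by (auto simp: complex_eq_iff)
  moreover have "x \<in> frame" "w \<in> frame" using assms by (auto simp: cheese_def)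
  ultimately have "\<exists>t. cut_valid t \<and> (A t x w \<or> A t w x)" using main[of x w] main[of w x] by blast
  then show ?thesis unfolding A_def .
qed

subsection \<open>Failure of strong regularity in the plane\<close>

text \<open>The coarsest level among holes through \<open>p\<close> gives a maximal hole, since a
  coarser square meeting it would contain \<open>p\<close> as well.\<close>

lemma max_hole:
  assumes "S0 \<in> holes" "p \<in> S0"
  shows "\<exists>S\<in>holes. p \<in> S \<and> (\<forall>S'\<in>holes. S' \<inter> S \<noteq> {} \<longrightarrow> S' \<subseteq> S)"
proof -
  define Q where "Q n \<longleftrightarrow> (\<exists>i j. dyadic_sq n i j \<in> holes \<and> p \<in> dyadic_sq n i j)" for n
  obtain n0 where "Q n0" using assms holesE unfolding Q_def by metis
  then have "Q (LEAST n. Q n)" by (rule LeastI)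
  then obtain n i j where n: "n = (LEAST n. Q n)" "dyadic_sq n i j \<in> holes" "p \<in> dyadic_sq n i j" unfolding Q_def by blast
  have "S' \<subseteq> dyadic_sq n i j" if S': "S' \<in> holes" "S' \<inter> dyadic_sq n i j \<noteq> {}" for S'
  proof -
    obtain m i' j' where m: "S' = dyadic_sq m i' j'" using holesE[OF S'(1)] by metis
    obtain z where z: "z \<in> dyadic_sq n i j" "z \<in> dyadic_sq m i' j'" using S' m by blast
    show ?thesis
    proof (cases "n \<le> m")
      case True
      then show ?thesis using dyadic_sq_nested[OF True z] m by simp
    next
      case False
      then have "m \<le> n" by simp
      then have "dyadic_sq n i j \<subseteq> dyadic_sq m i' j'" using dyadic_sq_nested z by blast
      then have "Q m" unfolding Q_def using n(3) S'(1) m by blast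
      then show ?thesis using False n(1) Least_le[of Q m] by simp
    qed
  qed
  then show ?thesis using n(2,3) by blast
qed

definition hole_around :: "complex \<Rightarrow> complex set" where
  "hole_around p = (SOME S. S \<in> holes \<and> p \<in> S \<and> (\<forall>S'\<in>holes. S' \<inter> S \<noteq> {} \<longrightarrow> S' \<subseteq> S))"

lemma hole_around:
  assumes "p \<in> frame" "p \<notin> cheese"
  shows "hole_around p \<in> holes" "p \<in> hole_around p" "\<And>S'. S' \<in> holes \<Longrightarrow> S' \<inter> hole_around p \<noteq> {} \<Longrightarrow> S' \<subseteq> hole_around p"
proof -
  obtain S0 where "S0 \<in> holes" "p \<in> S0" using assms by (auto simp: cheese_def)
  then have "\<exists>S. S \<in> holes \<and> p \<in> S \<and> (\<forall>S'\<in>holes. S' \<inter> S \<noteq> {} \<longrightarrow> S' \<subseteq> S)"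
    using max_hole by blast
  from someI_ex[OF this]
  show "hole_around p \<in> holes" "p \<in> hole_around p" "\<And>S'. S' \<in> holes \<Longrightarrow> S' \<inter> hole_around p \<noteq> {} \<Longrightarrow> S' \<subseteq> hole_around p"
    unfolding hole_around_def by blast+
qed

text \<open>A hole through a boundary point would, being open, meet \<open>S\<close> and hence lie
  in \<open>S\<close> by maximality, although the boundary point does not.\<close>

lemma closure_max_hole:
  assumes S: "S \<in> holes" "\<And>S'. S' \<in> holes \<Longrightarrow> S' \<inter> S \<noteq> {} \<Longrightarrow> S' \<subseteq> S" "S \<subseteq> frame"
  shows "closure S - S \<subseteq> cheese"
proof
  fix z assume z: "z \<in> closure S - S"
  have "closed frame" by (simp add: frame_def closed_cbox)
  then have "z \<in> frame" using z S(3) closure_minimal by blast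
  moreover have "z \<notin> S'" if "S' \<in> holes" for S'
  proof
    assume "z \<in> S'"
    then have "S' \<inter> S \<noteq> {}" using z open_hole[OF that] open_Int_closure_eq_empty by blast
    then show False using S(2)[OF that] z \<open>z \<in> S'\<close> by blast
  qed
  ultimately show "z \<in> cheese" by (auto simp: cheese_def)
qed

text \<open>Grid points of level \<open>n\<close> are not interior to cells of that level, so a cell
  containing \<open>1 / 2 ^ m\<close> up to sign is coarser than level \<open>m\<close>; a coarser
  cell around the positive one is the cell starting at \<open>0\<close>.\<close>

lemma dyadic_line:
  fixes x :: real
  assumes "of_int i < 2 ^ n * x" "2 ^ n * x < of_int i + 1" "\<bar>x\<bar> = 1 / 2 ^ m"
  shows "n < m \<and> (x > 0 \<longrightarrow> i = 0) "
proof -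
  have nm: "n < m"
  proof (rule ccontr)
    assume "\<not> n < m"
    then have "(2::real) ^ n = 2 ^ m * 2 ^ (n - m)" by (simp flip: power_add)
    moreover have "x = 1 / 2 ^ m \<or> x = - (1 / 2 ^ m)" using assms(3) by linarith
    ultimately have "2 ^ n * x = of_int (2 ^ (n - m)) \<or> 2 ^ n * x = of_int (- (2 ^ (n - m)))" by auto
    then obtain d :: int where "2 ^ n * x = of_int d" by blast
    then show False using assms(1,2) by simp
  qed
  moreover have "i = 0" if "x > 0"
  proof -
    have "x = 1 / 2 ^ m" using that assms(3) by simp
    have "(2::real) ^ n < 2 ^ m" using nm by simp
    then have "2 ^ n * x < 1" using \<open>x = 1 / 2 ^ m\<close> by simp
    moreover have "0 < 2 ^ n * x" using that by simp
    ultimately show ?thesis using assms(1,2) by linarith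
  qed
  ultimately show ?thesis by blast
qed

text \<open>These are the segments on which contours run. A hole crossing one of those near the
  origin would be a coarser square in column \<open>0\<close>, which holes avoid. For the horizontal
  lines the argument works under \<open>Re z \<le> 1 / 2 ^ m\<close>, which dictates how the frame
  is cut into rectangles later.\<close>

lemma lines_cheese:
  assumes z: "z \<in> frame"
    and l: "Re z = 0 \<or> Re z = 1 \<or> Re z = 1 / 2 ^ m \<or> \<bar>Im z\<bar> = 1 \<or> (\<bar>Im z\<bar> = 1 / 2 ^ m \<and> Re z \<le> 1 / 2 ^ m)"
  shows "z \<in> cheese"
proof -
  have "z \<notin> S" if S: "S \<in> holes" for S
  proof
    assume zS: "z \<in> S"
    obtain n i j r where h: "i \<noteq> 0" "S = dyadic_sq n i j" "r > 0" "\<And>z. z \<in> S \<Longrightarrow> r \<le> cmod z"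
      using holesE[OF S] by metis
    then have d: "of_int i < 2 ^ n * Re z" "2 ^ n * Re z < of_int i + 1" "of_int j < 2 ^ n * Im z" "2 ^ n * Im z < of_int j + 1"
      using zS by (auto simp: in_dyadic_sq)
    consider "Re z = 0" | "\<bar>Re z\<bar> = 1 / 2 ^ 0" | "\<bar>Im z\<bar> = 1 / 2 ^ 0" | "\<bar>Re z\<bar> = 1 / 2 ^ m" "Re z > 0"
      | "\<bar>Im z\<bar> = 1 / 2 ^ m" "Re z \<le> 1 / 2 ^ m"
      using l by force
    then show False
    proof cases
      case 1
      then show False using d(1,2) by simp
    next
      case 2
      then show False using dyadic_line[OF d(1,2) 2] by simp
    next
      case 3
      then show False using dyadic_line[OF d(3,4) 3] by simp
    next
      case 4
      then show False using dyadic_line[OF d(1,2) 4(1)] h(1) by simp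
    next
      case 5
      have "n < m" using dyadic_line[OF d(3,4) 5(1)] by simp
      then have "(2::real) ^ n < 2 ^ m" by simp
      then have "2 ^ n * (1 / 2 ^ m) < (1::real)" by simp
      moreover have "2 ^ n * Re z \<le> 2 ^ n * (1 / 2 ^ m)" using 5(2) by (intro mult_left_mono) auto
      moreover have "0 \<le> 2 ^ n * Re z" using z by (simp add: in_frame)
      ultimately have "i = 0" using d(1,2) by linarith
      then show False using h(1) by simp
    qed
  qed
  then show ?thesis using z by (auto simp: cheese_def)
qed

section \<open>Contour integrals over rectangles\<close>

lemma zero_notin_box:
  assumes "cbox a b \<subseteq> frame" shows "0 \<notin> box a b"
proof
  assume "0 \<in> box a b"
  then have "Re a < 0" "a \<in> cbox a b" by (auto simp: in_box_complex_iff in_cbox_complex_iff)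
  then show False using assms by (auto simp: in_frame)
qed

lemma rect_residue:
  assumes P: "finite P" "f holomorphic_on (ball 0 4 - P)"
    and ab: "Re a < Re b" "Im a < Im b" "cbox a b \<subseteq> ball 0 4"
    and path: "path_image (rectpath a b) \<inter> P = {}"
  shows "contour_integral (rectpath a b) f = 2 * pi * \<i> * (\<Sum>p\<in>P \<inter> box a b. residue f p)"
proof -
  have sub: "path_image (rectpath a b) \<subseteq> cbox a b" using ab by (intro path_image_rectpath_subset_cbox) auto
  have w0: "winding_number (rectpath a b) z = 0" if "z \<notin> cbox a b" for z
    using that ab by (intro winding_number_rectpath_outside) auto
  have w1: "winding_number (rectpath a b) z = 1" if "z \<in> box a b" for z
    using that by (rule winding_number_rectpath)
  have "contour_integral (rectpath a b) f = 2 * pi * \<i> * (\<Sum>p\<in>P. winding_number (rectpath a b) p * residue f p)"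
  proof (rule Residue_theorem[OF open_ball connected_ball P])
    show "path_image (rectpath a b) \<subseteq> ball 0 4 - P" using sub ab(3) path by blast
    show "\<forall>z. z \<notin> ball 0 4 \<longrightarrow> winding_number (rectpath a b) z = 0" using w0 ab(3) by blast
  qed auto
  also have "(\<Sum>p\<in>P. winding_number (rectpath a b) p * residue f p) = (\<Sum>p\<in>P \<inter> box a b. residue f p)"
  proof (rule sum.mono_neutral_cong_right[OF P(1)])
    show "\<forall>i\<in>P - P \<inter> box a b. winding_number (rectpath a b) i * residue f i = 0"
    proof
      fix p assume p: "p \<in> P - P \<inter> box a b"
      have "p \<notin> path_image (rectpath a b)" using p path by blast
      then have "p \<notin> cbox a b" using p ab by (simp add: path_image_rectpath_cbox_minus_box)
      then show "winding_number (rectpath a b) p * residue f p = 0" using w0 by simp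
    qed
  qed (use w1 in auto)
  finally show ?thesis .
qed

lemma path_image_rectpath_segments:
  "path_image (rectpath a b) = closed_segment a (Complex (Re b) (Im a)) \<union> closed_segment (Complex (Re b) (Im a)) b \<union>
    closed_segment b (Complex (Re a) (Im b)) \<union> closed_segment (Complex (Re a) (Im b)) a"
  by (simp add: rectpath_def Let_def path_image_join Un_assoc)

lemma rect_split:
  assumes "Re a \<le> Re b" "Im a \<le> Im b" "continuous_on (path_image (rectpath a b)) f"
  shows "contour_integral (rectpath a b) f =
    contour_integral (linepath a (Complex (Re b) (Im a))) f + contour_integral (linepath (Complex (Re b) (Im a)) b) f +
    contour_integral (linepath b (Complex (Re a) (Im b))) f + contour_integral (linepath (Complex (Re a) (Im b)) a) f"
proof -
  have c: "f contour_integrable_on linepath a (Complex (Re b) (Im a))" "f contour_integrable_on linepath (Complex (Re b) (Im a)) b"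
    "f contour_integrable_on linepath b (Complex (Re a) (Im b))" "f contour_integrable_on linepath (Complex (Re a) (Im b)) a"
    by (rule contour_integrable_continuous_linepath, rule continuous_on_subset[OF assms(3)],
        use path_image_rectpath_segments[of a b] in blast)+
  show ?thesis
    unfolding rectpath_def Let_def
    by (simp add: contour_integral_join contour_integrable_joinI c)
qed

lemma contour_integrable_continuous_rectpath:
  assumes "continuous_on (path_image (rectpath a b)) f"
  shows "f contour_integrable_on rectpath a b"
proof -
  have "f contour_integrable_on linepath a (Complex (Re b) (Im a))" "f contour_integrable_on linepath (Complex (Re b) (Im a)) b"
    "f contour_integrable_on linepath b (Complex (Re a) (Im b))" "f contour_integrable_on linepath (Complex (Re a) (Im b)) a"
    by (rule contour_integrable_continuous_linepath, rule continuous_on_subset[OF assms],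
        use path_image_rectpath_segments[of a b] in blast)+
  then show ?thesis
    unfolding rectpath_def Let_def by (simp add: contour_integrable_joinI)
qed

lemma rect_bound:
  assumes ab: "Re a \<le> Re b" "Im a \<le> Im b" and cont: "continuous_on (path_image (rectpath a b)) f"
    and B: "B \<ge> 0" "\<And>z. z \<in> path_image (rectpath a b) \<Longrightarrow> cmod (f z) \<le> B"
  shows "cmod (contour_integral (rectpath a b) f) \<le> B * (2 * ((Re b - Re a) + (Im b - Im a)))"
proof -
  let ?p = "path_image (rectpath a b)"
  note p = path_image_rectpath_segments[of a b]
  have bd: "cmod (contour_integral (linepath x y) f) \<le> B * cmod (y - x)" if "closed_segment x y \<subseteq> ?p" for x y
    by (rule contour_integral_bound_linepath[OF contour_integrable_continuous_linepath B(1)])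
      (use that B(2) continuous_on_subset[OF cont] in blast)+
  have n: "cmod (Complex (Re b) (Im a) - a) = Re b - Re a" "cmod (b - Complex (Re b) (Im a)) = Im b - Im a"
    "cmod (Complex (Re a) (Im b) - b) = Re b - Re a" "cmod (a - Complex (Re a) (Im b)) = Im b - Im a"
    using ab by (simp_all add: cmod_def)
  have "cmod (contour_integral (rectpath a b) f) \<le> B * (Re b - Re a) + B * (Im b - Im a) + B * (Re b - Re a) + B * (Im b - Im a)"
    unfolding rect_split[OF ab cont]
    by (intro norm_triangle_mono; rule order_trans[OF bd]; (simp add: n; fail)?; unfold p; blast)
  also have "\<dots> = B * (2 * ((Re b - Re a) + (Im b - Im a)))" by (simp add: algebra_simps)
  finally show ?thesis .
qed

lemma cmod_exp_inverse: "cmod (exp (1 / z)) \<le> exp (1 / cmod z)"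
proof -
  have "Re (1 / z) \<le> cmod (1 / z)" by (rule complex_Re_le_cmod)
  then show ?thesis by (simp add: norm_divide)
qed

text \<open>On a circle of radius \<open>R\<close> the function is compared with
  \<open>z + 1 + 1 / (2 * z)\<close>, written as \<open>q\<close>. The difference is of order
  \<open>1 / R^2\<close>, so its integral tends to \<open>0\<close> as \<open>R\<close>
  grows.\<close>

lemma residue_z_exp_inverse: "residue (\<lambda>z. z * exp (1 / z)) 0 = 1 / 2"
proof -
  define f where "f z = z * exp (1 / z)" for z :: complex
  define q where "q z = (z\<^sup>2 + z + 1/2) / (z - 0)" for z :: complex
  define e where "e = 2 * pi * \<i> * residue f 0 - 2 * pi * \<i> * (1/2)"
  have bound: "cmod e \<le> 3 * pi / R" if R: "R \<ge> 1" for R :: real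
  proof -
    have "f holomorphic_on (UNIV - {0})" unfolding f_def by (intro holomorphic_intros) auto
    then have 1: "(f has_contour_integral 2 * pi * \<i> * residue f 0) (circlepath 0 R)"
      using R by (intro base_residue[of UNIV]) auto
    have "(\<lambda>z. z\<^sup>2 + z + 1/2 :: complex) holomorphic_on cball 0 R" by (intro holomorphic_intros) auto
    from Cauchy_integral_circlepath_simple[OF this, of 0]
    have 2: "(q has_contour_integral 2 * pi * \<i> * (1/2)) (circlepath 0 R)"
      using R by (simp add: q_def[abs_def])
    have "((\<lambda>z. f z - q z) has_contour_integral e) (circlepath 0 R)"
      unfolding e_def by (rule has_contour_integral_diff[OF 1 2])
    moreover have "cmod (f z - q z) \<le> 3 / (2 * R\<^sup>2)" if z: "cmod (z - 0) = R" for z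
    proof -
      have zR: "cmod z = R" "z \<noteq> 0" using z R by auto
      let ?w = "1 / z"
      have "f z - q z = z * (exp ?w - (\<Sum>k\<le>2. ?w ^ k / fact k))"
        using zR(2) by (simp add: f_def q_def atMost_nat_numeral fact_numeral field_simps power2_eq_square numeral_2_eq_2)
      then have "cmod (f z - q z) = R * cmod (exp ?w - (\<Sum>k\<le>2. ?w ^ k / fact k))"
        by (simp add: norm_mult zR)
      also have "\<dots> \<le> R * (exp \<bar>Re ?w\<bar> * cmod ?w ^ Suc 2 / fact 2)"
        using R by (intro mult_left_mono Taylor_exp) auto
      also have "\<dots> \<le> R * (3 * cmod ?w ^ Suc 2 / fact 2)"
      proof -
        have "\<bar>Re ?w\<bar> \<le> cmod ?w" by (rule abs_Re_le_cmod)
        also have "\<dots> \<le> 1" using zR R by (simp add: norm_divide)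
        finally have "exp \<bar>Re ?w\<bar> \<le> exp 1" by simp
        also have "exp 1 \<le> (3::real)" by (rule exp_le)
        finally have "exp \<bar>Re ?w\<bar> \<le> 3" .
        then show ?thesis using R by (intro mult_left_mono divide_right_mono mult_right_mono) auto
      qed
      also have "\<dots> = 3 / (2 * R\<^sup>2)" using R by (simp add: norm_divide zR power_divide power2_eq_square power3_eq_cube numeral_3_eq_3 field_simps)
      finally show ?thesis .
    qed
    ultimately have "cmod e \<le> 3 / (2 * R\<^sup>2) * (2 * pi * R)"
      using R by (intro has_contour_integral_bound_circlepath) auto
    also have "\<dots> = 3 * pi / R" using R by (simp add: power2_eq_square)
    finally show ?thesis .
  qed
  have "cmod e \<le> 0"
  proof (rule field_le_epsilon)
    fix d :: real assume d: "d > 0"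
    define R where "R = max 1 (3 * pi / d)"
    have R: "R \<ge> 1" "3 * pi / d \<le> R" by (auto simp: R_def)
    have "3 * pi / R \<le> d" using R d by (simp add: field_simps)
    then show "cmod e \<le> 0 + d" using bound[OF R(1)] by simp
  qed
  then have "2 * pi * \<i> * residue f 0 = 2 * pi * \<i> * (1/2)" by (simp add: e_def)
  then show ?thesis unfolding f_def by (subst (asm) mult_cancel_left) simp
qed

text \<open>The residue theorem moves the integral from the rectangle to the boundaries of the
  maximal holes that contain its poles. There \<open>g z\<close> may be replaced by
  \<open>g z - z\<close>, because \<open>z * exp (1 / z)\<close> is holomorphic across the hole.
  Each hole then contributes at most \<open>c\<close> times its perimeter times
  \<open>exp (1 / r)\<close>, and \<open>holes_weight\<close> bounds the total by
  \<open>2 * c\<close>, whatever the number of poles.\<close>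

lemma rect_estimate:
  assumes g: "finite P" "P \<inter> cheese = {}" "g holomorphic_on (ball 0 4 - P)"
    and c: "c \<ge> 0" "\<And>z. z \<in> cheese \<Longrightarrow> cmod (g z - z) \<le> c"
    and ab: "Re a < Re b" "Im a < Im b" "cbox a b \<subseteq> frame" "path_image (rectpath a b) \<subseteq> cheese - {0}"
  shows "cmod (contour_integral (rectpath a b) (\<lambda>z. g z * exp (1 / z))) \<le> 2 * c"
proof -
  define f where "f z = g z * exp (1 / z)" for z
  \<comment> \<open>The singularity of \<open>exp (1 / z)\<close> at \<open>0\<close> is treated as
    one more pole; no contour in this proof winds around it.\<close>
  define P0 where "P0 = insert 0 P"
  have P0: "finite P0" using g(1) by (simp add: P0_def)
  have "(\<lambda>z. exp (1 / z)) holomorphic_on (ball 0 4 - P0)"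
    by (intro holomorphic_intros) (auto simp: P0_def)
  moreover have "g holomorphic_on (ball 0 4 - P0)"
    using g(3) by (rule holomorphic_on_subset) (auto simp: P0_def)
  ultimately have fh: "f holomorphic_on (ball 0 4 - P0)"
    unfolding f_def by (intro holomorphic_on_mult)
  have zE: "(\<lambda>z. z * exp (1 / z)) holomorphic_on (ball 0 4 - {0})"
    by (intro holomorphic_intros) auto
  define F where "F = hole_around ` (P \<inter> box a b)"
  have boxQ: "box a b \<subseteq> frame" using ab(3) box_subset_cbox by blast
  have pf: "hole_around p \<in> holes" "p \<in> hole_around p" "\<And>S'. S' \<in> holes \<Longrightarrow> S' \<inter> hole_around p \<noteq> {} \<Longrightarrow> S' \<subseteq> hole_around p"
    if "p \<in> P \<inter> box a b" for p
    using hole_around[of p] that boxQ g(2) by blast+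
  have Fh: "S \<in> holes" "S \<inter> box a b \<noteq> {}" "\<And>S'. S' \<in> holes \<Longrightarrow> S' \<inter> S \<noteq> {} \<Longrightarrow> S' \<subseteq> S" if "S \<in> F" for S
    using that pf unfolding F_def by blast+
  have hcheese: "S \<inter> cheese = {}" if "S \<in> holes" for S using that by (auto simp: cheese_def)
  \<comment> \<open>A connected hole that met the box without lying in it would cross the boundary
    rectangle, which lies in the cheese.\<close>
  have Fbox: "S \<subseteq> box a b" if S: "S \<in> F" for S
  proof (rule ccontr)
    assume "\<not> S \<subseteq> box a b"
    moreover have "connected S" using Fh(1)[OF S] by (rule connected_hole)
    ultimately have "S \<inter> frontier (box a b) \<noteq> {}" using Fh(2)[OF S] connected_Int_frontier by blast
    moreover have "box a b \<noteq> {}" using Fh(2)[OF S] by blast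
    then have "frontier (box a b) = path_image (rectpath a b)"
      using ab by (simp add: frontier_box path_image_rectpath_cbox_minus_box)
    ultimately show False using ab(4) hcheese[OF Fh(1)[OF S]] by blast
  qed
  have Feq: "S = S'" if "S \<in> F" "S' \<in> F" "S \<inter> S' \<noteq> {}" for S S'
    using Fh(3)[OF that(1) Fh(1)[OF that(2)]] Fh(3)[OF that(2) Fh(1)[OF that(1)]] that(3) by blast
  have "\<forall>S\<in>F. \<exists>n i j. S = dyadic_sq n i j"
  proof
    fix S assume "S \<in> F"
    from holesE[OF Fh(1)[OF this]] show "\<exists>n i j. S = dyadic_sq n i j" by metis
  qed
  then obtain nn ii jj where rep: "\<And>S. S \<in> F \<Longrightarrow> S = dyadic_sq (nn S) (ii S) (jj S)" by metis
  define lo hi where "lo S = Complex (of_int (ii S) / 2 ^ nn S) (of_int (jj S) / 2 ^ nn S)"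
    and "hi S = Complex (of_int (ii S + 1) / 2 ^ nn S) (of_int (jj S + 1) / 2 ^ nn S)" for S
  have lohi: "Re (lo S) < Re (hi S)" "Im (lo S) < Im (hi S)" "Re (hi S) - Re (lo S) = 1 / 2 ^ nn S"
    "Im (hi S) - Im (lo S) = 1 / 2 ^ nn S" for S
    by (simp_all add: lo_def hi_def divide_strict_right_mono add_divide_distrib)
  let ?I = "\<lambda>S. contour_integral (rectpath (lo S) (hi S))" and ?bd = "\<lambda>S. path_image (rectpath (lo S) (hi S))"
  have Sbox: "S = box (lo S) (hi S)" if "S \<in> F" for S
    using rep[OF that] by (simp add: dyadic_sq_def lo_def hi_def)
  have Sne: "box (lo S) (hi S) \<noteq> {}" for S
    using dyadic_sq_center[of "ii S" "nn S" "jj S"] by (auto simp: dyadic_sq_def lo_def hi_def)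
  have Scl: "cbox (lo S) (hi S) = closure S" if "S \<in> F" for S
    using Sbox[OF that] Sne closure_box by metis
  have Sbd: "?bd S = closure S - S" if "S \<in> F" for S
    using Scl[OF that] Sbox[OF that] lohi by (simp add: path_image_rectpath_cbox_minus_box less_imp_le)
  have SQ: "S \<subseteq> frame" if "S \<in> F" for S using Fbox[OF that] boxQ by blast
  have SclQ: "closure S \<subseteq> frame" if "S \<in> F" for S
    using SQ[OF that] by (simp add: frame_def closure_minimal closed_cbox)
  have SbdK: "?bd S \<subseteq> cheese" if "S \<in> F" for S
    unfolding Sbd[OF that] using closure_max_hole[OF Fh(1)[OF that] Fh(3)[OF that] SQ[OF that]] by blast
  have Snorm: "\<exists>r>0. (\<forall>z\<in>closure S. r \<le> cmod z)" if S: "S \<in> F" for S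
  proof -
    obtain r where r: "r > 0" "\<And>z. z \<in> S \<Longrightarrow> r \<le> cmod z" using holesE[OF Fh(1)[OF S]] by metis
    have "closed {z::complex. r \<le> cmod z}" by (intro closed_Collect_le continuous_intros)
    then have "closure S \<subseteq> {z. r \<le> cmod z}" using r(2) by (intro closure_minimal) auto
    then show ?thesis using r(1) by blast
  qed
  have S0: "0 \<notin> closure S" if "S \<in> F" for S
    using Snorm[OF that] by (metis norm_zero not_less)
  have int_S: "?I S f = 2 * pi * \<i> * (\<Sum>p\<in>P0 \<inter> S. residue f p)" if S: "S \<in> F" for S
  proof -
    have "?I S f = 2 * pi * \<i> * (\<Sum>p\<in>P0 \<inter> box (lo S) (hi S). residue f p)"
    proof (rule rect_residue[OF P0 fh lohi(1,2)])
      show "cbox (lo S) (hi S) \<subseteq> ball 0 4" using Scl[OF S] SclQ[OF S] frame_ball by blast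
      show "?bd S \<inter> P0 = {}"
        using SbdK[OF S] g(2) S0[OF S] Sbd[OF S] unfolding P0_def by blast
    qed
    then show ?thesis using Sbox[OF S] by simp
  qed
  have "0 \<notin> box a b" using ab(3) by (rule zero_notin_box)
  have "contour_integral (rectpath a b) f = 2 * pi * \<i> * (\<Sum>p\<in>P0 \<inter> box a b. residue f p)"
  proof (rule rect_residue[OF P0 fh ab(1,2)])
    show "cbox a b \<subseteq> ball 0 4" using ab(3) frame_ball by blast
    show "path_image (rectpath a b) \<inter> P0 = {}" using ab(4) g(2) unfolding P0_def by blast
  qed
  also have "P0 \<inter> box a b = (\<Union>S\<in>F. P0 \<inter> S)"
  proof
    show "P0 \<inter> box a b \<subseteq> (\<Union>S\<in>F. P0 \<inter> S)"
    proof
      fix p assume p: "p \<in> P0 \<inter> box a b"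
      then have "p \<in> P \<inter> box a b" using \<open>0 \<notin> box a b\<close> unfolding P0_def by blast
      then have "hole_around p \<in> F" "p \<in> hole_around p" using pf(2) unfolding F_def by blast+
      then show "p \<in> (\<Union>S\<in>F. P0 \<inter> S)" using p by blast
    qed
    show "(\<Union>S\<in>F. P0 \<inter> S) \<subseteq> P0 \<inter> box a b" using Fbox by blast
  qed
  also have "(\<Sum>p\<in>(\<Union>S\<in>F. P0 \<inter> S). residue f p) = (\<Sum>S\<in>F. \<Sum>p\<in>P0 \<inter> S. residue f p)"
  proof (rule sum.UNION_disjoint)
    show "finite F" using g(1) by (simp add: F_def)
    show "\<forall>S\<in>F. finite (P0 \<inter> S)" using P0 by simp
    show "\<forall>S\<in>F. \<forall>S'\<in>F. S \<noteq> S' \<longrightarrow> P0 \<inter> S \<inter> (P0 \<inter> S') = {}" using Feq by blast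
  qed
  also have "2 * pi * \<i> * \<dots> = (\<Sum>S\<in>F. ?I S f)"
    using int_S by (simp add: sum_distrib_left)
  finally have tot: "contour_integral (rectpath a b) f = (\<Sum>S\<in>F. ?I S f)" .
  have bound: "cmod (?I S f) \<le> c * (4 / 2 ^ nn S * exp (1 / r))"
    if S: "S \<in> F" and r: "r > 0" "\<And>z. z \<in> S \<Longrightarrow> r \<le> cmod z" for S r
  proof -
    have "closed {z::complex. r \<le> cmod z}" by (intro closed_Collect_le continuous_intros)
    then have "closure S \<subseteq> {z. r \<le> cmod z}" using r(2) by (intro closure_minimal) auto
    then have rz: "r \<le> cmod z" if "z \<in> (?bd S)" for z using that unfolding Sbd[OF S] by blast
    have p0: "(?bd S) \<subseteq> ball 0 4 - P0"
      using SbdK[OF S] g(2) S0[OF S] Sbd[OF S] cheese_ball unfolding P0_def by blast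
    have cf: "continuous_on (?bd S) f" using fh p0 holomorphic_on_imp_continuous_on holomorphic_on_subset by blast
    have cz: "continuous_on (?bd S) (\<lambda>z. z * exp (1 / z))"
      by (intro continuous_intros) (use p0 in \<open>auto simp: P0_def\<close>)
    have "?I S (\<lambda>z. z * exp (1 / z)) = 0"
    proof -
      have "?I S (\<lambda>z. z * exp (1 / z)) =
        2 * pi * \<i> * (\<Sum>p\<in>{0} \<inter> box (lo S) (hi S). residue (\<lambda>z. z * exp (1 / z)) p)"
      proof (rule rect_residue[OF _ zE lohi(1,2)])
        show "cbox (lo S) (hi S) \<subseteq> ball 0 4" using Scl[OF S] SclQ[OF S] frame_ball by blast
        show "?bd S \<inter> {0} = {}" using p0 unfolding P0_def by blast
      qed simp
      moreover have "{0} \<inter> box (lo S) (hi S) = {}" using S0[OF S] Sbox[OF S] closure_subset by blast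
      ultimately show ?thesis by simp
    qed
    moreover have "?I S (\<lambda>z. f z - z * exp (1 / z)) =
      ?I S f - ?I S (\<lambda>z. z * exp (1 / z))"
      by (intro contour_integral_diff contour_integrable_continuous_rectpath cf cz)
    ultimately have eq: "?I S f = ?I S (\<lambda>z. f z - z * exp (1 / z))"
      by simp
    have "cmod (?I S f) \<le> c * exp (1 / r) * (2 * ((Re (hi S) - Re (lo S)) + (Im (hi S) - Im (lo S))))"
      unfolding eq
    proof (rule rect_bound)
      show "continuous_on (?bd S) (\<lambda>z. f z - z * exp (1 / z))" by (intro continuous_intros cf cz)
      fix z assume z: "z \<in> (?bd S)"
      have "f z - z * exp (1 / z) = (g z - z) * exp (1 / z)" by (simp add: f_def algebra_simps)
      then have "cmod (f z - z * exp (1 / z)) = cmod (g z - z) * cmod (exp (1 / z))" by (simp only: norm_mult)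
      also have "\<dots> \<le> c * exp (1 / r)"
      proof (intro mult_mono)
        show "cmod (g z - z) \<le> c" using c(2) SbdK[OF S] z by blast
        have "1 / cmod z \<le> 1 / r" using rz[OF z] r(1) by (intro frac_le) auto
        then show "cmod (exp (1 / z)) \<le> exp (1 / r)" using cmod_exp_inverse[of z] by (meson exp_le_cancel_iff order_trans)
      qed (use c in auto)
      finally show "cmod (f z - z * exp (1 / z)) \<le> c * exp (1 / r)" .
    qed (use lohi[of S] c in auto)
    then show ?thesis unfolding lohi(3,4) by (simp add: mult_ac)
  qed
  show ?thesis
  proof (cases "c = 0")
    case True
    have "?I S f = 0" if S: "S \<in> F" for S
    proof -
      obtain r where r: "r > 0" "\<And>z. z \<in> S \<Longrightarrow> r \<le> cmod z" using holesE[OF Fh(1)[OF S]] by metis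
      show ?thesis using bound[OF S r] True by simp
    qed
    then show ?thesis using tot True by (simp add: f_def[abs_def])
  next
    case False
    then have cp: "c > 0" using c by simp
    have "(\<Sum>S\<in>F. cmod (?I S f) / c) \<le> 2"
    proof (rule holes_weight)
      show "finite F" using g(1) by (simp add: F_def)
      show "F \<subseteq> {S \<in> holes. S \<subseteq> frame}" using Fh(1) SQ by blast
      fix S n i j r assume S: "S \<in> F" "S = dyadic_sq n i j" "0 < r" "\<And>z. z \<in> S \<Longrightarrow> r \<le> cmod z"
      \<comment> \<open>A nonempty box determines its corners, so every dyadic description of
        \<open>S\<close> has the same side.\<close>
      have nn: "(1::real) / 2 ^ nn S = 1 / 2 ^ n"
      proof -
        have "box (lo S) (hi S) = box (Complex (of_int i / 2 ^ n) (of_int j / 2 ^ n)) (Complex (of_int (i+1) / 2 ^ n) (of_int (j+1) / 2 ^ n))"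
          using Sbox[OF S(1)] S(2) by (simp add: dyadic_sq_def)
        then have "lo S = Complex (of_int i / 2 ^ n) (of_int j / 2 ^ n) \<and> hi S = Complex (of_int (i+1) / 2 ^ n) (of_int (j+1) / 2 ^ n)"
          using Sne[of S] by (metis box_eq_empty(1) eq_box(1))
        then have "Re (hi S) - Re (lo S) = 1 / 2 ^ n" by (simp add: add_divide_distrib)
        then show ?thesis using lohi(3)[of S] by simp
      qed
      have "cmod (?I S f) \<le> c * (4 * (1 / 2 ^ nn S) * exp (1 / r))"
        using bound[OF S(1,3,4)] by simp
      then show "cmod (?I S f) / c \<le> 4 / 2 ^ n * exp (1 / r)"
        using cp unfolding nn by (simp add: field_simps)
    qed
    then have "(\<Sum>S\<in>F. cmod (?I S f)) \<le> 2 * c"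
      using cp by (simp add: divide_le_eq flip: sum_divide_distrib)
    moreover have "cmod (contour_integral (rectpath a b) f) \<le> (\<Sum>S\<in>F. cmod (?I S f))"
      unfolding tot by (rule norm_sum)
    ultimately show ?thesis by (simp add: f_def[abs_def])
  qed
qed

lemma in_vseg: "z \<in> closed_segment (Complex x y1) (Complex x y2) \<longleftrightarrow> Re z = x \<and> min y1 y2 \<le> Im z \<and> Im z \<le> max y1 y2"
  by (auto simp: closed_segment_same_Re closed_segment_eq_real_ivl)

lemma in_hseg: "z \<in> closed_segment (Complex x1 y) (Complex x2 y) \<longleftrightarrow> Im z = y \<and> min x1 x2 \<le> Re z \<and> Re z \<le> max x1 x2"
  by (auto simp: closed_segment_same_Im closed_segment_eq_real_ivl)

text \<open>The contour integral of \<open>g z * exp (1 / z)\<close> over the frame with a square of side \<open>2 / 2\<^sup>m\<close> around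
  \<open>0\<close> cut out is small by \<open>rect_estimate\<close>. If \<open>g\<close> is near \<open>z\<close> on the outer part and near \<open>0\<close> on the
  notch, closing the notch on the left, where \<open>\<bar>exp (1 / z)\<bar> \<le> 1\<close>, leaves the residue of
  \<open>z * exp (1 / z)\<close> at \<open>0\<close>, which is \<open>1 / 2\<close>.\<close>

lemma key_estimate_aux:
  assumes g: "g \<in> mero" and m: "m \<ge> 2"
    and c: "c \<ge> 0" "\<And>z. z \<in> cheese \<Longrightarrow> cmod (g z - z) \<le> c"
    and e: "e \<ge> 0" "\<And>z. z \<in> cheese \<Longrightarrow> cmod z \<le> 2 / 2 ^ m \<Longrightarrow> cmod (g z) \<le> e"
  shows "pi \<le> 30 * c + 4 * e * exp (2 ^ m) + 1 / 2"
proof -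
  define \<tau> :: real where "\<tau> = 1 / 2 ^ m"
  have "(2::real) ^ 2 \<le> 2 ^ m" using m by (intro power_increasing) auto
  then have t: "0 < \<tau>" "\<tau> \<le> 1/4" by (simp_all add: \<tau>_def)
  obtain P where P: "finite P" "P \<inter> cheese = {}" "g holomorphic_on (ball 0 4 - P)" using g by (rule meroE)
  define I where "I f p q = contour_integral (linepath p q) f" for f :: "complex \<Rightarrow> complex" and p q
  define gE zE where "gE z = g z * exp (1 / z)" and "zE z = z * exp (1 / z)" for z
  let ?K = "cheese - {0}"
  have cont_g: "continuous_on ?K g"
    by (rule continuous_on_subset[OF cheese.P_cont[OF g]]) auto
  have cE: "continuous_on A (\<lambda>z. exp (1 / z))" if "0 \<notin> A" for A :: "complex set"
    by (intro continuous_intros) (use that in auto)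
  have cg: "continuous_on ?K gE" unfolding gE_def by (intro continuous_on_mult cont_g cE) simp
  have cz: "continuous_on A zE" if "0 \<notin> A" for A
    unfolding zE_def using that by (intro continuous_on_mult cE continuous_on_id)
  have inK: "z \<in> cheese" if "0 \<le> Re z" "Re z \<le> 1" "\<bar>Im z\<bar> \<le> 1"
      "Re z = 0 \<or> Re z = 1 \<or> Re z = \<tau> \<or> \<bar>Im z\<bar> = 1 \<or> (\<bar>Im z\<bar> = \<tau> \<and> Re z \<le> \<tau>)" for z
  proof (rule lines_cheese[of z m])
    show "z \<in> frame" using that(1-3) by (simp add: in_frame abs_le_iff)
    show "Re z = 0 \<or> Re z = 1 \<or> Re z = 1 / 2 ^ m \<or> \<bar>Im z\<bar> = 1 \<or> (\<bar>Im z\<bar> = 1 / 2 ^ m \<and> Re z \<le> 1 / 2 ^ m)"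
      using that(4) by (simp only: \<tau>_def)
  qed
  \<comment> \<open>The rectangle right of the notch has corners \<open>B\<close> and
    \<open>D\<close>; those above and below it have corners \<open>p1\<close>, \<open>E'\<close> and
    \<open>A\<close>, \<open>p3\<close>. All sides lie on segments granted by
    \<open>lines_cheese\<close>.\<close>
  define A B C D E' F p1 p2 p3 p4 where "A = Complex 0 (-1)" and "B = Complex \<tau> (-1)" and "C = Complex 1 (-1)"
    and "D = Complex 1 1" and "E' = Complex \<tau> 1" and "F = Complex 0 1" and "p1 = Complex 0 \<tau>" and "p2 = Complex \<tau> \<tau>"
    and "p3 = Complex \<tau> (- \<tau>)" and "p4 = Complex 0 (- \<tau>)"
  note pts = A_def B_def C_def D_def E'_def F_def p1_def p2_def p3_def p4_def
  have seg: "closed_segment B C \<subseteq> ?K" "closed_segment C D \<subseteq> ?K" "closed_segment D E' \<subseteq> ?K" "closed_segment E' B \<subseteq> ?K"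
    "closed_segment p1 p2 \<subseteq> ?K" "closed_segment p2 E' \<subseteq> ?K" "closed_segment E' F \<subseteq> ?K" "closed_segment F p1 \<subseteq> ?K"
    "closed_segment A B \<subseteq> ?K" "closed_segment B p3 \<subseteq> ?K" "closed_segment p3 p4 \<subseteq> ?K" "closed_segment p4 A \<subseteq> ?K"
    "closed_segment p3 p2 \<subseteq> ?K"
    using t by (auto simp: pts in_vseg in_hseg intro!: inK)
  note pim = path_image_rectpath_segments
  have corners: "Complex (Re D) (Im B) = C" "Complex (Re B) (Im D) = E'" "Complex (Re E') (Im p1) = p2" "Complex (Re p1) (Im E') = F"
    "Complex (Re p3) (Im A) = B" "Complex (Re A) (Im p3) = p4"
    by (simp_all add: pts)
  have R: "path_image (rectpath B D) \<subseteq> ?K" "path_image (rectpath p1 E') \<subseteq> ?K" "path_image (rectpath A p3) \<subseteq> ?K"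
    unfolding pim corners using seg by blast+
  have ord: "Re B < Re D" "Im B < Im D" "Re p1 < Re E'" "Im p1 < Im E'" "Re A < Re p3" "Im A < Im p3"
    using t by (simp_all add: pts)
  have cbQ: "cbox B D \<subseteq> frame" "cbox p1 E' \<subseteq> frame" "cbox A p3 \<subseteq> frame"
    using t by (auto simp: pts in_frame in_cbox_complex_iff)
  define J where "J f = contour_integral (rectpath B D) f + contour_integral (rectpath p1 E') f + contour_integral (rectpath A p3) f" for f
  define \<Gamma> where "\<Gamma> f = I f B C + I f C D + I f D E' + I f E' F + I f F p1 + I f p4 A + I f A B" for f
  define N where "N f = I f p3 p2 + I f p2 p1 + I f p4 p3" for f
  have rev: "I f p q = - I f q p" if "continuous_on (closed_segment p q) f" for f p q
    unfolding I_def using contour_integral_reverse_linepath[OF that] .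
  \<comment> \<open>Common sides cancel except along the notch: \<open>\<Gamma>\<close> collects the
    outer edges, \<open>N\<close> the three sides of the notch, run counterclockwise around
    \<open>0\<close>.\<close>
  have J: "J f = \<Gamma> f - N f" if f: "continuous_on ?K f" for f
  proof -
    have cs: "continuous_on (closed_segment p q) f" if "closed_segment p q \<subseteq> ?K" for p q
      using f that by (rule continuous_on_subset)
    have spl: "I f E' B = I f E' p2 + I f p2 p3 + I f p3 B"
    proof -
      have "I f E' B = I f E' p2 + I f p2 B"
        unfolding I_def by (rule contour_integral_split_linepath[OF cs[OF seg(4)]]) (use t in \<open>simp add: pts in_vseg\<close>)
      moreover have "closed_segment p2 B \<subseteq> ?K"
        by (rule subset_trans[OF _ seg(4)]) (use t in \<open>auto simp: pts in_vseg\<close>)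
      then have "I f p2 B = I f p2 p3 + I f p3 B"
        unfolding I_def by (intro contour_integral_split_linepath cs) (use t in \<open>simp_all add: pts in_vseg\<close>)
      ultimately show ?thesis by simp
    qed
    have r: "contour_integral (rectpath B D) f = I f B C + I f C D + I f D E' + I f E' B"
      "contour_integral (rectpath p1 E') f = I f p1 p2 + I f p2 E' + I f E' F + I f F p1"
      "contour_integral (rectpath A p3) f = I f A B + I f B p3 + I f p3 p4 + I f p4 A"
      using rect_split[of B D f] rect_split[of p1 E' f] rect_split[of A p3 f] ord continuous_on_subset[OF f R(1)]
        continuous_on_subset[OF f R(2)] continuous_on_subset[OF f R(3)]
      unfolding corners I_def by simp_all
    have v: "I f p2 E' = - I f E' p2" "I f B p3 = - I f p3 B" "I f p1 p2 = - I f p2 p1" "I f p3 p4 = - I f p4 p3" "I f p3 p2 = - I f p2 p3"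
      by (rule rev, rule cs, rule seg)+
    show ?thesis unfolding J_def r spl \<Gamma>_def N_def v by simp
  qed
  have JgE: "cmod (J gE) \<le> 6 * c"
  proof -
    have "cmod (contour_integral (rectpath B D) gE) \<le> 2 * c" "cmod (contour_integral (rectpath p1 E') gE) \<le> 2 * c"
      "cmod (contour_integral (rectpath A p3) gE) \<le> 2 * c"
      unfolding gE_def using rect_estimate[OF P c] ord cbQ R by simp_all
    then show ?thesis unfolding J_def
      using norm_triangle_ineq[of "contour_integral (rectpath B D) gE + contour_integral (rectpath p1 E') gE" "contour_integral (rectpath A p3) gE"]
       norm_triangle_ineq[of "contour_integral (rectpath B D) gE" "contour_integral (rectpath p1 E') gE"] by linarith
  qed
  have zEh: "zE holomorphic_on (ball 0 4 - {0})"
    unfolding zE_def by (intro holomorphic_intros) auto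
  have zero: "contour_integral (rectpath a b) zE = 0" if "Re a < Re b" "Im a < Im b" "cbox a b \<subseteq> frame" "path_image (rectpath a b) \<subseteq> ?K" for a b
  proof -
    have "contour_integral (rectpath a b) zE = 2 * pi * \<i> * (\<Sum>p\<in>{0} \<inter> box a b. residue zE p)"
      by (rule rect_residue[OF _ zEh that(1,2)]) (use that(3,4) frame_ball in auto)
    then show ?thesis using zero_notin_box[OF that(3)] by simp
  qed
  have JzE: "J zE = 0"
    unfolding J_def using zero ord cbQ R by simp
  define u where "u z = gE z - zE z" for z
  have cu: "continuous_on ?K u" unfolding u_def by (intro continuous_on_diff cg cz) simp
  have Iu: "I u p q = I gE p q - I zE p q" if "closed_segment p q \<subseteq> ?K" for p q
    unfolding I_def u_def
    by (rule contour_integral_diff; rule contour_integrable_continuous_linepath)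
      (use that in \<open>auto intro: continuous_on_subset[OF cg] cz\<close>)
  have Gu: "\<Gamma> u = \<Gamma> gE - \<Gamma> zE"
    unfolding \<Gamma>_def using Iu seg by simp
  \<comment> \<open>\<open>J zE = 0\<close> gives \<open>N zE = \<Gamma> zE\<close>, and
    \<open>\<Gamma> gE = J gE + N gE\<close>; only small terms remain on the right.\<close>
  have NzE: "N zE = J gE + N gE - \<Gamma> u"
    using J[OF cg] J[OF cz[of ?K]] JzE Gu by simp
  have bd: "cmod (I f p q) \<le> b * L" if "continuous_on (closed_segment p q) f" "\<And>z. z \<in> closed_segment p q \<Longrightarrow> cmod (f z) \<le> b"
      "b \<ge> 0" "cmod (q - p) \<le> L" for f p q b L
  proof -
    have "cmod (I f p q) \<le> b * cmod (q - p)" unfolding I_def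
      by (rule contour_integral_bound_linepath[OF contour_integrable_continuous_linepath]) (use that in auto)
    also have "\<dots> \<le> b * L" using that by (intro mult_left_mono)
    finally show ?thesis .
  qed
  have E3: "cmod (exp (1 / z)) \<le> 3" if "Re z = 0 \<or> 1 \<le> cmod z" for z :: complex
    using that
  proof
    assume "Re z = 0"
    then have "Re (1 / z) = 0" by (simp add: Re_divide)
    then show ?thesis by simp
  next
    assume "1 \<le> cmod z"
    then have "1 / cmod z \<le> 1" using frac_le[of 1 1 1 "cmod z"] by simp
    then have "exp (1 / cmod z) \<le> exp 1" by (simp only: exp_le_cancel_iff)
    then show ?thesis using cmod_exp_inverse[of z] exp_le by linarith
  qed
  \<comment> \<open>On the edges in \<open>\<Gamma>\<close> the kernel is bounded: it has modulus
    \<open>1\<close> on the imaginary axis and at most \<open>exp 1\<close> outside the unit disc.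
    Lengths bounded by \<open>8\<close> in total then give \<open>24 * c\<close>.\<close>
  have u3: "cmod (u z) \<le> 3 * c" if "z \<in> ?K" "Re z = 0 \<or> 1 \<le> cmod z" for z
  proof -
    have "u z = (g z - z) * exp (1 / z)" by (simp add: u_def gE_def zE_def algebra_simps)
    then have "cmod (u z) = cmod (g z - z) * cmod (exp (1 / z))" by (simp only: norm_mult)
    also have "\<dots> \<le> c * 3" using c that E3 by (intro mult_mono) auto
    finally show ?thesis by simp
  qed
  have big: "1 \<le> cmod z" if "\<bar>Re z\<bar> = 1 \<or> \<bar>Im z\<bar> = 1" for z
    using that abs_Re_le_cmod[of z] abs_Im_le_cmod[of z] by auto
  have lens: "cmod (C - B) \<le> 1" "cmod (D - C) \<le> 2" "cmod (E' - D) \<le> 1" "cmod (F - E') \<le> 1" "cmod (p1 - F) \<le> 1" "cmod (A - p4) \<le> 1" "cmod (B - A) \<le> 1"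
    "cmod (p2 - p3) \<le> 2 * \<tau>" "cmod (p1 - p2) \<le> \<tau>" "cmod (p3 - p4) \<le> \<tau>"
    using t cmod_le[of "C - B"] cmod_le[of "D - C"] cmod_le[of "E' - D"] cmod_le[of "F - E'"] cmod_le[of "p1 - F"] cmod_le[of "A - p4"]
      cmod_le[of "B - A"] cmod_le[of "p2 - p3"] cmod_le[of "p1 - p2"] cmod_le[of "p3 - p4"]
    by (simp_all add: pts)
  have GuB: "cmod (\<Gamma> u) \<le> 24 * c"
  proof -
    have s: "cmod (I u p q) \<le> 3 * c * L" if "closed_segment p q \<subseteq> ?K" "\<And>z. z \<in> closed_segment p q \<Longrightarrow> Re z = 0 \<or> 1 \<le> cmod z" "cmod (q - p) \<le> L" for p q L
      by (rule bd[OF continuous_on_subset[OF cu that(1)] u3[OF subsetD[OF that(1)] that(2)] _ that(3)]) (use c(1) in auto)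
    have "cmod (I u B C) \<le> 3 * c * 1"
      by (rule s[OF seg(1) _ lens(1)]) (use t in \<open>auto simp: pts in_vseg in_hseg intro!: big\<close>)
    moreover have "cmod (I u C D) \<le> 3 * c * 2"
      by (rule s[OF seg(2) _ lens(2)]) (use t in \<open>auto simp: pts in_vseg in_hseg intro!: big\<close>)
    moreover have "cmod (I u D E') \<le> 3 * c * 1"
      by (rule s[OF seg(3) _ lens(3)]) (use t in \<open>auto simp: pts in_vseg in_hseg intro!: big\<close>)
    moreover have "cmod (I u E' F) \<le> 3 * c * 1"
      by (rule s[OF seg(7) _ lens(4)]) (use t in \<open>auto simp: pts in_vseg in_hseg intro!: big\<close>)
    moreover have "cmod (I u F p1) \<le> 3 * c * 1"
      by (rule s[OF seg(8) _ lens(5)]) (use t in \<open>auto simp: pts in_vseg in_hseg intro!: big\<close>)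
    moreover have "cmod (I u p4 A) \<le> 3 * c * 1"
      by (rule s[OF seg(12) _ lens(6)]) (use t in \<open>auto simp: pts in_vseg in_hseg intro!: big\<close>)
    moreover have "cmod (I u A B) \<le> 3 * c * 1"
      by (rule s[OF seg(9) _ lens(7)]) (use t in \<open>auto simp: pts in_vseg in_hseg intro!: big\<close>)
    ultimately have "cmod (\<Gamma> u) \<le> 3 * c * 1 + 3 * c * 2 + 3 * c * 1 + 3 * c * 1 + 3 * c * 1 + 3 * c * 1 + 3 * c * 1"
      unfolding \<Gamma>_def by (intro norm_triangle_mono)
    then show ?thesis by simp
  qed
  have NgB: "cmod (N gE) \<le> 4 * e * exp (2 ^ m)"
  proof -
    \<comment> \<open>The kernel may reach \<open>exp (1 / \<tau>) = exp (2 ^ m)\<close> on the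
      notch, which is why \<open>e\<close> has to be tiny in terms of \<open>m\<close>.\<close>
    have small: "cmod (gE z) \<le> e * exp (2 ^ m)" if z: "z \<in> ?K" "\<bar>Re z\<bar> \<le> \<tau>" "\<bar>Im z\<bar> \<le> \<tau>" "Re z = \<tau> \<or> \<bar>Im z\<bar> = \<tau>" for z
    proof -
      have "cmod z \<le> 2 / 2 ^ m" using cmod_le[of z] z by (simp add: \<tau>_def)
      then have 1: "cmod (g z) \<le> e" using e(2) z by blast
      have "\<tau> \<le> cmod z" using z(4) t abs_Re_le_cmod[of z] abs_Im_le_cmod[of z] by auto
      then have "1 / cmod z \<le> 1 / \<tau>" using t by (intro frac_le) auto
      then have "exp (1 / cmod z) \<le> exp (2 ^ m)" by (simp add: \<tau>_def)
      then have "cmod (exp (1 / z)) \<le> exp (2 ^ m)" using cmod_exp_inverse[of z] by linarith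
      then show ?thesis unfolding gE_def norm_mult using 1 e(1) by (intro mult_mono) auto
    qed
    have s: "cmod (I gE p q) \<le> e * exp (2 ^ m) * L" if "closed_segment p q \<subseteq> ?K"
      "\<And>z. z \<in> closed_segment p q \<Longrightarrow> \<bar>Re z\<bar> \<le> \<tau> \<and> \<bar>Im z\<bar> \<le> \<tau> \<and> (Re z = \<tau> \<or> \<bar>Im z\<bar> = \<tau>)" "cmod (q - p) \<le> L" for p q L
      by (rule bd[OF continuous_on_subset[OF cg that(1)] small[OF subsetD[OF that(1)] that(2)[THEN conjunct1]
          that(2)[THEN conjunct2, THEN conjunct1] that(2)[THEN conjunct2, THEN conjunct2]] _ that(3)]) (use e(1) in auto)
    have sg: "closed_segment p2 p1 \<subseteq> ?K" "closed_segment p4 p3 \<subseteq> ?K"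
      using seg(5) seg(11) closed_segment_commute by metis+
    have "cmod (I gE p3 p2) \<le> e * exp (2 ^ m) * (2 * \<tau>)"
      by (rule s[OF seg(13) _ lens(8)]) (use t in \<open>auto simp: pts in_vseg in_hseg\<close>)
    moreover have "cmod (I gE p2 p1) \<le> e * exp (2 ^ m) * \<tau>"
      by (rule s[OF sg(1) _ lens(9)]) (use t in \<open>auto simp: pts in_vseg in_hseg\<close>)
    moreover have "cmod (I gE p4 p3) \<le> e * exp (2 ^ m) * \<tau>"
      by (rule s[OF sg(2) _ lens(10)]) (use t in \<open>auto simp: pts in_vseg in_hseg\<close>)
    ultimately have "cmod (N gE) \<le> e * exp (2 ^ m) * (2 * \<tau>) + e * exp (2 ^ m) * \<tau> + e * exp (2 ^ m) * \<tau>"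
      unfolding N_def by (intro norm_triangle_mono)
    also have "\<dots> = (4 * e * exp (2 ^ m)) * \<tau>" by simp
    also have "\<dots> \<le> (4 * e * exp (2 ^ m)) * 1" using t e(1) by (intro mult_left_mono) auto
    finally show ?thesis by simp
  qed
  \<comment> \<open>Left corners that complete the notch to a square around \<open>0\<close>; the
    added path \<open>L\<close> lies in \<open>Re z \<le> 0\<close>, where the kernel is bounded by
    \<open>1\<close>.\<close>
  define s1 s4 where "s1 = Complex (- \<tau>) (- \<tau>)" and "s4 = Complex (- \<tau>) \<tau>"
  have sq: "contour_integral (rectpath s1 p2) zE = pi * \<i>"
  proof -
    have "contour_integral (rectpath s1 p2) zE = 2 * pi * \<i> * (\<Sum>p\<in>{0} \<inter> box s1 p2. residue zE p)"
    proof (rule rect_residue[OF _ zEh])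
      show "cbox s1 p2 \<subseteq> ball 0 4"
      proof
        fix z assume "z \<in> cbox s1 p2"
        then have "cmod z \<le> 1" using cmod_le[of z] t by (auto simp: s1_def pts in_cbox_complex_iff)
        then show "z \<in> ball 0 4" by simp
      qed
      show "path_image (rectpath s1 p2) \<inter> {0} = {}"
        using t by (auto simp: pim s1_def pts in_vseg in_hseg)
    qed (use t in \<open>auto simp: s1_def pts\<close>)
    moreover have "{0} \<inter> box s1 p2 = {0}" using t by (auto simp: s1_def pts in_box_complex_iff)
    moreover have "residue zE 0 = 1 / 2" using residue_z_exp_inverse by (simp add: zE_def[abs_def])
    ultimately show ?thesis by simp
  qed
  define L where "L = I zE s1 p4 + I zE p1 s4 + I zE s4 s1"
  have NL: "N zE = pi * \<i> - L"
  proof -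
    have n0: "0 \<notin> closed_segment s1 p3" "0 \<notin> closed_segment p3 p2" "0 \<notin> closed_segment p2 s4" "0 \<notin> closed_segment s4 s1"
      using t by (auto simp: s1_def s4_def pts in_vseg in_hseg)
    have c2: "Complex (Re p2) (Im s1) = p3" "Complex (Re s1) (Im p2) = s4" by (simp_all add: s1_def s4_def pts)
    have "0 \<notin> path_image (rectpath s1 p2)" unfolding pim c2 using n0 by blast
    then have "contour_integral (rectpath s1 p2) zE = I zE s1 p3 + I zE p3 p2 + I zE p2 s4 + I zE s4 s1"
      using rect_split[of s1 p2 zE] cz t unfolding c2 I_def by (simp add: s1_def pts)
    moreover have "I zE s1 p3 = I zE s1 p4 + I zE p4 p3"
      unfolding I_def by (rule contour_integral_split_linepath[OF cz[OF n0(1)]]) (use t in \<open>simp add: s1_def pts in_hseg\<close>)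
    moreover have "I zE p2 s4 = I zE p2 p1 + I zE p1 s4"
      unfolding I_def by (rule contour_integral_split_linepath[OF cz[OF n0(3)]]) (use t in \<open>simp add: s4_def pts in_hseg\<close>)
    ultimately show ?thesis using sq by (simp add: N_def L_def algebra_simps)
  qed
  have LB: "cmod L \<le> 1 / 2"
  proof -
    have small: "cmod (zE z) \<le> 2 * \<tau>" if "\<bar>Re z\<bar> \<le> \<tau>" "\<bar>Im z\<bar> \<le> \<tau>" "Re z \<le> 0" for z
    proof -
      have "Re (1 / z) \<le> 0" using that(3) by (simp add: Re_divide divide_nonpos_nonneg)
      then have "cmod (exp (1 / z)) \<le> 1" by simp
      moreover have "cmod z \<le> 2 * \<tau>" using cmod_le[of z] that by linarith
      ultimately have "cmod z * cmod (exp (1 / z)) \<le> 2 * \<tau> * 1" using t by (intro mult_mono) auto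
      then show ?thesis by (simp add: zE_def norm_mult)
    qed
    have s: "cmod (I zE p q) \<le> 2 * \<tau> * L" if "0 \<notin> closed_segment p q"
      "\<And>z. z \<in> closed_segment p q \<Longrightarrow> \<bar>Re z\<bar> \<le> \<tau> \<and> \<bar>Im z\<bar> \<le> \<tau> \<and> Re z \<le> 0" "cmod (q - p) \<le> L" for p q L
      by (rule bd[OF cz[OF that(1)] small[OF that(2)[THEN conjunct1]
          that(2)[THEN conjunct2, THEN conjunct1] that(2)[THEN conjunct2, THEN conjunct2]] _ that(3)]) (use t in auto)
    have l: "cmod (p4 - s1) \<le> \<tau>" "cmod (s4 - p1) \<le> \<tau>" "cmod (s1 - s4) \<le> 2 * \<tau>"
      using t cmod_le[of "p4 - s1"] cmod_le[of "s4 - p1"] cmod_le[of "s1 - s4"] by (simp_all add: s1_def s4_def pts)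
    have "cmod (I zE s1 p4) \<le> 2 * \<tau> * \<tau>"
      by (rule s[OF _ _ l(1)]) (use t in \<open>auto simp: s1_def pts in_hseg\<close>)
    moreover have "cmod (I zE p1 s4) \<le> 2 * \<tau> * \<tau>"
      by (rule s[OF _ _ l(2)]) (use t in \<open>auto simp: s4_def pts in_hseg\<close>)
    moreover have "cmod (I zE s4 s1) \<le> 2 * \<tau> * (2 * \<tau>)"
      by (rule s[OF _ _ l(3)]) (use t in \<open>auto simp: s1_def s4_def in_vseg\<close>)
    ultimately have "cmod L \<le> 2 * \<tau> * \<tau> + 2 * \<tau> * \<tau> + 2 * \<tau> * (2 * \<tau>)"
      unfolding L_def by (intro norm_triangle_mono)
    also have "\<dots> = 8 * (\<tau> * \<tau>)" by simp
    also have "\<dots> \<le> 8 * (1/4 * (1/4))" using t by (intro mult_left_mono mult_mono) auto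
    finally show ?thesis by simp
  qed
  have "pi = cmod (pi * \<i>)" by (simp add: norm_mult)
  also have "pi * \<i> = J gE + N gE - \<Gamma> u + L" using NzE NL by (metis diff_add_cancel)
  also have "cmod \<dots> \<le> 6 * c + 4 * e * exp (2 ^ m) + 24 * c + 1 / 2"
    using JgE NgB GuB LB norm_triangle_ineq[of "J gE + N gE - \<Gamma> u" L] norm_triangle_ineq4[of "J gE + N gE" "\<Gamma> u"]
      norm_triangle_ineq[of "J gE" "N gE"] by linarith
  finally show ?thesis by simp
qed

text \<open>With \<open>c = 1/30\<close> and \<open>e = exp (- (2 ^ m)) / 8\<close> the preceding
  estimate would read \<open>pi \<le> 1 + 1/2 + 1/2\<close>. The tolerance \<open>e\<close> depends
  on \<open>r\<close> alone and not on \<open>g\<close>, which matters because the averaged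
  functions vanish near \<open>0\<close> only up to an error.\<close>

lemma key_estimate:
  assumes r: "r > 0"
  shows "\<exists>e>0. \<not> (\<exists>g\<in>mero. (\<forall>z\<in>cheese. cmod (g z - z) \<le> 1/30) \<and> (\<forall>z\<in>cheese. cmod z < r \<longrightarrow> cmod (g z) \<le> e))"
proof -
  obtain m0 :: nat where m0: "2 / r < 2 ^ m0" using real_arch_pow[of 2 "2 / r"] by auto
  define m where "m = max m0 2"
  have "(2::real) ^ m0 \<le> 2 ^ m" unfolding m_def by (intro power_increasing) auto
  then have "2 / r < 2 ^ m" using m0 by linarith
  then have mr: "2 / 2 ^ m < r" using r by (simp add: field_simps)
  define e where "e = exp (- (2 ^ m)) / (8::real)"
  have ee: "4 * e * exp (2 ^ m) = 1 / 2" by (simp add: e_def flip: exp_add)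
  have "\<not> (\<exists>g\<in>mero. (\<forall>z\<in>cheese. cmod (g z - z) \<le> 1/30) \<and> (\<forall>z\<in>cheese. cmod z < r \<longrightarrow> cmod (g z) \<le> e))"
  proof
    assume "\<exists>g\<in>mero. (\<forall>z\<in>cheese. cmod (g z - z) \<le> 1/30) \<and> (\<forall>z\<in>cheese. cmod z < r \<longrightarrow> cmod (g z) \<le> e)"
    then obtain g where g: "g \<in> mero" "\<And>z. z \<in> cheese \<Longrightarrow> cmod (g z - z) \<le> 1/30" "\<And>z. z \<in> cheese \<Longrightarrow> cmod z < r \<Longrightarrow> cmod (g z) \<le> e"
      by blast
    have "pi \<le> 30 * (1/30) + 4 * e * exp (2 ^ m) + 1 / 2"
      by (rule key_estimate_aux[OF g(1)]) (use g(2,3) mr in \<open>auto simp: m_def e_def\<close>)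
    then show False using ee pi_gt3 by simp
  qed
  then show ?thesis by (intro exI[of _ e]) (simp add: e_def)
qed

subsection \<open>Adjoining roots\<close>

definition cutoff :: "cut_index \<Rightarrow> complex \<Rightarrow> complex" where
  "cutoff t = (if cut_valid t then SOME F. F \<in> cheese.cl \<and>
     (\<forall>z\<in>cheese. (Re (cnj (cut_dir t) * z) \<le> cut_a t \<longrightarrow> F z = 1) \<and> (cut_b t \<le> Re (cnj (cut_dir t) * z) \<longrightarrow> F z = 0)) else (\<lambda>_. 1))"

lemma cutoff:
  "cutoff t \<in> cheese.cl"
  "cut_valid t \<Longrightarrow> z \<in> cheese \<Longrightarrow> Re (cnj (cut_dir t) * z) \<le> cut_a t \<Longrightarrow> cutoff t z = 1"
  "cut_valid t \<Longrightarrow> z \<in> cheese \<Longrightarrow> cut_b t \<le> Re (cnj (cut_dir t) * z) \<Longrightarrow> cutoff t z = 0"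
proof -
  have *: "cutoff t \<in> cheese.cl \<and>
     (\<forall>z\<in>cheese. (Re (cnj (cut_dir t) * z) \<le> cut_a t \<longrightarrow> cutoff t z = 1) \<and> (cut_b t \<le> Re (cnj (cut_dir t) * z) \<longrightarrow> cutoff t z = 0))"
    if "cut_valid t"
  proof -
    have "\<exists>F. F \<in> cheese.cl \<and>
     (\<forall>z\<in>cheese. (Re (cnj (cut_dir t) * z) \<le> cut_a t \<longrightarrow> F z = 1) \<and> (cut_b t \<le> Re (cnj (cut_dir t) * z) \<longrightarrow> F z = 0))"
      using cutoff_exists[OF that] by blast
    from someI_ex[OF this] show ?thesis unfolding cutoff_def using that by simp
  qed
  show "cutoff t \<in> cheese.cl"
  proof (cases "cut_valid t")
    case False
    then have "cutoff t = (\<lambda>_. 1)" by (simp add: cutoff_def)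
    then show ?thesis by simp
  qed (use * in blast)
  show "cut_valid t \<Longrightarrow> z \<in> cheese \<Longrightarrow> Re (cnj (cut_dir t) * z) \<le> cut_a t \<Longrightarrow> cutoff t z = 1"
    "cut_valid t \<Longrightarrow> z \<in> cheese \<Longrightarrow> cut_b t \<le> Re (cnj (cut_dir t) * z) \<Longrightarrow> cutoff t z = 0"
    using * by blast+
qed

definition cut_factor :: "cut_index \<times> bool \<Rightarrow> complex \<Rightarrow> complex" where
  "cut_factor p z = (if snd p then cutoff (fst p) z else 1 - cutoff (fst p) z)"

lemma cut_factor_cl: "cut_factor p \<in> cheese.cl"
proof -
  have "(\<lambda>z. if snd p then cutoff (fst p) z else 1 - cutoff (fst p) z) \<in> cheese.cl"
    using cutoff(1) cheese.cl_diff[OF cheese.cl_const cutoff(1)] by (cases "snd p") simp_all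
  then show ?thesis by (simp add: cut_factor_def[abs_def])
qed

lemma cut_factor_separates:
  assumes "x \<in> cheese" "w \<in> cheese" "x \<noteq> w"
  shows "\<exists>p U V. open U \<and> open V \<and> x \<in> U \<and> w \<in> V \<and> (\<forall>z\<in>cheese \<inter> U. cut_factor p z = 1) \<and> (\<forall>z\<in>cheese \<inter> V. cut_factor p z = 0)"
proof -
  obtain t where t: "cut_valid t" and d: "(Re (cnj (cut_dir t) * x) < cut_a t \<and> cut_b t < Re (cnj (cut_dir t) * w)) \<or>
                          (Re (cnj (cut_dir t) * w) < cut_a t \<and> cut_b t < Re (cnj (cut_dir t) * x))"
    using cheese_separate[OF assms] by blast
  define A B where "A = {z. Re (cnj (cut_dir t) * z) < cut_a t}" and "B = {z. cut_b t < Re (cnj (cut_dir t) * z)}"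
  have o: "open A" "open B" unfolding A_def B_def by (intro open_Collect_less continuous_intros)+
  have a: "cutoff t z = 1" if "z \<in> cheese \<inter> A" for z using that cutoff(2)[OF t, of z] by (simp add: A_def del: times_complex.sel)
  have b: "cutoff t z = 0" if "z \<in> cheese \<inter> B" for z using that cutoff(3)[OF t, of z] by (simp add: B_def del: times_complex.sel)
  from d show ?thesis
  proof
    assume "Re (cnj (cut_dir t) * x) < cut_a t \<and> cut_b t < Re (cnj (cut_dir t) * w)"
    then have "x \<in> A" "w \<in> B" unfolding A_def B_def by blast+
    then show ?thesis using o a b
      by (intro exI[of _ "(t, True)"] exI[of _ A] exI[of _ B]) (simp add: cut_factor_def)
  next
    assume "Re (cnj (cut_dir t) * w) < cut_a t \<and> cut_b t < Re (cnj (cut_dir t) * x)"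
    then have "x \<in> B" "w \<in> A" unfolding A_def B_def by blast+
    then show ?thesis using o a b
      by (intro exI[of _ "(t, False)"] exI[of _ B] exI[of _ A]) (simp add: cut_factor_def)
  qed
qed

text \<open>Lists over a countable type, so that all products, each paired with a degree, can be
  enumerated by \<open>from_nat\<close>.\<close>

definition cut_prod :: "(cut_index \<times> bool) list \<Rightarrow> complex \<Rightarrow> complex" where
  "cut_prod L z = (\<Prod>p\<leftarrow>L. cut_factor p z)"

lemma cut_prod_cl: "cut_prod L \<in> cheese.cl"
proof (induction L)
  case Nil
  have "cut_prod [] = (\<lambda>_. 1)" by (rule ext) (simp add: cut_prod_def)
  then show ?case by simp
next
  case (Cons p L)
  have "cut_prod (p # L) = (\<lambda>z. cut_factor p z * cut_prod L z)" by (rule ext) (simp add: cut_prod_def)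
  then show ?case using cheese.cl_mult[OF cut_factor_cl Cons] by simp
qed

lemma cut_prod_separates:
  assumes x: "x \<in> cheese" and C: "compact C" "C \<subseteq> cheese" "x \<notin> C"
  shows "\<exists>L U. open U \<and> x \<in> U \<and> (\<forall>z\<in>cheese \<inter> U. cut_prod L z = 1) \<and> (\<forall>z\<in>C. cut_prod L z = 0)"
proof -
  have "\<forall>w\<in>C. \<exists>p U V. open U \<and> open V \<and> x \<in> U \<and> w \<in> V \<and> (\<forall>z\<in>cheese \<inter> U. cut_factor p z = 1) \<and> (\<forall>z\<in>cheese \<inter> V. cut_factor p z = 0)"
  proof
    fix w assume "w \<in> C"
    then have "w \<in> cheese" "x \<noteq> w" using C by auto
    then show "\<exists>p U V. open U \<and> open V \<and> x \<in> U \<and> w \<in> V \<and> (\<forall>z\<in>cheese \<inter> U. cut_factor p z = 1) \<and> (\<forall>z\<in>cheese \<inter> V. cut_factor p z = 0)"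
      by (rule cut_factor_separates[OF x])
  qed
  then obtain p U V where p: "\<And>w. w \<in> C \<Longrightarrow> open (U w) \<and> open (V w) \<and> x \<in> U w \<and> w \<in> V w \<and>
      (\<forall>z\<in>cheese \<inter> U w. cut_factor (p w) z = 1) \<and> (\<forall>z\<in>cheese \<inter> V w. cut_factor (p w) z = 0)"
    by metis
  then obtain D where D: "D \<subseteq> C" "finite D" "C \<subseteq> (\<Union>w\<in>D. V w)"
    using compactE_image[OF C(1), of C V] by (metis UN_I subsetI)
  obtain ws where ws: "set ws = D" using finite_list[OF D(2)] by blast
  define L where "L = map p ws"
  have pD: "w \<in> D \<Longrightarrow> open (U w) \<and> x \<in> U w \<and> (\<forall>z\<in>cheese \<inter> U w. cut_factor (p w) z = 1) \<and> (\<forall>z\<in>cheese \<inter> V w. cut_factor (p w) z = 0)" for w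
    using p[of w] D(1) by auto
  have 1: "cut_prod L z = 1" if z: "z \<in> cheese \<inter> (\<Inter>w\<in>D. U w)" for z
  proof -
    have "cut_factor (p w) z = 1" if "w \<in> set ws" for w using pD[of w] that z ws by auto
    then have "map (\<lambda>p. cut_factor p z) L = map (\<lambda>_. 1) ws" unfolding L_def map_map by (intro map_cong) auto
    then show ?thesis by (simp add: cut_prod_def map_replicate_const)
  qed
  have 0: "cut_prod L z = 0" if z: "z \<in> C" for z
  proof -
    obtain w where w: "w \<in> D" "z \<in> V w" using D(3) z by auto
    then have "cut_factor (p w) z = 0" using pD[of w] z C(2) by auto
    then have "0 \<in> set (map (\<lambda>p. cut_factor p z) L)" using w(1) ws by (force simp: L_def)
    then show ?thesis unfolding cut_prod_def prod_list_zero_iff .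
  qed
  have "open (\<Inter>w\<in>D. U w)" using pD D(2) by (intro open_INT) simp_all
  moreover have "x \<in> (\<Inter>w\<in>D. U w)" using pD by simp
  ultimately show ?thesis using 1 0 by (intro exI[of _ L] exI[of _ "\<Inter>w\<in>D. U w"] conjI ballI) simp_all
qed

text \<open>Index \<open>j\<close> codes a product of cutoffs and the degree of a root to be adjoined. Products that do
  not vanish at \<open>0\<close> are discarded, so that the fibre over \<open>0\<close> stays a single point.\<close>

definition radicand :: "nat \<Rightarrow> complex \<Rightarrow> complex" where
  "radicand j = (let L = fst (from_nat j :: (cut_index \<times> bool) list \<times> nat) in if cut_prod L 0 = 0 then cut_prod L else (\<lambda>_. 0))"

definition root_degree :: "nat \<Rightarrow> nat" where
  "root_degree j = Suc (snd (from_nat j :: (cut_index \<times> bool) list \<times> nat))"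

lemma radicand: "radicand j \<in> cheese.cl" "radicand j 0 = 0" "root_degree j > 0"
  using cut_prod_cl by (simp_all add: radicand_def Let_def root_degree_def)

text \<open>A product of cutoffs has some uncontrolled bound \<open>B\<close>; a degree
  \<open>n + 1\<close> with \<open>B \<le> (1 + e) ^ (n + 1)\<close> exists, and every pair of
  product and degree occurs as an index. Adding \<open>0\<close> to the set where the product
  vanishes makes it an admissible radicand.\<close>

lemma radicand_peak:
  assumes x: "x \<in> cheese" "x \<noteq> 0" and V: "open V" "x \<in> V" and e: "e > 0"
  shows "\<exists>j. radicand j x = 1 \<and> (\<forall>z\<in>cheese - V. radicand j z = 0) \<and> (\<forall>z\<in>cheese. cmod (radicand j z) \<le> (1 + e) ^ root_degree j)"
proof -
  have c: "compact (insert 0 (cheese - V))" using compact_cheese V(1) by (simp add: compact_diff)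
  have s: "insert 0 (cheese - V) \<subseteq> cheese" "x \<notin> insert 0 (cheese - V)" using zero_cheese x V by auto
  obtain L U where LU: "open U \<and> x \<in> U \<and> (\<forall>z\<in>cheese \<inter> U. cut_prod L z = 1) \<and> (\<forall>z\<in>insert 0 (cheese - V). cut_prod L z = 0)"
    using cut_prod_separates[OF x(1) c s] by (elim exE)
  then have L: "x \<in> U" "\<forall>z\<in>cheese \<inter> U. cut_prod L z = 1" "\<forall>z\<in>insert 0 (cheese - V). cut_prod L z = 0"
    by simp_all
  obtain B where B: "\<forall>z\<in>cheese. cmod (cut_prod L z) \<le> B" using cheese.cl_bounded[OF cut_prod_cl] by blast
  obtain n where n: "B < (1 + e) ^ n" using real_arch_pow[of "1 + e" B] e by auto
  have "(1 + e) ^ n \<le> (1 + e) ^ Suc n" using e by (intro power_increasing) auto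
  then have n': "B \<le> (1 + e) ^ Suc n" using n by linarith
  define j where "j = to_nat (L, n)"
  have "radicand j = cut_prod L" "root_degree j = Suc n" using L(3) by (simp_all add: radicand_def root_degree_def j_def)
  then show ?thesis using L x(1) B n' by (intro exI[of _ j]) (auto intro: order_trans)
qed

text \<open>Coordinate \<open>0\<close> is the base point, coordinate \<open>Suc j\<close> a root of
  the \<open>j\<close>-th radicand. Adjoining all roots at once inside
  \<open>nat \<Rightarrow> complex\<close>, whose product topology is metrizable, replaces a limit
  of successive extensions.\<close>

definition cover :: "(nat \<Rightarrow> complex) set" where
  "cover = {s. s 0 \<in> cheese \<and> (\<forall>j. s (Suc j) ^ root_degree j = radicand j (s 0))}"

lemma cover_0: "s \<in> cover \<Longrightarrow> s 0 \<in> cheese" by (simp add: cover_def)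
lemma cover_Suc: "s \<in> cover \<Longrightarrow> s (Suc j) ^ root_degree j = radicand j (s 0)" by (simp add: cover_def)

lemma continuous_on_coord: "continuous_on A (\<lambda>s :: nat \<Rightarrow> complex. s i)"
  by (rule continuous_on_subset[OF continuous_on_product_coordinates]) simp

lemma compact_cover: "compact cover"
proof -
  \<comment> \<open>With \<open>B \<ge> 1\<close>, a root exceeding \<open>B\<close> in modulus has
    a power exceeding \<open>B\<close>, whatever the positive degree.\<close>
  have "\<exists>B\<ge>1. \<forall>z\<in>cheese. cmod (radicand j z) \<le> B" for j
  proof -
    obtain B where "\<forall>z\<in>cheese. cmod (radicand j z) \<le> B" using cheese.cl_bounded[OF radicand(1)] by blast
    then show ?thesis by (intro exI[of _ "max 1 B"]) force
  qed
  then obtain B where B: "\<And>j. 1 \<le> B j" "\<And>j z. z \<in> cheese \<Longrightarrow> cmod (radicand j z) \<le> B j" by metis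
  define C where "C i = (case i of 0 \<Rightarrow> cheese | Suc j \<Rightarrow> cball 0 (B j))" for i
  define Y where "Y = PiE UNIV C"
  have "compactin (product_topology (\<lambda>_::nat. euclidean :: complex topology) UNIV) (PiE UNIV C)"
    unfolding compactin_PiE using compact_cheese by (auto simp: C_def split: nat.split)
  then have cY: "compact Y" by (simp add: Y_def euclidean_product_topology)
  have Y0: "s 0 \<in> cheese" if "s \<in> Y" for s
    using that by (auto simp: Y_def C_def PiE_def Pi_def dest: spec[of _ 0])
  have sub: "cover \<subseteq> Y"
  proof
    fix s assume s: "s \<in> cover"
    have "s i \<in> C i" for i
    proof (cases i)
      case (Suc j)
      have "cmod (s (Suc j)) \<le> B j"
      proof (rule ccontr)
        assume "\<not> ?thesis"
        then have gt: "B j < cmod (s (Suc j))" by simp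
        have "cmod (s (Suc j)) ^ 1 \<le> cmod (s (Suc j)) ^ root_degree j"
          using gt B(1)[of j] radicand(3)[of j] by (intro power_increasing) auto
        then have "B j < cmod (s (Suc j) ^ root_degree j)" using gt by (simp add: norm_power)
        then show False using B(2)[OF cover_0[OF s], of j] cover_Suc[OF s, of j] by simp
      qed
      then show ?thesis by (simp add: C_def Suc)
    qed (simp add: C_def cover_0[OF s])
    then show "s \<in> Y" by (auto simp: Y_def)
  qed
  have cl: "closed {s \<in> Y. s (Suc j) ^ root_degree j - radicand j (s 0) = 0}" for j
  proof (rule continuous_closed_preimage_constant)
    show "closed Y" using cY by (rule compact_imp_closed)
    have "continuous_on Y (\<lambda>s. radicand j (s 0))"
      by (rule continuous_on_compose2[OF cheese.cl_cont[OF radicand(1)] continuous_on_coord]) (use Y0 in auto)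
    then show "continuous_on Y (\<lambda>s. s (Suc j) ^ root_degree j - radicand j (s 0))"
      by (intro continuous_on_diff continuous_on_power continuous_on_coord)
  qed
  have eq: "cover = Y \<inter> (\<Inter>j. {s \<in> Y. s (Suc j) ^ root_degree j - radicand j (s 0) = 0})"
    using sub Y0 by (auto simp: cover_def)
  have "closed (\<Inter>j. {s \<in> Y. s (Suc j) ^ root_degree j - radicand j (s 0) = 0})"
    using cl by (intro closed_INT) simp
  then show ?thesis unfolding eq by (rule compact_Int_closed[OF cY])
qed

lemma zero_cover: "(\<lambda>_. 0) \<in> cover"
  using zero_cheese radicand by (simp add: cover_def)

definition cover_monom :: "(complex \<Rightarrow> complex) \<Rightarrow> nat \<Rightarrow> (nat \<Rightarrow> nat) \<Rightarrow> (nat \<Rightarrow> complex) \<Rightarrow> complex" where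
  "cover_monom g N \<alpha> s = g (s 0) * (\<Prod>j<N. s (Suc j) ^ \<alpha> j)"

text \<open>Coefficients range over the closure \<open>cheese.cl\<close>, so that replacing a full
  power of a root by its radicand stays inside the base algebra.\<close>

inductive_set cover_poly :: "((nat \<Rightarrow> complex) \<Rightarrow> complex) set" where
  monom: "g \<in> cheese.cl \<Longrightarrow> cover_monom g N \<alpha> \<in> cover_poly"
| add: "f \<in> cover_poly \<Longrightarrow> g \<in> cover_poly \<Longrightarrow> (\<lambda>s. f s + g s) \<in> cover_poly"

lemma prod_power_pad: "N \<le> M \<Longrightarrow> (\<Prod>j<N. s (Suc j) ^ \<alpha> j) = (\<Prod>j<M. (s (Suc j) :: complex) ^ (if j < N then \<alpha> j else 0))"
  by (rule prod.mono_neutral_cong_left) auto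

lemma cover_poly_mult: "f \<in> cover_poly \<Longrightarrow> g \<in> cover_poly \<Longrightarrow> (\<lambda>s. f s * g s) \<in> cover_poly"
proof (induction f rule: cover_poly.induct)
  case (monom a N \<alpha>)
  from monom(2) show ?case
  proof (induction g rule: cover_poly.induct)
    case (monom b M \<beta>)
    define \<gamma> where "\<gamma> j = (if j < N then \<alpha> j else 0) + (if j < M then \<beta> j else 0)" for j
    have "(\<lambda>s. cover_monom a N \<alpha> s * cover_monom b M \<beta> s) = cover_monom (\<lambda>z. a z * b z) (max N M) \<gamma>"
    proof
      fix s :: "nat \<Rightarrow> complex"
      let ?A = "\<Prod>j<N. s (Suc j) ^ \<alpha> j" and ?B = "\<Prod>j<M. s (Suc j) ^ \<beta> j"
      have le: "N \<le> max N M" "M \<le> max N M" by simp_all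
      have "?A * ?B = (\<Prod>j<max N M. s (Suc j) ^ \<gamma> j)"
        unfolding prod_power_pad[OF le(1), of s] prod_power_pad[OF le(2), of s]
        by (simp only: \<gamma>_def power_add prod.distrib)
      moreover have "(a (s 0) * ?A) * (b (s 0) * ?B) = (a (s 0) * b (s 0)) * (?A * ?B)" by (simp only: mult_ac)
      ultimately show "cover_monom a N \<alpha> s * cover_monom b M \<beta> s = cover_monom (\<lambda>z. a z * b z) (max N M) \<gamma> s"
        by (simp only: cover_monom_def)
    qed
    moreover have "cover_monom (\<lambda>z. a z * b z) (max N M) \<gamma> \<in> cover_poly" by (intro cover_poly.monom cheese.cl_mult \<open>a \<in> _\<close> \<open>b \<in> _\<close>)
    ultimately show ?case by simp
  next
    case (add g h)
    have "(\<lambda>s. cover_monom a N \<alpha> s * (g s + h s)) = (\<lambda>s. cover_monom a N \<alpha> s * g s + cover_monom a N \<alpha> s * h s)"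
      by (simp add: distrib_left)
    then show ?case using cover_poly.add[OF add.IH] by simp
  qed
next
  case (add f h)
  have "(\<lambda>s. (f s + h s) * g s) = (\<lambda>s. f s * g s + h s * g s)" by (simp add: distrib_right)
  then show ?case using cover_poly.add[OF add.IH[OF add.prems]] by simp
qed

lemma cover_poly_base: "g \<in> cheese.cl \<Longrightarrow> (\<lambda>s. g (s 0)) \<in> cover_poly"
  using cover_poly.monom[of g 0] by (simp add: cover_monom_def[abs_def])

lemma cover_poly_coord: "(\<lambda>s. s (Suc j)) \<in> cover_poly"
proof -
  have "cover_monom (\<lambda>_. 1) (Suc j) (\<lambda>i. if i = j then 1 else 0) = (\<lambda>s. s (Suc j))"
    by (rule ext) (simp add: cover_monom_def)
  then show ?thesis using cover_poly.monom[OF cheese.cl_const, of 1 "Suc j" "\<lambda>i. if i = j then 1 else 0"] by simp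
qed

interpretation cover: fun_algebra cover cover_poly
proof
  show "compact cover" by (rule compact_cover)
  show "cover \<noteq> {}" using zero_cover by blast
  show "(\<lambda>_. c) \<in> cover_poly" for c using cover_poly_base[OF cheese.cl_const] .
  show "\<And>f g. f \<in> cover_poly \<Longrightarrow> g \<in> cover_poly \<Longrightarrow> (\<lambda>x. f x + g x) \<in> cover_poly" by (rule cover_poly.add)
  show "\<And>f g. f \<in> cover_poly \<Longrightarrow> g \<in> cover_poly \<Longrightarrow> (\<lambda>x. f x * g x) \<in> cover_poly" by (rule cover_poly_mult)
  show "continuous_on cover f" if "f \<in> cover_poly" for f
    using that
  proof (induction rule: cover_poly.induct)
    case (monom g N \<alpha>)
    have "continuous_on cover (\<lambda>s. g (s 0))"
      by (rule continuous_on_compose2[OF cheese.cl_cont[OF monom] continuous_on_coord]) (auto simp: cover_0)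
    then show ?case unfolding cover_monom_def[abs_def]
      by (intro continuous_on_mult continuous_on_prod continuous_on_power continuous_on_coord)
  qed (rule continuous_on_add)
qed

lemma base_cl: "g \<in> cheese.cl \<Longrightarrow> (\<lambda>s. g (s 0)) \<in> cover.cl"
  by (rule uclosure_base[OF cover_poly_base])

lemma coord_cl: "(\<lambda>s. s (Suc j)) \<in> cover.cl"
  by (rule uclosure_base[OF cover_poly_coord])

text \<open>The image of \<open>C\<close> in the plane is compact and misses \<open>x\<close>. In
  this way properties of the fibre over \<open>x\<close> extend to the fibres over a
  neighbourhood.\<close>

lemma closed_fibre_image:
  assumes "compact C" "C \<subseteq> cover" "\<And>s. s \<in> C \<Longrightarrow> s 0 \<noteq> x"
  shows "\<exists>V. open V \<and> x \<in> V \<and> (\<forall>s\<in>C. s 0 \<notin> V)"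
proof -
  have "compact ((\<lambda>s. s 0) ` C)" using assms(1) by (intro compact_continuous_image continuous_on_coord)
  then have "open (- ((\<lambda>s. s 0) ` C))" using compact_imp_closed by blast
  then show ?thesis using assms(3) by (intro exI[of _ "- ((\<lambda>s. s 0) ` C)"]) auto
qed

lemma mero_id: "(\<lambda>z. z) \<in> mero" by (rule mero_entire) (rule holomorphic_on_ident)

text \<open>On functions of the base point the character is evaluation at \<open>y 0\<close>:
  \<open>z - y 0\<close> lies in its kernel, so it is not invertible, and
  \<open>p z - p (y 0)\<close> is divisible by it within \<open>mero\<close>. The values on the root
  coordinates satisfy the equations of \<open>cover\<close> because the character is
  multiplicative.\<close>

lemma cover_eval:
  assumes ch: "cover.character \<psi>"
  shows "\<exists>y\<in>cover. \<forall>p\<in>cover_poly. \<psi> p = p y"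
proof -
  define \<xi> where "\<xi> g = \<psi> (\<lambda>s. g (s 0))" for g :: "complex \<Rightarrow> complex"
  note chs = cover.char_add[OF ch] cover.char_mult[OF ch] cover.char_const[OF ch] cover.char_cong[OF ch]
  have chi: "cheese.character \<xi>"
    unfolding cheese.character_def
  proof (intro conjI ballI allI impI)
    fix f g assume fg: "f \<in> cheese.cl" "g \<in> cheese.cl"
    show "\<xi> (\<lambda>x. f x + g x) = \<xi> f + \<xi> g" "\<xi> (\<lambda>x. f x * g x) = \<xi> f * \<xi> g"
      unfolding \<xi>_def using chs(1,2)[OF base_cl[OF fg(1)] base_cl[OF fg(2)]] by simp_all
  next
    show "\<xi> (\<lambda>x. c) = c" for c unfolding \<xi>_def by (rule chs(3))
  next
    fix f g :: "complex \<Rightarrow> complex" assume "\<forall>x\<in>cheese. f x = g x"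
    then show "\<xi> f = \<xi> g" unfolding \<xi>_def by (intro chs(4)) (simp add: cover_0)
  qed
  define y where "y i = \<psi> (\<lambda>s. s i)" for i
  have y0: "y 0 = \<xi> (\<lambda>z. z)" by (simp add: y_def \<xi>_def)
  have lin: "(\<lambda>z. z - y 0) \<in> mero" by (rule mero_entire) (intro holomorphic_intros)
  have chilin: "\<xi> (\<lambda>z. z - y 0) = 0"
    using cheese.char_diff[OF chi uclosure_base[OF mero_id] cheese.cl_const, of "y 0"] cheese.char_const[OF chi] y0 by simp
  have yK: "y 0 \<in> cheese"
  proof (rule ccontr)
    assume n: "y 0 \<notin> cheese"
    have "(\<lambda>z. 1 / (z - y 0)) \<in> mero"
      by (rule meroI[of "{y 0}"]) (use n in \<open>auto intro!: holomorphic_intros\<close>)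
    then have "\<xi> (\<lambda>z. z - y 0) \<noteq> 0"
      by (rule cheese.char_nonzero[OF chi uclosure_base[OF lin] uclosure_base]) (use n in auto)
    then show False using chilin by simp
  qed
  have chiG: "\<xi> p = p (y 0)" if p: "p \<in> mero" for p
  proof -
    obtain P where P: "finite P" "P \<inter> cheese = {}" "p holomorphic_on (ball 0 4 - P)" using p by (rule meroE)
    define q where "q z = (if z = y 0 then deriv p (y 0) else (p z - p (y 0)) / (z - y 0))" for z
    have "open (ball (0::complex) 4 - P)" using P(1) by (simp add: open_Diff finite_imp_closed)
    then have "q holomorphic_on (ball 0 4 - P)" unfolding q_def by (rule pole_lemma_open[OF P(3)])
    then have q: "q \<in> mero" by (rule meroI[OF P(1,2)])
    have "\<xi> (\<lambda>z. (z - y 0) * q z) = 0"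
      using cheese.char_mult[OF chi uclosure_base[OF lin] uclosure_base[OF q]] chilin by simp
    moreover have "(\<lambda>z. (z - y 0) * q z) = (\<lambda>z. p z - p (y 0))" by (rule ext) (simp add: q_def)
    ultimately have "\<xi> (\<lambda>z. p z - p (y 0)) = 0" by simp
    then show ?thesis
      using cheese.char_diff[OF chi uclosure_base[OF p] cheese.cl_const, of "p (y 0)"] cheese.char_const[OF chi] by simp
  qed
  have chi_eval: "\<xi> g = g (y 0)" if "g \<in> cheese.cl" for g
    using cheese.char_eval[OF chi yK chiG that] .
  have yX: "y \<in> cover"
    unfolding cover_def
  proof (intro CollectI conjI allI yK)
    fix j
    have "y (Suc j) ^ root_degree j = \<psi> (\<lambda>s. s (Suc j) ^ root_degree j)"
      unfolding y_def by (rule cover.char_power[OF ch coord_cl, symmetric])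
    also have "\<dots> = \<xi> (radicand j)" unfolding \<xi>_def by (rule chs(4)) (rule cover_Suc)
    also have "\<dots> = radicand j (y 0)" by (rule chi_eval[OF radicand(1)])
    finally show "y (Suc j) ^ root_degree j = radicand j (y 0)" .
  qed
  have "\<psi> p = p y" if "p \<in> cover_poly" for p
    using that
  proof (induction rule: cover_poly.induct)
    case (monom g N \<alpha>)
    have "\<psi> (cover_monom g N \<alpha>) = \<psi> (\<lambda>s. g (s 0)) * \<psi> (\<lambda>s. \<Prod>j<N. s (Suc j) ^ \<alpha> j)"
      unfolding cover_monom_def[abs_def]
      by (rule chs(2)) (intro base_cl monom cover.cl_prod cover.cl_power coord_cl finite_lessThan)+
    also have "\<psi> (\<lambda>s. \<Prod>j<N. s (Suc j) ^ \<alpha> j) = (\<Prod>j<N. \<psi> (\<lambda>s. s (Suc j) ^ \<alpha> j))"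
      by (rule cover.char_prod[OF ch]) (intro cover.cl_power coord_cl finite_lessThan)+
    also have "\<dots> = (\<Prod>j<N. y (Suc j) ^ \<alpha> j)"
      unfolding y_def by (intro prod.cong refl cover.char_power[OF ch coord_cl])
    also have "\<psi> (\<lambda>s. g (s 0)) = g (y 0)" using chi_eval[OF monom] by (simp add: \<xi>_def)
    finally show ?case by (simp add: cover_monom_def)
  next
    case (add f g)
    then show ?case using chs(1)[OF uclosure_base uclosure_base] by simp
  qed
  then show ?thesis using yX by blast
qed

section \<open>Separation, bumps and peak functions on the cover\<close>

lemma cheese_bump:
  assumes x: "x \<in> cheese" and V: "open V" "x \<in> V"
  shows "\<exists>e U. e \<in> cheese.cl \<and> open U \<and> x \<in> U \<and> (\<forall>z\<in>cheese \<inter> U. e z = 1) \<and> (\<forall>z\<in>cheese - V. e z = 0)"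
proof -
  have "compact (cheese - V)" using compact_cheese V(1) by (simp add: compact_diff)
  moreover have "cheese - V \<subseteq> cheese" "x \<notin> cheese - V" using V by auto
  ultimately have "\<exists>L U. open U \<and> x \<in> U \<and> (\<forall>z\<in>cheese \<inter> U. cut_prod L z = 1) \<and> (\<forall>z\<in>cheese - V. cut_prod L z = 0)"
    by (rule cut_prod_separates[OF x])
  then obtain L U where "open U \<and> x \<in> U \<and> (\<forall>z\<in>cheese \<inter> U. cut_prod L z = 1) \<and> (\<forall>z\<in>cheese - V. cut_prod L z = 0)"
    by (elim exE)
  then show ?thesis using cut_prod_cl by (intro exI[of _ "cut_prod L"] exI[of _ U]) simp
qed

lemma compact_preimage:
  fixes f :: "'a::metric_space \<Rightarrow> 'b::topological_space"
  assumes "compact S" "continuous_on S f" "closed T"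
  shows "compact (S \<inter> f -` T)"
  using compact_Int_closed[OF assms(1) continuous_closed_preimage[OF assms(2) compact_imp_closed[OF assms(1)] assms(3)]]
  by (simp add: Int_absorb1)

lemma cover_eqI:
  assumes "s \<in> cover" "t \<in> cover" "s 0 = t 0" "\<And>j. s (Suc j) = t (Suc j)"
  shows "s = t"
proof
  fix i show "s i = t i" using assms(3,4) by (cases i) auto
qed

text \<open>Points of one fibre differ in some root \<open>c\<close>, and the average of the powers
  of \<open>s (Suc j) / c\<close> is \<open>1\<close> at \<open>c\<close> and, as a geometric sum,
  \<open>0\<close> at the other roots. Near the fibre it is close to \<open>0\<close> or
  \<open>1\<close>, and \<open>indicator_of_near_01\<close> makes it exact; the cutoff
  \<open>e\<close> localizes to such a neighbourhood.\<close>

lemma fibre_idempotent: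
  assumes y: "y \<in> cover" and w: "w \<in> cover" and eq: "y 0 = w 0" and ne: "y \<noteq> w"
  shows "\<exists>f V. f \<in> cover.cl \<and> open V \<and> y 0 \<in> V \<and> (\<forall>s\<in>cover. s 0 \<in> V \<longrightarrow> f s = 0 \<or> f s = 1) \<and> f y = 1 \<and> f w = 0"
proof -
  obtain j where j: "y (Suc j) \<noteq> w (Suc j)" using cover_eqI[OF y w eq] ne by blast
  define d c where "d = root_degree j" and "c = y (Suc j)"
  have d: "d > 0" using radicand(3) by (simp add: d_def)
  have fib: "s (Suc j) ^ d = c ^ d" if "s \<in> cover" "s 0 = y 0" for s
    using cover_Suc[OF that(1), of j] cover_Suc[OF y, of j] that(2) by (simp add: d_def c_def)
  have c0: "c \<noteq> 0"
  proof
    assume c: "c = 0"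
    then have "w (Suc j) ^ d = 0" using fib[OF w eq[symmetric]] d by simp
    then show False using j c by (simp add: c_def)
  qed
  define p where "p s = (1 / of_nat d) * (\<Sum>i<d. (inverse c * s (Suc j)) ^ i)" for s :: "nat \<Rightarrow> complex"
  have pcl: "p \<in> cover.cl"
    unfolding p_def by (intro cover.cl_scale cover.cl_sum cover.cl_power coord_cl finite_lessThan)
  have p1: "p s = 1" if "s (Suc j) = c" for s using that c0 d by (simp add: p_def)
  have p0: "p s = 0" if "s \<in> cover" "s 0 = y 0" "s (Suc j) \<noteq> c" for s
  proof -
    define v where "v = inverse c * s (Suc j)"
    have v1: "v \<noteq> 1" using that(3) c0 by (simp add: v_def field_simps)
    have "v ^ d = 1" unfolding v_def power_mult_distrib fib[OF that(1,2)] using c0 by (simp add: power_inverse)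
    then have "(\<Sum>i<d. v ^ i) = 0" using geometric_sum[OF v1, of d] by simp
    then show ?thesis by (simp add: p_def v_def)
  qed
  define C where "C = cover \<inter> p -` {w. 1/8 \<le> cmod w \<and> 1/8 \<le> cmod (1 - w)}"
  have "compact C"
    unfolding C_def
    by (rule compact_preimage[OF compact_cover cover.cl_cont[OF pcl]]) (intro closed_Collect_conj closed_Collect_le continuous_intros)
  moreover have "s 0 \<noteq> y 0" if "s \<in> C" for s
    using that p0[of s] p1[of s] by (cases "s (Suc j) = c") (auto simp: C_def)
  ultimately obtain V where V: "open V" "y 0 \<in> V" "\<And>s. s \<in> C \<Longrightarrow> s 0 \<notin> V"
    using closed_fibre_image[of C "y 0"] by (auto simp: C_def)
  obtain e U where eU: "e \<in> cheese.cl" "open U" "y 0 \<in> U" "\<And>z. z \<in> cheese \<inter> U \<Longrightarrow> e z = 1" "\<And>z. z \<in> cheese - V \<Longrightarrow> e z = 0"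
    using cheese_bump[OF cover_0[OF y] V(1,2)] by (elim exE conjE) blast
  define f where "f s = (if cmod (1 - p s) \<le> 1/8 then e (s 0) else 0)" for s
  have "f \<in> cover.cl"
    unfolding f_def
  proof (rule cover.indicator_of_near_01[OF pcl base_cl[OF eU(1)], where V = "{s. s 0 \<in> V}"])
    show "e (s 0) = 0" if "s \<in> cover" "s \<notin> {s. s 0 \<in> V}" for s using that eU(5)[of "s 0"] cover_0 by auto
    show "cmod (p s) \<le> 1/8 \<or> cmod (1 - p s) \<le> 1/8" if "s \<in> cover" "s \<in> {s. s 0 \<in> V}" for s
      using V(3)[of s] that by (force simp: C_def)
  qed
  moreover have "f s = 0 \<or> f s = 1" if "s \<in> cover" "s 0 \<in> U" for s
    using eU(4)[of "s 0"] cover_0[OF that(1)] that(2) by (simp add: f_def)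
  moreover have "f y = 1" using p1[of y] eU(3) eU(4)[of "y 0"] cover_0[OF y] by (simp add: f_def c_def)
  moreover have "f w = 0" using p0[OF w eq[symmetric]] j by (simp add: f_def c_def)
  ultimately show ?thesis using eU(2,3) by (intro exI[of _ f] exI[of _ U] conjI ballI impI) simp_all
qed

lemma rel_open:
  assumes "f \<in> cover.cl" "open T"
  obtains A where "open A" "\<And>s. s \<in> cover \<Longrightarrow> s \<in> A \<longleftrightarrow> f s \<in> T"
proof -
  obtain A where "open A" "A \<inter> cover = f -` T \<inter> cover"
    using cover.cl_cont[OF assms(1)] assms(2) unfolding continuous_on_open_invariant by blast
  then show ?thesis by (intro that[of A]) auto
qed

lemma open_coord: "open V \<Longrightarrow> open {s :: nat \<Rightarrow> complex. s 0 \<in> V}"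
  using open_vimage[of V "\<lambda>s :: nat \<Rightarrow> complex. s 0"] continuous_on_coord[of UNIV 0] by (simp add: vimage_def)

text \<open>Different base points are separated by a cutoff. Within a fibre an idempotent does it:
  over \<open>V\<close> it takes only the values \<open>0\<close> and \<open>1\<close>, so being
  within \<open>1/2\<close> of one of them means equality.\<close>

lemma cover_separate:
  assumes y: "y \<in> cover" and w: "w \<in> cover" and ne: "y \<noteq> w"
  shows "\<exists>f\<in>cover.cl. \<exists>U V. open U \<and> open V \<and> y \<in> U \<and> w \<in> V \<and> (\<forall>t\<in>cover \<inter> U. f t = 1) \<and> (\<forall>t\<in>cover \<inter> V. f t = 0)"
proof (cases "y 0 = w 0")
  case False
  obtain p U V where p: "open U" "open V" "y 0 \<in> U" "w 0 \<in> V" "\<And>z. z \<in> cheese \<inter> U \<Longrightarrow> cut_factor p z = 1" "\<And>z. z \<in> cheese \<inter> V \<Longrightarrow> cut_factor p z = 0"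
    using cut_factor_separates[OF cover_0[OF y] cover_0[OF w] False] by (elim exE conjE) blast
  show ?thesis
  proof (intro bexI[OF _ base_cl[OF cut_factor_cl[of p]]] exI conjI ballI)
    show "open {s :: nat \<Rightarrow> complex. s 0 \<in> U}" "open {s :: nat \<Rightarrow> complex. s 0 \<in> V}" using p(1,2) by (simp_all add: open_coord)
    show "y \<in> {s. s 0 \<in> U}" "w \<in> {s. s 0 \<in> V}" using p(3,4) by simp_all
    show "cut_factor p (t 0) = 1" if "t \<in> cover \<inter> {s. s 0 \<in> U}" for t using p(5)[of "t 0"] that cover_0 by simp
    show "cut_factor p (t 0) = 0" if "t \<in> cover \<inter> {s. s 0 \<in> V}" for t using p(6)[of "t 0"] that cover_0 by simp
  qed
next
  case True
  obtain f V where f: "f \<in> cover.cl" "open V" "y 0 \<in> V" "\<And>s. s \<in> cover \<Longrightarrow> s 0 \<in> V \<Longrightarrow> f s = 0 \<or> f s = 1" "f y = 1" "f w = 0"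
    using fibre_idempotent[OF y w True ne] by (elim exE conjE) blast
  obtain A where A: "open A" "\<And>s. s \<in> cover \<Longrightarrow> s \<in> A \<longleftrightarrow> f s \<in> ball 1 (1/2)"
    by (rule rel_open[OF f(1) open_ball[of 1 "1/2"]]) (rule that)
  obtain B where B: "open B" "\<And>s. s \<in> cover \<Longrightarrow> s \<in> B \<longleftrightarrow> f s \<in> ball 0 (1/2)"
    by (rule rel_open[OF f(1) open_ball[of 0 "1/2"]]) (rule that)
  show ?thesis
  proof (intro bexI[OF _ f(1)] exI conjI ballI)
    show "open (A \<inter> {s. s 0 \<in> V})" "open (B \<inter> {s. s 0 \<in> V})" using A(1) B(1) f(2) open_coord by (simp_all add: open_Int)
    show "y \<in> A \<inter> {s. s 0 \<in> V}" using A(2)[OF y] f(3,5) by simp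
    show "w \<in> B \<inter> {s. s 0 \<in> V}" using B(2)[OF w] f(3,6) True by simp
    show "f t = 1" if "t \<in> cover \<inter> (A \<inter> {s. s 0 \<in> V})" for t using A(2)[of t] f(4)[of t] that by (auto simp: dist_norm)
    show "f t = 0" if "t \<in> cover \<inter> (B \<inter> {s. s 0 \<in> V})" for t using B(2)[of t] f(4)[of t] that by (auto simp: dist_norm)
  qed
qed

text \<open>The bump is a normalized root times idempotents. The root has norm at most
  \<open>1 + e\<close> and lives over a small set of base points, where the idempotents have modulus
  at most \<open>1\<close> and remove the rest of the fibre; so localizing within the fibre costs
  nothing in norm.\<close>

lemma cover_bump:
  assumes y: "y \<in> cover" and y0: "y 0 \<noteq> 0" and W: "open W" "y \<in> W" and e: "e > 0"
  shows "\<exists>f\<in>cover.cl. f y = 1 \<and> (\<forall>s\<in>cover. cmod (f s) \<le> 1 + e) \<and> (\<forall>s\<in>cover - W. f s = 0)"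
proof -
  define C where "C = (cover - W) \<inter> (\<lambda>s. s 0) -` {y 0}"
  have XW: "compact (cover - W)" using compact_cover W(1) by (rule compact_diff)
  have cC: "compact C" unfolding C_def by (rule compact_preimage[OF XW continuous_on_coord]) simp
  have "\<forall>w\<in>C. \<exists>f V A. f \<in> cover.cl \<and> open V \<and> y 0 \<in> V \<and> (\<forall>s\<in>cover. s 0 \<in> V \<longrightarrow> f s = 0 \<or> f s = 1) \<and> f y = 1 \<and>
      open A \<and> w \<in> A \<and> (\<forall>s\<in>cover. s \<in> A \<longrightarrow> cmod (f s) < 1/2)"
  proof
    fix w assume "w \<in> C"
    then have w: "w \<in> cover" "y 0 = w 0" "y \<noteq> w" using W(2) by (auto simp: C_def)
    obtain f V where f: "f \<in> cover.cl" "open V" "y 0 \<in> V" "\<forall>s\<in>cover. s 0 \<in> V \<longrightarrow> f s = 0 \<or> f s = 1" "f y = 1" "f w = 0"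
      using fibre_idempotent[OF y w] by (elim exE conjE) blast
    obtain A where A: "open A" "\<And>s. s \<in> cover \<Longrightarrow> s \<in> A \<longleftrightarrow> f s \<in> ball 0 (1/2)"
    by (rule rel_open[OF f(1) open_ball[of 0 "1/2"]]) (rule that)
    have "w \<in> A" using A(2)[OF w(1)] f(6) by simp
    moreover have "\<forall>s\<in>cover. s \<in> A \<longrightarrow> cmod (f s) < 1/2" using A(2) by simp
    ultimately show "\<exists>f V A. f \<in> cover.cl \<and> open V \<and> y 0 \<in> V \<and> (\<forall>s\<in>cover. s 0 \<in> V \<longrightarrow> f s = 0 \<or> f s = 1) \<and> f y = 1 \<and>
      open A \<and> w \<in> A \<and> (\<forall>s\<in>cover. s \<in> A \<longrightarrow> cmod (f s) < 1/2)"
      using f A(1) by (intro exI[of _ f] exI[of _ V] exI[of _ A] conjI)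
  qed
  then obtain f V A where f: "\<And>w. w \<in> C \<Longrightarrow> f w \<in> cover.cl \<and> open (V w) \<and> y 0 \<in> V w \<and>
      (\<forall>s\<in>cover. s 0 \<in> V w \<longrightarrow> f w s = 0 \<or> f w s = 1) \<and> f w y = 1 \<and> open (A w) \<and> w \<in> A w \<and> (\<forall>s\<in>cover. s \<in> A w \<longrightarrow> cmod (f w s) < 1/2)"
    by metis
  then obtain D where D: "D \<subseteq> C" "finite D" "C \<subseteq> (\<Union>w\<in>D. A w)"
    using compactE_image[OF cC, of C A] by (metis UN_I subsetI)
  note fD = subsetD[OF D(1), THEN f]
  have oA: "open (\<Union>w\<in>D. A w)" using fD by (intro open_UN) simp
  \<comment> \<open>What the sets \<open>A w\<close> leave of \<open>cover - W\<close> is compact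
    and misses the fibre of \<open>y\<close>, so a neighbourhood \<open>V2\<close> of the base point
    removes it.\<close>
  define R where "R = (cover - W) - (\<Union>w\<in>D. A w)"
  have cR: "compact R" unfolding R_def using XW oA by (rule compact_diff)
  have RX: "R \<subseteq> cover" by (auto simp: R_def)
  have Ry: "s 0 \<noteq> y 0" if s: "s \<in> R" for s
  proof
    assume "s 0 = y 0"
    then have "s \<in> C" using s by (auto simp: R_def C_def)
    then show False using D(3) s by (auto simp: R_def)
  qed
  have "\<exists>V. open V \<and> y 0 \<in> V \<and> (\<forall>s\<in>R. s 0 \<notin> V)" using cR RX Ry by (rule closed_fibre_image)
  then obtain V2 where V2: "open V2" "y 0 \<in> V2" "\<forall>s\<in>R. s 0 \<notin> V2" by (elim exE conjE)
  define V1 where "V1 = (\<Inter>w\<in>D. V w) \<inter> V2"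
  have "open (\<Inter>w\<in>D. V w)" using fD D(2) by (intro open_INT) simp_all
  then have V1: "open V1" "y 0 \<in> V1" unfolding V1_def using V2 fD by (simp_all add: open_Int)
  obtain j where j: "radicand j (y 0) = 1" "\<And>z. z \<in> cheese - V1 \<Longrightarrow> radicand j z = 0" "\<And>z. z \<in> cheese \<Longrightarrow> cmod (radicand j z) \<le> (1 + e) ^ root_degree j"
    using radicand_peak[OF cover_0[OF y] y0 V1 e] by (elim exE conjE) blast
  have d: "root_degree j > 0" by (rule radicand(3))
  have ny: "cmod (y (Suc j)) = 1"
  proof (rule power_eq_imp_eq_base[OF _ _ _ d])
    show "cmod (y (Suc j)) ^ root_degree j = 1 ^ root_degree j" using cover_Suc[OF y, of j] j(1) by (simp flip: norm_power)
  qed auto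
  have ns: "cmod (s (Suc j)) \<le> 1 + e" if "s \<in> cover" for s
  proof -
    have "cmod (s (Suc j)) ^ root_degree j \<le> (1 + e) ^ root_degree j"
      using cover_Suc[OF that, of j] j(3)[OF cover_0[OF that]] by (simp flip: norm_power)
    then show ?thesis using d e by (subst (asm) power_mono_iff) auto
  qed
  define p where "p s = (\<Prod>w\<in>D. f w s)" for s
  define g where "g s = inverse (y (Suc j)) * s (Suc j) * p s" for s
  have pcl: "p \<in> cover.cl" unfolding p_def using fD D(2) by (intro cover.cl_prod) simp_all
  have gcl: "g \<in> cover.cl" unfolding g_def by (intro cover.cl_mult cover.cl_scale coord_cl pcl)
  have py: "p y = 1" unfolding p_def using fD by (intro prod.neutral) simp
  have "y (Suc j) \<noteq> 0" using ny by auto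
  then have gy: "g y = 1" using py by (simp add: g_def)
  have off: "g s = 0" if s: "s \<in> cover" "s 0 \<notin> V1" for s
  proof -
    have "s (Suc j) ^ root_degree j = 0" using cover_Suc[OF s(1), of j] j(2)[of "s 0"] cover_0[OF s(1)] s(2) by simp
    then show ?thesis by (simp add: g_def)
  qed
  have p01: "f w s = 0 \<or> f w s = 1" if "s \<in> cover" "s 0 \<in> V1" "w \<in> D" for s w
    using fD[OF that(3)] that(1,2,3) unfolding V1_def by blast
  have "cmod (g s) \<le> 1 + e" if s: "s \<in> cover" for s
  proof (cases "s 0 \<in> V1")
    case True
    have "cmod (p s) \<le> 1" unfolding p_def prod_norm[symmetric]
      by (rule prod_le_1) (use p01[of s, OF s True] in force)
    then have "cmod (s (Suc j)) * cmod (p s) \<le> (1 + e) * 1" using ns[OF s] e by (intro mult_mono) auto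
    then show ?thesis by (simp add: g_def norm_mult norm_inverse ny)
  qed (use off[OF s] e in simp)
  moreover have "g s = 0" if s: "s \<in> cover - W" for s
  proof (cases "s 0 \<in> V1")
    case True
    then have "s \<notin> R" using V2(3) by (auto simp: V1_def)
    then obtain w where w: "w \<in> D" "s \<in> A w" using s by (auto simp: R_def)
    have "cmod (f w s) < 1/2" using fD[OF w(1)] w(2) s by simp
    then have "f w s = 0" using p01[of s w] True w(1) s by auto
    then have "p s = 0" unfolding p_def using D(2) w(1) by (intro prod_zero) auto
    then show ?thesis by (simp add: g_def)
  qed (use off s in simp)
  ultimately show ?thesis using gcl gy by (intro bexI[of _ g] conjI ballI)
qed

text \<open>Over \<open>0\<close> the function \<open>1 / (1 + z)\<close> peaks, since
  \<open>Re z \<ge> 0\<close> on the cheese, and it does so at a single point because every radicand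
  vanishes at \<open>0\<close>. Elsewhere bumps of norm at most \<open>1 + 1/4\<close> feed the
  summation.\<close>

lemma cover_peak:
  assumes y: "y \<in> cover"
  shows "\<exists>f\<in>cover.cl. f y = 1 \<and> (\<forall>s\<in>cover - {y}. cmod (f s) < 1)"
proof (cases "y 0 = 0")
  case False
  show ?thesis
  proof (rule cover.peak_function_exists[OF y])
    fix r :: real assume "r > 0"
    then show "\<exists>f\<in>cover.cl. f y = 1 \<and> (\<forall>s\<in>cover. cmod (f s) \<le> 5/4) \<and> (\<forall>s\<in>cover - ball y r. f s = 0)"
      using cover_bump[OF y False open_ball, of y r "1/4"] by simp
  qed
next
  case True
  have one: "1 < cmod (1 + z)" if z: "z \<in> cheese" "z \<noteq> 0" for z
  proof -
    have "0 \<le> Re z" using z by (simp add: cheese_def in_frame)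
    moreover have "(1 + Re z)\<^sup>2 = 1 + 2 * Re z + (Re z)\<^sup>2" by (simp add: power2_sum)
    moreover have "Re z \<noteq> 0 \<or> 0 < (Im z)\<^sup>2" using z(2) by (auto simp: complex_eq_iff)
    ultimately have "1 < (1 + Re z)\<^sup>2 + (Im z)\<^sup>2"
      using zero_le_power2[of "Re z"] zero_le_power2[of "Im z"] by linarith
    then show ?thesis by (simp add: cmod_def)
  qed
  have "(\<lambda>z. 1 / (1 + z)) \<in> mero"
  proof (rule meroI[of "{-1}"])
    show "{-1} \<inter> cheese = {}" by (simp add: cheese_def in_frame)
    show "(\<lambda>z. 1 / (1 + z)) holomorphic_on ball 0 4 - {-1}"
      by (intro holomorphic_intros) (auto simp: add_eq_0_iff)
  qed simp
  then have g: "(\<lambda>s. 1 / (1 + s 0)) \<in> cover.cl" by (rule base_cl[OF uclosure_base])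
  have "cmod (1 / (1 + s 0)) < 1" if s: "s \<in> cover - {y}" for s
  proof -
    have "s 0 \<noteq> 0"
    proof
      assume s0: "s 0 = 0"
      have z: "t (Suc j) = 0" if "t \<in> cover" "t 0 = 0" for t j
      proof -
        have "t (Suc j) ^ root_degree j = 0" using cover_Suc[OF that(1), of j] that(2) radicand(2) by simp
        then show ?thesis by simp
      qed
      have sX: "s \<in> cover" using s by simp
      have "s = y" by (rule cover_eqI[OF sX y]) (simp_all only: s0 True z[OF sX s0] z[OF y True])
      then show False using s by simp
    qed
    then have "1 < cmod (1 + s 0)" using one cover_0 s by simp
    moreover from this have "0 < cmod (1 + s 0)" by linarith
    ultimately show ?thesis by (simp only: norm_divide norm_one divide_less_eq_1_pos)
  qed
  then show ?thesis using True by (intro bexI[OF _ g]) simp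
qed

subsection \<open>Averaging over the fibres\<close>

definition unit_root :: "nat \<Rightarrow> complex" where "unit_root j = exp (2 * of_real pi * \<i> * of_nat 1 / of_nat (root_degree j))"

lemma unit_root_power: "unit_root j ^ n = 1 \<longleftrightarrow> root_degree j dvd n"
proof -
  have "unit_root j ^ n = exp (2 * of_real pi * \<i> * of_nat n / of_nat (root_degree j))"
    unfolding unit_root_def by (simp add: mult_ac flip: exp_of_nat_mult)
  then show ?thesis using complex_root_unity_eq_1[of "root_degree j" n] radicand(3)[of j] by simp
qed

definition rot :: "nat \<Rightarrow> nat \<Rightarrow> (nat \<Rightarrow> complex) \<Rightarrow> nat \<Rightarrow> complex" where
  "rot j k s = s(Suc j := unit_root j ^ k * s (Suc j))"

lemma rot_0 [simp]: "rot j k s 0 = s 0" by (simp add: rot_def)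

lemma rot_cover: "s \<in> cover \<Longrightarrow> rot j k s \<in> cover"
proof -
  assume s: "s \<in> cover"
  have "(unit_root j ^ k) ^ root_degree j = 1" using unit_root_power[of j "k * root_degree j"] by (simp flip: power_mult)
  then show ?thesis using s by (auto simp: cover_def rot_def power_mult_distrib)
qed

definition rot_avg :: "nat \<Rightarrow> ((nat \<Rightarrow> complex) \<Rightarrow> complex) \<Rightarrow> (nat \<Rightarrow> complex) \<Rightarrow> complex" where
  "rot_avg j f s = (\<Sum>k<root_degree j. f (rot j k s)) / of_nat (root_degree j)"

primrec rot_avgs :: "nat \<Rightarrow> ((nat \<Rightarrow> complex) \<Rightarrow> complex) \<Rightarrow> (nat \<Rightarrow> complex) \<Rightarrow> complex" where
  "rot_avgs 0 f = f"
| "rot_avgs (Suc N) f = rot_avg N (rot_avgs N f)"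

text \<open>The rotations stay in the fibre over \<open>z\<close>, on which \<open>c\<close> is
  constant. The bound is used with \<open>c = z\<close> for closeness to the base coordinate and
  with \<open>c = 0\<close> near the origin.\<close>

lemma rot_avg_bound:
  assumes f: "\<And>s. s \<in> cover \<Longrightarrow> s 0 = z \<Longrightarrow> cmod (f s - c) \<le> B" and s: "s \<in> cover" "s 0 = z"
  shows "cmod (rot_avg j f s - c) \<le> B"
proof -
  let ?d = "root_degree j"
  have d: "?d > 0" by (rule radicand(3))
  have "rot_avg j f s - c = (\<Sum>k<?d. f (rot j k s) - c) / of_nat ?d"
    using d by (simp add: rot_avg_def sum_subtractf field_simps)
  then have "cmod (rot_avg j f s - c) = cmod (\<Sum>k<?d. f (rot j k s) - c) / of_nat ?d" by (simp add: norm_divide)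
  also have "cmod (\<Sum>k<?d. f (rot j k s) - c) \<le> of_nat (card {..<?d}) * B"
    by (rule sum_norm_bound) (use f rot_cover[OF s(1)] s(2) in simp)
  then have "cmod (\<Sum>k<?d. f (rot j k s) - c) / of_nat ?d \<le> B" using d by (simp add: divide_le_eq mult.commute)
  finally show ?thesis .
qed

lemma rot_avgs_bound:
  assumes f: "\<And>s. s \<in> cover \<Longrightarrow> s 0 = z \<Longrightarrow> cmod (f s - c) \<le> B"
  shows "s \<in> cover \<Longrightarrow> s 0 = z \<Longrightarrow> cmod (rot_avgs N f s - c) \<le> B"
proof (induction N arbitrary: s)
  case 0
  then show ?case using f by simp
next
  case (Suc N)
  show ?case unfolding rot_avgs.simps by (rule rot_avg_bound[of z]) (rule Suc.IH, assumption+, rule Suc.prems, rule Suc.prems)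
qed

lemma rot_avgs_add: "rot_avgs N (\<lambda>s. f s + g s) = (\<lambda>s. rot_avgs N f s + rot_avgs N g s)"
  by (induction N) (simp_all add: rot_avg_def sum.distrib add_divide_distrib fun_eq_iff)

lemma cover_monom_rot: "cover_monom g N \<alpha> (rot j k s) = cover_monom g N \<alpha> s * (if j < N then (unit_root j ^ \<alpha> j) ^ k else 1)"
proof -
  have "rot j k s (Suc i) ^ \<alpha> i = s (Suc i) ^ \<alpha> i * (if i = j then (unit_root j ^ \<alpha> j) ^ k else 1)" for i
    by (simp add: rot_def power_mult_distrib mult.commute flip: power_mult)
  then have "(\<Prod>i<N. rot j k s (Suc i) ^ \<alpha> i) = (\<Prod>i<N. s (Suc i) ^ \<alpha> i) * (\<Prod>i<N. if i = j then (unit_root j ^ \<alpha> j) ^ k else 1)"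
    by (simp add: prod.distrib)
  then show ?thesis by (simp add: cover_monom_def)
qed

text \<open>The terms of the average form a geometric sum of roots of unity, which cancels unless
  the exponent of the \<open>j\<close>-th root is a multiple of its degree.\<close>

lemma rot_avg_cover_monom: "rot_avg j (cover_monom g N \<alpha>) s = (if j < N \<and> \<not> root_degree j dvd \<alpha> j then 0 else cover_monom g N \<alpha> s)"
proof -
  let ?d = "root_degree j" and ?v = "unit_root j ^ \<alpha> j"
  have d: "?d > 0" by (rule radicand(3))
  have a: "rot_avg j (cover_monom g N \<alpha>) s = cover_monom g N \<alpha> s * (\<Sum>k<?d. if j < N then ?v ^ k else 1) / of_nat ?d"
    unfolding rot_avg_def cover_monom_rot sum_distrib_left ..
  consider "\<not> j < N" | "j < N" "?d dvd \<alpha> j" | "j < N" "\<not> ?d dvd \<alpha> j" by blast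
  then show ?thesis
  proof cases
    case 1
    then show ?thesis using a d by simp
  next
    case 2
    then have "?v = 1" by (simp add: unit_root_power)
    then show ?thesis using a d 2 by simp
  next
    case 3
    then have v1: "?v \<noteq> 1" by (simp add: unit_root_power)
    have "?v ^ ?d = 1" using unit_root_power[of j "\<alpha> j * ?d"] by (simp flip: power_mult)
    then have "(\<Sum>k<?d. ?v ^ k) = 0" using geometric_sum[OF v1, of ?d] by simp
    then show ?thesis using a 3 by simp
  qed
qed

lemma rot_avgs_cover_monom: "rot_avgs M (cover_monom g N \<alpha>) = (\<lambda>s. if \<exists>j<M. j < N \<and> \<not> root_degree j dvd \<alpha> j then 0 else cover_monom g N \<alpha> s)"
proof (induction M)
  case (Suc M)
  show ?case
  proof (cases "\<exists>j<M. j < N \<and> \<not> root_degree j dvd \<alpha> j")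
    case True
    then have "rot_avgs M (cover_monom g N \<alpha>) = (\<lambda>s. 0)" using Suc by simp
    then have "rot_avgs (Suc M) (cover_monom g N \<alpha>) = (\<lambda>s. 0)" by (simp add: rot_avg_def[abs_def])
    moreover have "\<exists>j<Suc M. j < N \<and> \<not> root_degree j dvd \<alpha> j" using True less_SucI by blast
    ultimately show ?thesis by simp
  next
    case False
    have eq: "rot_avgs M (cover_monom g N \<alpha>) = cover_monom g N \<alpha>" unfolding Suc if_not_P[OF False] ..
    have "rot_avgs (Suc M) (cover_monom g N \<alpha>) = (\<lambda>s. if M < N \<and> \<not> root_degree M dvd \<alpha> M then 0 else cover_monom g N \<alpha> s)"
      by (rule ext) (simp only: rot_avgs.simps eq rot_avg_cover_monom)
    moreover have "(\<exists>j<Suc M. j < N \<and> \<not> root_degree j dvd \<alpha> j) \<longleftrightarrow> M < N \<and> \<not> root_degree M dvd \<alpha> M"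
      using False less_Suc_eq by blast
    ultimately show ?thesis by simp
  qed
qed simp

text \<open>Exponents surviving the averages are multiples of the degrees, and the equations of
  \<open>cover\<close> turn those powers into powers of radicands. Stating this for all large
  \<open>N\<close> lets two summands share one \<open>N\<close>.\<close>

lemma rot_avgs_base:
  assumes "p \<in> cover_poly"
  shows "\<exists>N0. \<forall>N\<ge>N0. \<exists>q\<in>cheese.cl. \<forall>s\<in>cover. rot_avgs N p s = q (s 0)"
  using assms
proof (induction rule: cover_poly.induct)
  case (monom g N \<alpha>)
  show ?case
  proof (intro exI[of _ N] allI impI)
    fix M assume M: "N \<le> M"
    show "\<exists>q\<in>cheese.cl. \<forall>s\<in>cover. rot_avgs M (cover_monom g N \<alpha>) s = q (s 0)"
    proof (cases "\<exists>j<M. j < N \<and> \<not> root_degree j dvd \<alpha> j")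
      case True
      then show ?thesis unfolding rot_avgs_cover_monom by (intro bexI[of _ "\<lambda>_. 0"]) simp_all
    next
      case False
      then have dv: "root_degree j dvd \<alpha> j" if "j < N" for j using that M by (meson less_le_trans)
      define q where "q z = g z * (\<Prod>j<N. radicand j z ^ (\<alpha> j div root_degree j))" for z
      have "q \<in> cheese.cl" unfolding q_def
        by (intro cheese.cl_mult cheese.cl_prod cheese.cl_power monom radicand(1) finite_lessThan)
      moreover have "rot_avgs M (cover_monom g N \<alpha>) s = q (s 0)" if s: "s \<in> cover" for s
      proof -
        have "s (Suc j) ^ \<alpha> j = radicand j (s 0) ^ (\<alpha> j div root_degree j)" if "j < N" for j
          using dv[OF that] cover_Suc[OF s, of j] by (metis dvd_mult_div_cancel power_mult)
        then have "cover_monom g N \<alpha> s = q (s 0)" unfolding cover_monom_def q_def by simp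
        then show ?thesis unfolding rot_avgs_cover_monom if_not_P[OF False] .
      qed
      ultimately show ?thesis by blast
    qed
  qed
next
  case (add f g)
  obtain N1 where N1: "\<And>N. N \<ge> N1 \<Longrightarrow> \<exists>q\<in>cheese.cl. \<forall>s\<in>cover. rot_avgs N f s = q (s 0)" using add.IH(1) by blast
  obtain N2 where N2: "\<And>N. N \<ge> N2 \<Longrightarrow> \<exists>q\<in>cheese.cl. \<forall>s\<in>cover. rot_avgs N g s = q (s 0)" using add.IH(2) by blast
  show ?case
  proof (intro exI[of _ "max N1 N2"] allI impI)
    fix N assume N: "max N1 N2 \<le> N"
    obtain q1 where q1: "q1 \<in> cheese.cl" "\<forall>s\<in>cover. rot_avgs N f s = q1 (s 0)" using N1[of N] N by auto
    obtain q2 where q2: "q2 \<in> cheese.cl" "\<forall>s\<in>cover. rot_avgs N g s = q2 (s 0)" using N2[of N] N by auto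
    show "\<exists>q\<in>cheese.cl. \<forall>s\<in>cover. rot_avgs N (\<lambda>s. f s + g s) s = q (s 0)"
      by (rule bexI[OF _ cheese.cl_add[OF q1(1) q2(1)]]) (use q1(2) q2(2) in \<open>simp add: rot_avgs_add\<close>)
  qed
qed

lemma cover_surj:
  assumes z: "z \<in> cheese" shows "\<exists>s\<in>cover. s 0 = z"
proof -
  have "\<exists>r. r ^ root_degree j = radicand j z" for j
    using exists_complex_root[of "root_degree j" "radicand j z"] radicand(3)[of j] by (metis less_numeral_extra(3))
  then obtain r where r: "\<And>j. r j ^ root_degree j = radicand j z" by metis
  define s where "s i = (case i of 0 \<Rightarrow> z | Suc j \<Rightarrow> r j)" for i
  have "s \<in> cover" using z r by (simp add: cover_def s_def)
  then show ?thesis by (intro bexI[of _ s]) (simp_all add: s_def)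
qed

text \<open>Over \<open>0\<close> there is one point, so \<open>g\<close> vanishes over all points
  of the cheese in some disc. A polynomial close to \<open>g\<close>, averaged over the roots,
  becomes a function on the cheese that is close to \<open>z\<close> and nearly \<open>0\<close> in
  that disc, against \<open>key_estimate\<close>.\<close>

lemma not_approximable:
  assumes g: "g \<in> cover.cl" and U: "open U" "(\<lambda>_. 0) \<in> U" "\<And>s. s \<in> cover \<Longrightarrow> s \<in> U \<Longrightarrow> g s = 0"
    and near: "\<And>s. s \<in> cover \<Longrightarrow> cmod (g s - s 0) \<le> 1/60"
  shows False
proof -
  have z: "s = (\<lambda>_. 0)" if "s \<in> cover" "s 0 = 0" for s
  proof (rule cover_eqI[OF that(1) zero_cover])
    have "s (Suc j) ^ root_degree j = 0" for j using cover_Suc[OF that(1), of j] that(2) radicand(2) by simp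
    then show "s (Suc j) = 0" for j by simp
  qed (rule that(2))
  have "compact (cover - U)" using compact_cover U(1) by (rule compact_diff)
  moreover have "cover - U \<subseteq> cover" by blast
  moreover have "s 0 \<noteq> 0" if "s \<in> cover - U" for s using z[of s] that U(2) by auto
  ultimately have "\<exists>V. open V \<and> 0 \<in> V \<and> (\<forall>s\<in>cover - U. s 0 \<notin> V)" by (rule closed_fibre_image)
  then obtain V where V: "open V" "0 \<in> V" "\<And>s. s \<in> cover - U \<Longrightarrow> s 0 \<notin> V" by (elim exE conjE) blast
  obtain r where r: "r > 0" "ball 0 r \<subseteq> V" using V(1,2) openE by blast
  have g0: "g s = 0" if s: "s \<in> cover" "cmod (s 0) < r" for s
  proof -
    have "s 0 \<in> V" using r(2) s(2) by (intro subsetD[OF r(2)]) simp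
    then have "s \<in> U" using V(3)[of s] s(1) by blast
    then show ?thesis using U(3)[OF s(1)] by blast
  qed
  obtain e where e: "e > 0" "\<not> (\<exists>g\<in>mero. (\<forall>z\<in>cheese. cmod (g z - z) \<le> 1/30) \<and> (\<forall>z\<in>cheese. cmod z < r \<longrightarrow> cmod (g z) \<le> e))"
    using key_estimate[OF r(1)] by blast
  \<comment> \<open>Two approximations cost \<open>d\<close> each, that of \<open>g\<close> by
    \<open>p\<close> and that of \<open>q\<close> by \<open>h\<close>: hence
    \<open>2 * d \<le> e\<close> and \<open>1/60 + 2 * d \<le> 1/30\<close>.\<close>
  define d where "d = min (e / 2) (1 / 120)"
  have d: "d > 0" "d \<le> e / 2" "d \<le> 1/120" using e(1) by (auto simp: d_def)
  obtain p where p: "p \<in> cover_poly" "\<And>s. s \<in> cover \<Longrightarrow> cmod (g s - p s) < d" using uclosureD[OF g d(1)] by blast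
  obtain N q where q: "q \<in> cheese.cl" "\<And>s. s \<in> cover \<Longrightarrow> rot_avgs N p s = q (s 0)" using rot_avgs_base[OF p(1)] by blast
  obtain h where h: "h \<in> mero" "\<And>z. z \<in> cheese \<Longrightarrow> cmod (q z - h z) < d" using uclosureD[OF q(1) d(1)] by blast
  have q1: "cmod (q z - z) \<le> 1/60 + d" if zK: "z \<in> cheese" for z
  proof -
    obtain s where s: "s \<in> cover" "s 0 = z" using cover_surj[OF zK] by blast
    have "cmod (p t - z) \<le> 1/60 + d" if "t \<in> cover" "t 0 = z" for t
      using near[OF that(1)] p(2)[OF that(1)] norm_triangle_ineq4[of "g t - z" "g t - p t"] that(2) by simp
    from rot_avgs_bound[of z p z "1/60 + d" s N, OF this s] show ?thesis using q(2)[OF s(1)] s(2) by simp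
  qed
  have q0: "cmod (q z) \<le> d" if zK: "z \<in> cheese" "cmod z < r" for z
  proof -
    obtain s where s: "s \<in> cover" "s 0 = z" using cover_surj[OF zK(1)] by blast
    have "cmod (p t - 0) \<le> d" if "t \<in> cover" "t 0 = z" for t
      using g0[OF that(1)] p(2)[OF that(1)] that(2) zK(2) by simp
    from rot_avgs_bound[of z p 0 d s N, OF this s] show ?thesis using q(2)[OF s(1)] s(2) by simp
  qed
  have "cmod (h z - z) \<le> 1/30" if "z \<in> cheese" for z
    using q1[OF that] h(2)[OF that] d(3) norm_triangle_ineq4[of "q z - z" "q z - h z"] by simp
  moreover have "cmod (h z) \<le> e" if "z \<in> cheese" "cmod z < r" for z
    using q0[OF that] h(2)[OF that(1)] d(2) norm_triangle_ineq4[of "q z" "q z - h z"] by simp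
  ultimately show False using e(2) h(1) by blast
qed

theorem corollary1p3:
  shows "\<exists>(X :: (nat \<Rightarrow> complex) topology) (A :: ((nat \<Rightarrow> complex) \<Rightarrow> complex) set).
           compact_space X \<and> metrizable_space X \<and>
           normal_uniform_algebra X A \<and>
           (\<forall>x\<in>topspace X. peak_point X A x) \<and>
           \<not> strongly_regular X A"
proof (intro exI conjI)
  let ?X = "top_of_set cover"
  show "compact_space ?X" using compact_cover by (simp add: compact_space_subtopology)
  show "metrizable_space ?X" by (simp add: metrizable_space_subtopology metrizable_space_euclidean)
  have sep: "\<exists>f\<in>cover.cl. f x \<noteq> f y" if xy: "x \<in> cover" "y \<in> cover" "x \<noteq> y" for x y
  proof -
    obtain f U V where f: "f \<in> cover.cl" "x \<in> U" "y \<in> V" "\<forall>t\<in>cover \<inter> U. f t = 1" "\<forall>t\<in>cover \<inter> V. f t = 0"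
      using cover_separate[OF xy] by (elim bexE exE conjE)
    then have "f x = 1" "f y = 0" using xy by simp_all
    then show ?thesis using f(1) by (intro bexI[of _ f]) simp
  qed
  show "normal_uniform_algebra ?X cover.Alg"
    unfolding normal_uniform_algebra_def
    using cover.natural_Alg[OF sep cover_eval] cover.normal_Alg[OF cover_separate] by (rule conjI)
  show "\<forall>x\<in>topspace ?X. peak_point ?X cover.Alg x"
  proof
    fix x assume "x \<in> topspace ?X"
    then have x: "x \<in> cover" by simp
    obtain f where f: "f \<in> cover.cl" "f x = 1" "\<forall>s\<in>cover - {x}. cmod (f s) < 1" using cover_peak[OF x] by blast
    then show "peak_point ?X cover.Alg x"
      unfolding peak_point_def using x by (intro bexI[of _ "restrict f cover"]) simp_all
  qed
  show "\<not> strongly_regular ?X cover.Alg"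
  proof
    let ?o = "\<lambda>_::nat. 0::complex"
    assume "strongly_regular ?X cover.Alg"
    then have eq: "mtopology_of (C_metric ?X) closure_of J_ideal ?X cover.Alg ?o = M_ideal cover.Alg ?o"
      using zero_cover unfolding strongly_regular_def strongly_regular_at_def by simp
    have "J_ideal ?X cover.Alg ?o \<subseteq> mspace (C_metric ?X)"
      using cover.Alg_mspace by (auto simp: J_ideal_def)
    note cl = cover.closure_C[OF this]
    \<comment> \<open>The base coordinate vanishes at the point over \<open>0\<close>; it is the
      element of \<open>M_ideal\<close> out of reach of \<open>J_ideal\<close>.\<close>
    define f where "f = restrict (\<lambda>s :: nat \<Rightarrow> complex. s 0) cover"
    have "f \<in> M_ideal cover.Alg ?o"
      using base_cl[OF uclosure_base[OF mero_id]] zero_cover by (simp add: M_ideal_def f_def)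
    then have "\<forall>e>0. \<exists>g\<in>J_ideal ?X cover.Alg ?o. \<forall>x\<in>cover. cmod (f x - g x) \<le> e"
      unfolding eq[symmetric] cl by simp
    then obtain g where g: "g \<in> J_ideal ?X cover.Alg ?o" "\<forall>x\<in>cover. cmod (f x - g x) \<le> 1/60"
      by (metis zero_less_divide_1_iff zero_less_numeral)
    then obtain U where U: "openin ?X U" "?o \<in> U" "\<forall>y\<in>U. g y = 0" and gA: "g \<in> cover.Alg"
      unfolding J_ideal_def by blast
    obtain W where W: "open W" "U = cover \<inter> W" using U(1) by (auto simp: openin_open)
    show False
    proof (rule not_approximable[OF cover.Alg_cl[OF gA] W(1)])
      show "?o \<in> W" using U(2) W(2) by blast
      show "g s = 0" if "s \<in> cover" "s \<in> W" for s using U(3) W(2) that by blast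
      show "cmod (g s - s 0) \<le> 1/60" if "s \<in> cover" for s
      proof -
        have "cmod (f s - g s) \<le> 1/60" using g(2) that by (rule bspec)
        then show ?thesis unfolding f_def restrict_apply'[OF that] norm_minus_commute[of "g s"] .
      qed
    qed
  qed
qed

end
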